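(* Let $\sigma>0$ and let $\Upsilon$ be an open set with compact closure contained in $\Omega_\sigma$. Then there exist $N\in\mathbb N$ and $\lambda\in\mathbb R$ such that, with $\mathcal K u(x):=-N(N+1)u(x)+\lambda\sum_{i=0}^{N-1}\frac{(x-1)^i}{i!}u^{(i+1)}(1)$, for every $s\in\Upsilon$ and every $f\in Y^\sigma$ there exists a unique $u\in X^\sigma$ with $\frac{d}{dx}\big(x^2\frac{du}{dx}\big)+s\frac{du}{dx}+\mathcal Ku=f$ (and $u(1)=0$). Writing $u=R(s)f$, the map $s\mapsto R(s):Y^\sigma\to X^\sigma$ is a holomorphic family of bounded operators on $\Upsilon$.
   Context: Let $I=(0,1)$. For $\sigma>0$, $u\in C^\infty(\overline I)$, integers $0\le N\le M$, $k\in\{0,1,2\}$, $l\in\{0,1\}$, set $|u|^{N,M}_{\sigma,k,l}=\big(\sum_{n=N}^M\frac{\sigma^{2n}}{n!^2(n+1)!^2}n^{k+l}\int_0^1(x/\sigma)^k|\partial_x^nu|^2dx\big)^{1/2}$ (with $0^0:=1$), $|u|^N_{\sigma,k,l}$ the same with $M=\infty$; $\|u\|_{\sigma,0,0}=|u|^0_{\sigma,0,0}$. Boundary seminorms: $[u]^{N,M}_\sigma=(\sum_{n=N}^M\frac{\sigma^{2n+1}}{n!^2(n+1)!^2}|u^{(n)}(0)|^2)^{1/2}$, $[u]^N_\sigma$ the same with $M=\infty$. $X^\sigma=\{u\in C^\infty(\overline I):u(1)=0,\ \|\partial_xu\|_{\sigma,0,0}+|\partial_xu|^0_{\sigma,1,0}+|\partial_xu|^0_{\sigma,2,0}+[\partial_xu]^0_\sigma<\infty\}$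 and $Y^\sigma=\{u\in C^\infty(\overline I):\|u\|_{\sigma,0,0}+|u|^0_{\sigma,1,0}+[u]^0_\sigma<\infty\}$, Hilbert spaces with norms $\|u\|_{X^\sigma}=(\|\partial_xu\|_{\sigma,0,0}^2+(|\partial_xu|^0_{\sigma,1,0})^2+(|\partial_xu|^0_{\sigma,2,0})^2+([\partial_xu]^0_\sigma)^2)^{1/2}$, $\|u\|_{Y^\sigma}=(\|u\|_{\sigma,0,0}^2+(|u|^0_{\sigma,1,0})^2+([u]^0_\sigma)^2)^{1/2}$. For $\sigma>0$: $\Omega^1_\sigma=\{s:\Re s\le0,\ \sigma<|\Im s|\}\cup\{s:\Re s>0,\ \sigma<|s|\}$; $\Omega^2_\sigma=\{s:\ \sigma<|s|+\Re s,\ \sigma>\frac{-\Re(s)|s|}{2(|s|+\Re s)}\}$; $\Omega^3_\sigma=\{s\neq0:\ \sigma(|s|-\sigma+\Re s)-(\sigma(1+\frac{\Re s}{|s|})+\frac12\Re s)^2>0\}$; $\Omega_\sigma=\Omega^1_\sigma\cap(\Omega^2_\sigma\cup\Omega^3_\sigma)$. *)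

theory Defs
  imports "HOL-Analysis.Analysis"
begin

definition smooth_derivs :: "(real \<Rightarrow> complex) \<Rightarrow> (nat \<Rightarrow> real \<Rightarrow> complex) \<Rightarrow> bool" where
  "smooth_derivs u D \<longleftrightarrow> (\<forall>x\<in>{0..1}. D 0 x = u x) \<and>
     (\<forall>n. \<forall>x\<in>{0..1}. (D n has_vector_derivative D (Suc n) x) (at x within {0..1}))"

definition smooth01 :: "(real \<Rightarrow> complex) \<Rightarrow> bool" where
  "smooth01 u \<longleftrightarrow> (\<exists>D. smooth_derivs u D)"

text \<open>n-th derivative of u on [0,1] (meaningful for smooth01 u, and for x in [0,1]).\<close>
definition nderiv :: "(real \<Rightarrow> complex) \<Rightarrow> nat \<Rightarrow> real \<Rightarrow> complex" where
  "nderiv u n x = (SOME D. smooth_derivs u D) n x"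

definition cterm :: "real \<Rightarrow> nat \<Rightarrow> nat \<Rightarrow> nat \<Rightarrow> (real \<Rightarrow> complex) \<Rightarrow> nat \<Rightarrow> real" where
  "cterm \<sigma> k l d u n =
     \<sigma> ^ (2*n) / ((fact n)^2 * (fact (Suc n))^2) * (real n) ^ (k + l) *
     integral {0..1} (\<lambda>x. (x / \<sigma>) ^ k * (cmod (nderiv u (n + d) x))^2)"

definition bterm :: "real \<Rightarrow> nat \<Rightarrow> (real \<Rightarrow> complex) \<Rightarrow> nat \<Rightarrow> real" where
  "bterm \<sigma> d u n = \<sigma> ^ (2*n+1) / ((fact n)^2 * (fact (Suc n))^2) * (cmod (nderiv u (n + d) 0))^2"

definition Xsp :: "real \<Rightarrow> (real \<Rightarrow> complex) set" where
  "Xsp \<sigma> = {u. smooth01 u \<and> u 1 = 0 \<and> summable (cterm \<sigma> 0 0 1 u) \<and> summable (cterm \<sigma> 1 0 1 u)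
              \<and> summable (cterm \<sigma> 2 0 1 u) \<and> summable (bterm \<sigma> 1 u)}"

definition Xnorm :: "real \<Rightarrow> (real \<Rightarrow> complex) \<Rightarrow> real" where
  "Xnorm \<sigma> u = sqrt (suminf (cterm \<sigma> 0 0 1 u) + suminf (cterm \<sigma> 1 0 1 u)
                      + suminf (cterm \<sigma> 2 0 1 u) + suminf (bterm \<sigma> 1 u))"

definition Ysp :: "real \<Rightarrow> (real \<Rightarrow> complex) set" where
  "Ysp \<sigma> = {u. smooth01 u \<and> summable (cterm \<sigma> 0 0 0 u) \<and> summable (cterm \<sigma> 1 0 0 u)
              \<and> summable (bterm \<sigma> 0 u)}"

definition Ynorm :: "real \<Rightarrow> (real \<Rightarrow> complex) \<Rightarrow> real" where
  "Ynorm \<sigma> u = sqrt (suminf (cterm \<sigma> 0 0 0 u) + suminf (cterm \<sigma> 1 0 0 u) + suminf (bterm \<sigma> 0 u))"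

definition Omega1 :: "real \<Rightarrow> complex set" where
  "Omega1 \<sigma> = {s. Re s \<le> 0 \<and> \<sigma> < \<bar>Im s\<bar>} \<union> {s. Re s > 0 \<and> \<sigma> < cmod s}"

definition Omega2 :: "real \<Rightarrow> complex set" where
  "Omega2 \<sigma> = {s. \<sigma> < cmod s + Re s \<and> \<sigma> > - Re s * cmod s / (2 * (cmod s + Re s))}"

definition Omega3 :: "real \<Rightarrow> complex set" where
  "Omega3 \<sigma> = {s. s \<noteq> 0 \<and>
      \<sigma> * (cmod s - \<sigma> + Re s) - (\<sigma> * (1 + Re s / cmod s) + Re s / 2)^2 > 0}"

definition Omega :: "real \<Rightarrow> complex set" where
  "Omega \<sigma> = Omega1 \<sigma> \<inter> (Omega2 \<sigma> \<union> Omega3 \<sigma>)"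

definition Lop :: "nat \<Rightarrow> real \<Rightarrow> complex \<Rightarrow> (real \<Rightarrow> complex) \<Rightarrow> real \<Rightarrow> complex" where
  "Lop N lam s u x =
     of_real (2 * x) * nderiv u 1 x + of_real (x^2) * nderiv u 2 x + s * nderiv u 1 x
     - of_nat (N * (N + 1)) * u x
     + of_real lam * (\<Sum>i<N. of_real ((x - 1)^i / fact i) * nderiv u (Suc i) 1)"

definition bounded_op :: "real \<Rightarrow> ((real \<Rightarrow> complex) \<Rightarrow> (real \<Rightarrow> complex)) \<Rightarrow> bool" where
  "bounded_op \<sigma> T \<longleftrightarrow> (\<forall>f\<in>Ysp \<sigma>. T f \<in> Xsp \<sigma>) \<and>
     (\<forall>f\<in>Ysp \<sigma>. \<forall>g\<in>Ysp \<sigma>. \<forall>a::complex. \<forall>x\<in>{0..1}.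
         T (\<lambda>y. a * f y + g y) x = a * T f x + T g x) \<and>
     (\<exists>C. \<forall>f\<in>Ysp \<sigma>. Xnorm \<sigma> (T f) \<le> C * Ynorm \<sigma> f)"

definition holomorphic_op_family ::
  "real \<Rightarrow> complex set \<Rightarrow> (complex \<Rightarrow> (real \<Rightarrow> complex) \<Rightarrow> (real \<Rightarrow> complex)) \<Rightarrow> bool" where
  "holomorphic_op_family \<sigma> U R \<longleftrightarrow>
     (\<forall>s\<in>U. bounded_op \<sigma> (R s)) \<and>
     (\<forall>s0\<in>U. \<exists>R'. bounded_op \<sigma> R' \<and>
        (\<forall>\<epsilon>>0. \<exists>\<delta>>0. \<forall>s\<in>U. 0 < cmod (s - s0) \<and> cmod (s - s0) < \<delta> \<longrightarrow>
           (\<forall>f\<in>Ysp \<sigma>. Xnorm \<sigma> (\<lambda>x. (R s f x - R s0 f x) / (s - s0) - R' f x) \<le> \<epsilon> * Ynorm \<sigma> f)))"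

end

theory Submission
  imports Defs
begin

text \<open>
  Differentiating the equation \<open>n \<ge> N\<close> times kills the rank-\<open>N\<close> part of \<open>\<K>\<close>, and for
  \<open>n = N\<close> also the zeroth-order term, so that \<open>w = u\<^sup>(\<^sup>N\<^sup>+\<^sup>1\<^sup>)\<close> solves the first-order equation
  \<open>x\<^sup>2 w' + (2 (N + 1) x + s) w = f\<^sup>(\<^sup>N\<^sup>)\<close>; the values \<open>u\<^sup>(\<^sup>i\<^sup>)(1)\<close>, \<open>i \<le> N\<close>, then solve a tridiagonal
  system that is diagonally dominant for large \<open>\<lambda>\<close>.

  Let \<open>V\<^sub>n\<close> be \<open>u\<^sup>(\<^sup>n\<^sup>+\<^sup>1\<^sup>)\<close> times the Gevrey weight \<open>\<sigma>\<^sup>n / (n! (n + 1)!)\<close>, and \<open>y = (n + 1) x\<close>. Testing the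
  \<open>n\<close>-th equation with \<open>(2 y + Re s) V\<^sub>n\<close> and taking real parts controls the sum of
  \<open>\<integral> (2 y + Re s)\<^sup>2 |V\<^sub>n|\<^sup>2\<close> up to relative errors \<open>O(1/N)\<close>, since \<open>V\<^sub>n\<close> and \<open>V\<^sub>n\<^sub>+\<^sub>1\<close> are, up to a factor of size
  \<open>n\<^sup>2\<close>, a function and its derivative. Testing with \<open>V\<^sub>n\<close> and taking imaginary parts controls the sum of
  \<open>\<integral> (|Im s| - max (y\<^sup>2, \<sigma>\<^sup>2 - y\<^sup>2) / \<sigma>) |V\<^sub>n|\<^sup>2\<close>. A combination of both is coercive on a region that
  contains \<open>\<Omega>\<^sub>\<sigma>\<close> and is invariant under \<open>s \<mapsto> s + t\<close>, \<open>t \<ge> 0\<close>; the boundary values \<open>V\<^sub>n(0)\<close> obey a two-term recursion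
  that is contracting because \<open>|s| > \<sigma>\<close>. This gives the a priori estimate with constants uniform on compact sets.
  For \<open>Re s \<ge> 1\<close> the first-order equation has an explicit smooth solution and the real-part estimate alone shows that it
  lies in \<open>X\<^sup>\<sigma>\<close>; since \<open>d/dx\<close> maps \<open>X\<^sup>\<sigma>\<close> to \<open>Y\<^sup>\<sigma>\<close> with norm at most one, solvability
  propagates along horizontal segments, and holomorphy follows from the resolvent identity.
\<close>

section \<open>Energy estimates for the differentiated equations\<close>

text \<open>The point \<open>x = 0\<close> is an irregular singular point and carries no boundary
  condition; summability of the weighted derivatives takes its place. The weight balances the
  couplings: in the equation for \<open>V n\<close>, the coefficients of \<open>V (Suc n)\<close>
  and \<open>V (n - 1)\<close> become about \<open>y^2 / \<sigma>\<close> and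
  \<open>\<sigma> c\<close> with \<open>0 \<le> c \<le> 1\<close>. As \<open>c\<close> runs from 0
  at \<open>n = N\<close> towards 1, their difference is bounded only by the worse of the two
  extremes, whence the maximum in the imaginary-part estimate. The obstacle is that this estimate
  couples neighbouring indices: truncating at \<open>N + j\<close> leaves a term in
  \<open>V (Suc (N + j))\<close> that is controlled only for functions already known to lie in the
  space. It therefore yields bounds and uniqueness but no existence. The real-part estimate couples
  downwards only and survives truncation, but is coercive by itself only for positive
  \<open>Re s\<close>; hence the detour through the right half-plane. For the same reason
  \<open>N\<close> and \<open>\<lambda>\<close> must serve the whole path of continuation, so they
  are fixed on the compact set swept out by the segments.\<close>

lemma has_real_derivative_cmod_square:
  fixes V :: "real \<Rightarrow> complex"
  assumes "(V has_vector_derivative V') (at x within S)"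
  shows "((\<lambda>x. (cmod (V x))\<^sup>2) has_real_derivative 2 * Re (V' * cnj (V x))) (at x within S)"
proof -
  have "((\<lambda>x. V x \<bullet> V x) has_vector_derivative (V x \<bullet> V' + V' \<bullet> V x)) (at x within S)"
    by (rule bounded_bilinear.has_vector_derivative[OF bounded_bilinear_inner assms assms])
  then show ?thesis
    unfolding has_real_derivative_iff_has_vector_derivative
    by (simp add: power2_norm_eq_inner inner_complex_def algebra_simps)
qed

text \<open>Integration by parts for energy estimates: \<open>\<Psi>\<close> collects every exact
  derivative at once, so that only its two endpoint values survive.\<close>

lemma integral_le_of_derivative:
  fixes \<Psi> L R :: "real \<Rightarrow> real"
  assumes d: "\<And>x. x \<in> {0..1} \<Longrightarrow> (\<Psi> has_real_derivative \<psi> x) (at x within {0..1})"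
    and le: "\<And>x. x \<in> {0..1} \<Longrightarrow> L x \<le> R x - \<psi> x"
    and L: "continuous_on {0..1} L" and R: "continuous_on {0..1} R"
  shows "integral {0..1} L \<le> integral {0..1} R + \<Psi> 0 - \<Psi> 1"
proof -
  have "(\<psi> has_integral \<Psi> 1 - \<Psi> 0) {0..1}"
    by (rule fundamental_theorem_of_calculus)
      (use d in \<open>auto simp: has_real_derivative_iff_has_vector_derivative\<close>)
  then have "((\<lambda>x. R x - \<psi> x) has_integral (integral {0..1} R - (\<Psi> 1 - \<Psi> 0))) {0..1}"
    using R by (intro has_integral_diff integrable_integral integrable_continuous_interval)
  moreover have "(L has_integral integral {0..1} L) {0..1}"
    using L by (intro integrable_integral integrable_continuous_interval)
  ultimately have "integral {0..1} L \<le> integral {0..1} R - (\<Psi> 1 - \<Psi> 0)"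
    using le by (meson has_integral_le)
  then show ?thesis by simp
qed

lemma has_vector_derivative_continuous_on:
  assumes "\<And>x. x \<in> S \<Longrightarrow> (f has_vector_derivative f' x) (at x within S)"
  shows "continuous_on S f"
  using assms by (meson continuous_on_eq_continuous_within has_vector_derivative_continuous)

lemma mult_le_half_squares: "x * y \<le> x\<^sup>2 / 2 + y\<^sup>2 / (2::real)"
  using sum_squares_bound[of x y] by simp

text \<open>Multiplying by \<open>2 * ?p x * cnj (V x)\<close> and taking real parts turns both
  coupling terms into exact derivatives, the one with \<open>U\<close> because
  \<open>V = U' / k\<close>. What remains are derivatives of the multipliers, of relative size
  \<open>1 / m\<close> and \<open>m / k\<close>. One of the two copies of the square on the left
  pays for the source.\<close>

lemma real_part_estimate:
  fixes U V V' F :: "real \<Rightarrow> complex" and s :: complex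
  assumes dV: "\<And>x. x \<in> {0..1} \<Longrightarrow> (V has_vector_derivative V' x) (at x within {0..1})"
    and dU: "\<And>x. x \<in> {0..1} \<Longrightarrow> (U has_vector_derivative of_real k * V x) (at x within {0..1})"
    and F: "continuous_on {0..1} F"
    and eq: "\<And>x. x \<in> {0..1} \<Longrightarrow>
      of_real (x\<^sup>2) * V' x + (of_real (2 * m * x) + s) * V x + of_real (\<sigma> * c) * U x = F x"
    and k: "k > 0" and m: "m \<ge> 1" and c: "0 \<le> c" and sg: "\<sigma> > 0"
    and a: "\<bar>Re s\<bar> \<le> A" "A \<le> 2 * m"
  shows "integral {0..1} (\<lambda>x. (2 * m * x + Re s)\<^sup>2 * (cmod (V x))\<^sup>2) \<le>
     integral {0..1} (\<lambda>x. (cmod (F x))\<^sup>2)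
     + 2 * (3 + A) / m * integral {0..1} (\<lambda>x. (1 + (m * x)\<^sup>2) * (cmod (V x))\<^sup>2)
     + 2 * \<sigma> * c * m / k * integral {0..1} (\<lambda>x. (cmod (U x))\<^sup>2) + \<sigma> * c * A / k * (cmod (U 0))\<^sup>2"
proof -
  let ?a = "Re s"
  let ?p = "\<lambda>x. 2 * m * x + ?a"
  \<comment> \<open>The factor \<open>c / k\<close> is the one for which differentiating
    \<open>(cmod (U x))^2\<close> reproduces
    \<open>\<sigma> * c * Re (U x * cnj (V x))\<close>.\<close>
  define \<Psi> where "\<Psi> = (\<lambda>x. x\<^sup>2 * ?p x * (cmod (V x))\<^sup>2 + (\<sigma> * c / k) * ?p x * (cmod (U x))\<^sup>2)"
  define \<psi> where "\<psi> = (\<lambda>x. (6 * m * x\<^sup>2 + 2 * ?a * x) * (cmod (V x))\<^sup>2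
      + x\<^sup>2 * ?p x * (2 * Re (V' x * cnj (V x)))
      + (\<sigma> * c / k) * (2 * m) * (cmod (U x))\<^sup>2 + (\<sigma> * c / k) * ?p x * (2 * Re (of_real k * V x * cnj (U x))))"
  have contV: "continuous_on {0..1} V" "continuous_on {0..1} U"
    using has_vector_derivative_continuous_on[OF dV] has_vector_derivative_continuous_on[OF dU] by auto
  have A0: "A \<ge> 0" using a by linarith
  let ?R = "\<lambda>x. (cmod (F x))\<^sup>2 + 2 * (3 + A) / m * ((1 + (m * x)\<^sup>2) * (cmod (V x))\<^sup>2)
     + 2 * \<sigma> * c * m / k * (cmod (U x))\<^sup>2"
  have der: "(\<Psi> has_real_derivative \<psi> x) (at x within {0..1})" if x: "x \<in> {0..1}" for x
  proof -
    define v where "v = (\<lambda>x. (cmod (V x))\<^sup>2)"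
    define w where "w = (\<lambda>x. (cmod (U x))\<^sup>2)"
    have v: "(v has_real_derivative 2 * Re (V' x * cnj (V x))) (at x within {0..1})"
      unfolding v_def by (rule has_real_derivative_cmod_square[OF dV[OF x]])
    have w: "(w has_real_derivative 2 * Re (of_real k * V x * cnj (U x))) (at x within {0..1})"
      unfolding w_def by (rule has_real_derivative_cmod_square[OF dU[OF x]])
    have "((\<lambda>x. x\<^sup>2 * ?p x * v x + (\<sigma> * c / k) * ?p x * w x) has_real_derivative
       (6 * m * x\<^sup>2 + 2 * ?a * x) * v x + x\<^sup>2 * ?p x * (2 * Re (V' x * cnj (V x)))
      + (\<sigma> * c / k) * (2 * m) * w x + (\<sigma> * c / k) * ?p x * (2 * Re (of_real k * V x * cnj (U x)))) (at x within {0..1})"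
      by (rule derivative_eq_intros v w refl | simp)+ (simp add: algebra_simps power2_eq_square)
    then show ?thesis unfolding \<Psi>_def \<psi>_def v_def w_def .
  qed
  have le: "(?p x)\<^sup>2 * (cmod (V x))\<^sup>2 \<le> ?R x - \<psi> x" if x: "x \<in> {0..1}" for x
  proof -
    have e: "x\<^sup>2 * Re (V' x * cnj (V x)) + ?p x * (cmod (V x))\<^sup>2 + \<sigma> * c * Re (U x * cnj (V x)) = Re (F x * cnj (V x))"
    proof -
      have "Re (F x * cnj (V x)) = Re ((of_real (x\<^sup>2) * V' x + (of_real (2 * m * x) + s) * V x + of_real (\<sigma> * c) * U x) * cnj (V x))"
        using eq[OF x] by simp
      also have "\<dots> = x\<^sup>2 * Re (V' x * cnj (V x)) + ?p x * (cmod (V x))\<^sup>2 + \<sigma> * c * Re (U x * cnj (V x))"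
        unfolding cmod_power2 by (simp add: algebra_simps power2_eq_square)
      finally show ?thesis by simp
    qed
    have psi: "\<psi> x = (6 * m * x\<^sup>2 + 2 * ?a * x) * (cmod (V x))\<^sup>2 + 2 * \<sigma> * c * m / k * (cmod (U x))\<^sup>2
        + 2 * ?p x * (Re (F x * cnj (V x)) - ?p x * (cmod (V x))\<^sup>2)"
    proof -
      have "(\<sigma> * c / k) * ?p x * (2 * Re (of_real k * V x * cnj (U x))) = 2 * ?p x * (\<sigma> * c * Re (U x * cnj (V x)))"
        using k by (simp add: field_simps)
      moreover have "Re (F x * cnj (V x)) - ?p x * (cmod (V x))\<^sup>2 = x\<^sup>2 * Re (V' x * cnj (V x)) + \<sigma> * c * Re (U x * cnj (V x))"
        using e by simp
      ultimately show ?thesis unfolding \<psi>_def by (simp add: algebra_simps)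
    qed
    have "\<bar>Re (F x * cnj (V x))\<bar> \<le> cmod (F x) * cmod (V x)"
      using abs_Re_le_cmod[of "F x * cnj (V x)"] by (simp add: norm_mult)
    then have "?p x * Re (F x * cnj (V x)) \<le> \<bar>?p x\<bar> * (cmod (F x) * cmod (V x))"
      by (metis abs_ge_zero abs_le_D1 abs_mult mult_left_mono)
    also have "\<dots> = cmod (F x) * (\<bar>?p x\<bar> * cmod (V x))" by simp
    also have "\<dots> \<le> (cmod (F x))\<^sup>2 / 2 + (\<bar>?p x\<bar> * cmod (V x))\<^sup>2 / 2" by (rule mult_le_half_squares)
    finally have f: "2 * ?p x * Re (F x * cnj (V x)) \<le> (cmod (F x))\<^sup>2 + (?p x)\<^sup>2 * (cmod (V x))\<^sup>2"
      unfolding power_mult_distrib power2_abs by linarith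
    \<comment> \<open>The left side is the derivative of \<open>x^2 * ?p x\<close>. After
      multiplication by \<open>m\<close> it is quadratic in \<open>m * x\<close>, which is where the
      gain of \<open>1 / m\<close> comes from.\<close>
    have "6 * m * x\<^sup>2 + 2 * ?a * x \<le> 2 * (3 + A) / m * (1 + (m * x)\<^sup>2)"
    proof -
      have 1: "2 * (m * x) \<le> 1 + (m * x)\<^sup>2" using sum_squares_bound[of 1 "m * x"] by simp
      have 0: "0 \<le> m * x" using m x by simp
      have "?a * (m * x) \<le> A * (m * x)" using a 0 by (intro mult_right_mono) auto
      also have "\<dots> \<le> A * (1 + (m * x)\<^sup>2)" using A0 1 0 by (intro mult_left_mono) linarith+
      finally have "m * (6 * m * x\<^sup>2 + 2 * ?a * x) \<le> 2 * (3 + A) * (1 + (m * x)\<^sup>2)"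
        by (simp add: algebra_simps power2_eq_square)
      then show ?thesis using m by (simp add: field_simps)
    qed
    then have g: "(6 * m * x\<^sup>2 + 2 * ?a * x) * (cmod (V x))\<^sup>2 \<le> 2 * (3 + A) / m * (1 + (m * x)\<^sup>2) * (cmod (V x))\<^sup>2"
      by (intro mult_right_mono) auto
    have "?R x - \<psi> x - (?p x)\<^sup>2 * (cmod (V x))\<^sup>2 = ((cmod (F x))\<^sup>2 + (?p x)\<^sup>2 * (cmod (V x))\<^sup>2 - 2 * ?p x * Re (F x * cnj (V x)))
       + (2 * (3 + A) / m * (1 + (m * x)\<^sup>2) * (cmod (V x))\<^sup>2 - (6 * m * x\<^sup>2 + 2 * ?a * x) * (cmod (V x))\<^sup>2)"
      unfolding psi by (simp only: power2_eq_square[of "?p x"]) algebra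
    then show ?thesis using f g by linarith
  qed
  have "integral {0..1} (\<lambda>x. (?p x)\<^sup>2 * (cmod (V x))\<^sup>2) \<le> integral {0..1} ?R + \<Psi> 0 - \<Psi> 1"
    by (rule integral_le_of_derivative[OF der le]) (use k m in \<open>auto intro!: continuous_intros contV F\<close>)
  also have "integral {0..1} ?R = integral {0..1} (\<lambda>x. (cmod (F x))\<^sup>2)
     + 2 * (3 + A) / m * integral {0..1} (\<lambda>x. (1 + (m * x)\<^sup>2) * (cmod (V x))\<^sup>2)
     + 2 * \<sigma> * c * m / k * integral {0..1} (\<lambda>x. (cmod (U x))\<^sup>2)"
    by (subst integral_add, (intro integrable_continuous_interval continuous_intros contV F)+)+
      (simp del: times_divide_eq_left times_divide_eq_right)
  finally have fin: "integral {0..1} (\<lambda>x. (?p x)\<^sup>2 * (cmod (V x))\<^sup>2) \<le> integral {0..1} (\<lambda>x. (cmod (F x))\<^sup>2)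
     + 2 * (3 + A) / m * integral {0..1} (\<lambda>x. (1 + (m * x)\<^sup>2) * (cmod (V x))\<^sup>2)
     + 2 * \<sigma> * c * m / k * integral {0..1} (\<lambda>x. (cmod (U x))\<^sup>2) + \<Psi> 0 - \<Psi> 1" .
  \<comment> \<open>\<open>A \<le> 2 * m\<close> makes \<open>?p 1\<close> nonnegative, so the
    endpoint 1 has a favourable sign. At 0 the factor \<open>x^2\<close> removes \<open>V 0\<close>
    and leaves only \<open>U 0\<close>.\<close>
  have "\<Psi> 1 \<ge> 0" unfolding \<Psi>_def using a m c k sg by (auto intro!: add_nonneg_nonneg mult_nonneg_nonneg)
  moreover have "\<Psi> 0 \<le> \<sigma> * c * A / k * (cmod (U 0))\<^sup>2"
  proof -
    have "\<Psi> 0 = \<sigma> * c / k * (cmod (U 0))\<^sup>2 * ?a" unfolding \<Psi>_def by simp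
    also have "\<dots> \<le> \<sigma> * c / k * (cmod (U 0))\<^sup>2 * A"
      using a c k sg by (intro mult_left_mono) auto
    finally show ?thesis by (simp add: mult_ac)
  qed
  ultimately show ?thesis using fin by linarith
qed

section \<open>The imaginary-part estimate, summed over the hierarchy\<close>

lemma max_perturb:
  fixes q r S t :: real
  assumes "0 \<le> r" "r \<le> t"
  shows "max (q + r) (S - (q + r)) + max (q - r) (S - (q - r)) \<le> 2 * (max q (S - q) + t)"
proof -
  have "max (q + r) (S - (q + r)) \<le> max q (S - q) + t" "max (q - r) (S - (q - r)) \<le> max q (S - q) + t"
    using assms by (auto simp: max_def)
  from add_mono[OF this] show ?thesis by (simp only: distrib_left mult_2 add_ac)
qed

text \<open>Pairing the equation with \<open>cnj (V n)\<close> and taking imaginary parts removes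
  the real coefficient \<open>p n\<close>. The lower coupling at \<open>n\<close> and the upper one
  at \<open>n - 1\<close> involve the same quantity \<open>Im (V n * cnj (V (n - 1)))\<close> with
  opposite signs, so a shift of index merges them. \<open>c N = 0\<close> closes the sum from below;
  the last index has no partner above, hence the case distinction.\<close>

lemma imag_part_identity:
  fixes V F :: "nat \<Rightarrow> complex" and k c p :: "nat \<Rightarrow> real"
  assumes eq: "\<And>n. n \<ge> N \<Longrightarrow> of_real (k n) * V (Suc n) + (of_real (p n) + \<i> * of_real b) * V n
        + of_real (c n) * V (n - 1) = F n"
    and c: "c N = 0"
  shows "b * (\<Sum>n=N..N+j. (cmod (V n))\<^sup>2) =
     (\<Sum>n=N..N+j. Im (F n * cnj (V n)) + ((if n = N + j then 0 else c (Suc n)) - k n) * Im (V (Suc n) * cnj (V n)))"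
proof -
  have e: "Im (F n * cnj (V n)) = k n * Im (V (Suc n) * cnj (V n)) + b * (cmod (V n))\<^sup>2 - c n * Im (V n * cnj (V (n - 1)))"
    if "n \<ge> N" for n
    unfolding eq[OF that, symmetric] cmod_power2 by (simp add: algebra_simps power2_eq_square)
  show ?thesis
  proof (induction j)
    case 0
    then show ?case using e[of N] c by simp
  next
    case (Suc j)
    let ?I = "\<lambda>n. Im (V (Suc n) * cnj (V n))"
    have "(\<Sum>n=N..N+Suc j. Im (F n * cnj (V n)) + ((if n = N + Suc j then 0 else c (Suc n)) - k n) * ?I n)
      = (\<Sum>n=N..N+j. Im (F n * cnj (V n)) + (c (Suc n) - k n) * ?I n)
         + (Im (F (N + Suc j) * cnj (V (N + Suc j))) - k (N + Suc j) * ?I (N + Suc j))"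
      by (simp cong: sum.cong_simp)
    also have "(\<Sum>n=N..N+j. Im (F n * cnj (V n)) + (c (Suc n) - k n) * ?I n)
      = (\<Sum>n=N..N+j. Im (F n * cnj (V n)) + ((if n = N + j then 0 else c (Suc n)) - k n) * ?I n
          + (if n = N + j then c (Suc n) * ?I n else 0))"
      by (intro sum.cong) (auto simp: algebra_simps)
    also have "\<dots> = b * (\<Sum>n=N..N+j. (cmod (V n))\<^sup>2) + c (Suc (N + j)) * ?I (N + j)"
      by (simp only: sum.distrib Suc.IH) simp
    finally show ?case using e[of "N + Suc j"] by (simp add: algebra_simps)
  qed
qed

lemma abs_Im_mult_cnj_le: "\<bar>Im (z * cnj w)\<bar> \<le> ((cmod z)\<^sup>2 + (cmod w)\<^sup>2) / 2"
proof -
  have "\<bar>Im (z * cnj w)\<bar> \<le> cmod z * cmod w"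
    using abs_Im_le_cmod[of "z * cnj w"] by (simp add: norm_mult)
  also have "\<dots> \<le> ((cmod z)\<^sup>2 + (cmod w)\<^sup>2) / 2"
    using mult_le_half_squares[of "cmod z" "cmod w"] by (simp add: add_divide_distrib)
  finally show ?thesis .
qed

text \<open>Each merged coupling is split evenly between \<open>V n\<close> and
  \<open>V (Suc n)\<close>. So \<open>V n\<close> receives the mean of two neighbouring
  coefficients, which is close to its value at \<open>q n\<close>, and one unmatched half remains on
  \<open>V (Suc (N + j))\<close>.\<close>

lemma imag_part_estimate:
  fixes V F :: "nat \<Rightarrow> complex" and c :: "nat \<Rightarrow> real" and s :: complex
  assumes sg: "\<sigma> > 0"
    and eq: "\<And>n. n \<ge> N \<Longrightarrow> of_real (x\<^sup>2 * (real (n + 1) * real (n + 2) / \<sigma>)) * V (Suc n)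
        + (of_real (2 * real (n + 1) * x) + s) * V n + of_real (\<sigma> * c n) * V (n - 1) = F n"
    and c: "c N = 0" "\<And>n. n \<ge> N \<Longrightarrow> 0 \<le> c n \<and> c n \<le> 1"
    and N: "N \<ge> 1"
  defines "q \<equiv> \<lambda>n. (real (n + 1) * x)\<^sup>2"
  shows "\<bar>Im s\<bar> * (\<Sum>n=N..N+j. (cmod (V n))\<^sup>2) \<le>
     (\<Sum>n=N..N+j. cmod (F n) * cmod (V n) + (max (q n) (\<sigma>\<^sup>2 - q n) + q n / real N) / \<sigma> * (cmod (V n))\<^sup>2)
     + (\<sigma> + 1 / \<sigma>) * (1 + q (Suc (N + j))) * (cmod (V (Suc (N + j))))\<^sup>2"
proof -
  define p where "p n = x\<^sup>2 * (real (n + 1) * real (n + 2))" for n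
  define \<omega> where "\<omega> n = max (p n) (\<sigma>\<^sup>2 - p n) / \<sigma>" for n
  let ?C = "\<lambda>n. if n = N + j then 0 else \<sigma> * c (Suc n)"
  have p0: "p n \<ge> 0" for n unfolding p_def by simp
  have w0: "\<omega> n \<ge> 0" for n using p0[of n] sg unfolding \<omega>_def by (simp add: le_max_iff_disj)
  have id: "Im s * (\<Sum>n=N..N+j. (cmod (V n))\<^sup>2) =
     (\<Sum>n=N..N+j. Im (F n * cnj (V n)) + (?C n - p n / \<sigma>) * Im (V (Suc n) * cnj (V n)))"
  proof (rule imag_part_identity[where p = "\<lambda>n. 2 * real (n + 1) * x + Re s" and c = "\<lambda>n. \<sigma> * c n"])
    fix n assume "n \<ge> N"
    have "of_real (2 * real (n + 1) * x + Re s) + \<i> * of_real (Im s) = of_real (2 * real (n + 1) * x) + s"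
      by (simp add: complex_eq_iff)
    then show "complex_of_real (p n / \<sigma>) * V (Suc n) + (of_real (2 * real (n + 1) * x + Re s) + \<i> * of_real (Im s)) * V n
       + of_real (\<sigma> * c n) * V (n - 1) = F n"
      using eq[OF \<open>n \<ge> N\<close>] unfolding p_def by (simp only: times_divide_eq_right)
  qed (use c in simp)
  \<comment> \<open>\<open>\<sigma> * ?C n\<close> can be anywhere between 0 and
    \<open>\<sigma>^2\<close>; \<open>\<omega> n\<close> is the bound for the worse
    endpoint.\<close>
  have "\<bar>?C n - p n / \<sigma>\<bar> \<le> \<omega> n" if "n \<ge> N" for n
  proof -
    have "0 \<le> \<sigma> * ?C n" "\<sigma> * ?C n \<le> \<sigma>\<^sup>2"
      using c(2)[of "Suc n"] that sg mult_left_mono[of "c (Suc n)" 1 "\<sigma> * \<sigma>"] by (auto simp: power2_eq_square mult_ac)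
    then have "\<bar>\<sigma> * ?C n - p n\<bar> \<le> max (p n) (\<sigma>\<^sup>2 - p n)" using p0[of n] by (auto simp: abs_if)
    then have "\<bar>\<sigma> * ?C n - p n\<bar> / \<sigma> \<le> \<omega> n" unfolding \<omega>_def using sg by (intro divide_right_mono) auto
    moreover have "\<bar>\<sigma> * ?C n - p n\<bar> / \<sigma> = \<bar>(\<sigma> * ?C n - p n) / \<sigma>\<bar>" using sg by (simp add: abs_divide)
    moreover have "(\<sigma> * ?C n - p n) / \<sigma> = ?C n - p n / \<sigma>" using sg by (simp add: diff_divide_distrib)
    ultimately show ?thesis by simp
  qed
  then have t: "\<bar>Im (F n * cnj (V n)) + (?C n - p n / \<sigma>) * Im (V (Suc n) * cnj (V n))\<bar>
      \<le> cmod (F n) * cmod (V n) + \<omega> n * (((cmod (V (Suc n)))\<^sup>2 + (cmod (V n))\<^sup>2) / 2)" if "n \<ge> N" for n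
  proof -
    have "\<bar>Im (F n * cnj (V n))\<bar> \<le> cmod (F n) * cmod (V n)"
      using abs_Im_le_cmod[of "F n * cnj (V n)"] by (simp add: norm_mult)
    moreover have "\<bar>(?C n - p n / \<sigma>) * Im (V (Suc n) * cnj (V n))\<bar> \<le> \<omega> n * (((cmod (V (Suc n)))\<^sup>2 + (cmod (V n))\<^sup>2) / 2)"
      unfolding abs_mult using that \<open>n \<ge> N \<Longrightarrow> \<bar>?C n - p n / \<sigma>\<bar> \<le> \<omega> n\<close> abs_Im_mult_cnj_le w0
      by (intro mult_mono) auto
    ultimately show ?thesis by (rule order_trans[OF abs_triangle_ineq add_mono])
  qed
  let ?W = "\<lambda>n. \<omega> n * ((cmod (V n))\<^sup>2 / 2)"
  \<comment> \<open>The half of the coupling between \<open>n - 1\<close> and \<open>n\<close> that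
    falls on \<open>V n\<close>. After the shift of index the nonnegative term \<open>?Z N\<close>
    is added, so that both halves are summed over the same range.\<close>
  let ?Z = "\<lambda>n. \<omega> (n - 1) * ((cmod (V n))\<^sup>2 / 2)"
  have "\<bar>Im s\<bar> * (\<Sum>n=N..N+j. (cmod (V n))\<^sup>2) = \<bar>Im s * (\<Sum>n=N..N+j. (cmod (V n))\<^sup>2)\<bar>"
    by (simp add: abs_mult sum_nonneg)
  also have "\<dots> \<le> (\<Sum>n=N..N+j. cmod (F n) * cmod (V n) + \<omega> n * (((cmod (V (Suc n)))\<^sup>2 + (cmod (V n))\<^sup>2) / 2))"
    unfolding id by (rule order_trans[OF sum_abs sum_mono]) (use t in auto)
  also have "\<dots> = (\<Sum>n=N..N+j. cmod (F n) * cmod (V n) + ?W n) + (\<Sum>n=N..N+j. ?Z (Suc n))"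
    by (simp only: sum.distrib[symmetric] add_divide_distrib) (simp add: algebra_simps)
  also have "(\<Sum>n=N..N+j. ?Z (Suc n)) = (\<Sum>n=Suc N..Suc (N+j). ?Z n)"
    by (simp only: sum.shift_bounds_cl_Suc_ivl)
  also have "\<dots> = (\<Sum>n=Suc N..N+j. ?Z n) + ?Z (Suc (N + j))" by simp
  also have "\<dots> \<le> (\<Sum>n=N..N+j. ?Z n) + ?Z (Suc (N + j))"
    using w0 by (intro add_right_mono sum_mono2) auto
  also have "?Z (Suc (N + j)) \<le> (\<sigma> + 1 / \<sigma>) * (1 + q (Suc (N + j))) * (cmod (V (Suc (N + j))))\<^sup>2"
  proof -
    let ?n = "N + j"
    have "x\<^sup>2 * (real (?n + 1) * real (?n + 2)) \<le> x\<^sup>2 * (real (Suc ?n + 1) * real (Suc ?n + 1))"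
      by (intro mult_left_mono mult_mono) auto
    then have "p ?n \<le> q (Suc ?n)" unfolding p_def q_def
      by (simp add: power_mult_distrib power2_eq_square mult_ac)
    then have "\<omega> ?n \<le> (\<sigma>\<^sup>2 + q (Suc ?n)) / \<sigma>"
      using p0[of ?n] sg unfolding \<omega>_def by (intro divide_right_mono) (auto simp: max_def power2_eq_square add_increasing)
    also have "\<dots> \<le> (\<sigma> + 1 / \<sigma>) * (1 + q (Suc ?n))"
    proof -
      have q0: "q (Suc ?n) \<ge> 0" unfolding q_def by simp
      have "(\<sigma>\<^sup>2 + q (Suc ?n)) / \<sigma> = \<sigma> + q (Suc ?n) / \<sigma>" using sg by (simp add: power2_eq_square add_divide_distrib)
      moreover have "0 \<le> \<sigma> * q (Suc ?n) + 1 / \<sigma>" using sg q0 by simp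
      ultimately show ?thesis by (simp add: algebra_simps)
    qed
    finally have "\<omega> ?n * (cmod (V (Suc ?n)))\<^sup>2 \<le> (\<sigma> + 1 / \<sigma>) * (1 + q (Suc ?n)) * (cmod (V (Suc ?n)))\<^sup>2"
      by (intro mult_right_mono) auto
    moreover have "0 \<le> \<omega> ?n * (cmod (V (Suc ?n)))\<^sup>2" using w0 by simp
    ultimately show ?thesis unfolding diff_Suc_1 by linarith
  qed
  also have "(\<Sum>n=N..N+j. cmod (F n) * cmod (V n) + ?W n) + ((\<Sum>n=N..N+j. ?Z n) + (\<sigma> + 1 / \<sigma>) * (1 + q (Suc (N + j))) * (cmod (V (Suc (N + j))))\<^sup>2)
     = (\<Sum>n=N..N+j. cmod (F n) * cmod (V n) + (\<omega> n + \<omega> (n - 1)) / 2 * (cmod (V n))\<^sup>2) + (\<sigma> + 1 / \<sigma>) * (1 + q (Suc (N + j))) * (cmod (V (Suc (N + j))))\<^sup>2"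
    by (simp add: sum.distrib algebra_simps add_divide_distrib)
  also have "(\<Sum>n=N..N+j. cmod (F n) * cmod (V n) + (\<omega> n + \<omega> (n - 1)) / 2 * (cmod (V n))\<^sup>2) \<le> 
    (\<Sum>n=N..N+j. cmod (F n) * cmod (V n) + (max (q n) (\<sigma>\<^sup>2 - q n) + q n / real N) / \<sigma> * (cmod (V n))\<^sup>2)"
  proof (intro sum_mono add_left_mono mult_right_mono)
    fix n assume n: "n \<in> {N..N+j}"
    then have n1: "n \<ge> N" "n \<ge> 1" using N by auto
    \<comment> \<open>The couplings above and below \<open>n\<close> lie symmetrically around
      \<open>q n\<close>, at distance \<open>(n + 1) * x^2 = q n / (n + 1)\<close>. This is the
      source of the relative error \<open>1 / N\<close>.\<close>
    have pn: "p n = q n + (n + 1) * x\<^sup>2" unfolding p_def q_def by (simp add: power_mult_distrib power2_eq_square algebra_simps)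
    have pm: "p (n - 1) = q n - (n + 1) * x\<^sup>2" unfolding p_def q_def using n1
      by (simp add: power_mult_distrib power2_eq_square algebra_simps)
    have "(n + 1) * x\<^sup>2 * N \<le> (n + 1) * x\<^sup>2 * (n + 1)" using n1 by (intro mult_left_mono) auto
    then have r: "(n + 1) * x\<^sup>2 \<le> q n / N" unfolding q_def using N by (simp add: field_simps power2_eq_square)
    have r0: "(n + 1) * x\<^sup>2 \<ge> 0" by simp
    have half: "X / 2 \<le> Y" if "X \<le> 2 * Y" for X Y :: real using that by simp
    have "max (p n) (\<sigma>\<^sup>2 - p n) + max (p (n - 1)) (\<sigma>\<^sup>2 - p (n - 1)) \<le> 2 * (max (q n) (\<sigma>\<^sup>2 - q n) + q n / N)"
      using r r0 unfolding pn pm by (rule max_perturb[rotated])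
    then have "(\<omega> n + \<omega> (n - 1)) \<le> 2 * (max (q n) (\<sigma>\<^sup>2 - q n) + q n / N) / \<sigma>"
      unfolding \<omega>_def add_divide_distrib[symmetric] using sg by (intro divide_right_mono) auto
    then show "(\<omega> n + \<omega> (n - 1)) / 2 \<le> (max (q n) (\<sigma>\<^sup>2 - q n) + q n / real N) / \<sigma>"
      unfolding times_divide_eq_right[symmetric] by (rule half)
  qed auto
  finally show ?thesis by simp
qed

lemma sum_shift_le:
  fixes g :: "nat \<Rightarrow> real"
  assumes "\<And>n. g n \<ge> 0"
  shows "(\<Sum>n=N..N+j. if n = N then 0 else g (n - 1)) \<le> (\<Sum>n=N..N+j. g n)"
proof -
  have "(\<Sum>n=N..N+j. if n = N then 0 else g (n - 1)) + g (N + j) = (\<Sum>n=N..N+j. g n)"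
    by (induction j) auto
  then show ?thesis using assms[of "N + j"] by linarith
qed

text \<open>The weighted derivatives \<open>V\<^sub>n\<close> satisfy the system below for \<open>n \<ge> N\<close>; the coefficient of \<open>V\<^sub>n\<^sub>-\<^sub>1\<close>
  vanishes for \<open>n = N\<close>, so that the system is closed.\<close>

locale hierarchy =
  fixes \<sigma> :: real and N :: nat and s :: complex and V F :: "nat \<Rightarrow> real \<Rightarrow> complex"
  assumes sg: "\<sigma> > 0" and N1: "N \<ge> 1"
    and dV: "\<And>n x. x \<in> {0..1} \<Longrightarrow>
      (V n has_vector_derivative of_real (real (n + 1) * real (n + 2) / \<sigma>) * V (Suc n) x) (at x within {0..1})"
    and eq: "\<And>n x. n \<ge> N \<Longrightarrow> x \<in> {0..1} \<Longrightarrow>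
      of_real (x\<^sup>2 * (real (n + 1) * real (n + 2) / \<sigma>)) * V (Suc n) x + (of_real (2 * real (n + 1) * x) + s) * V n x
       + of_real (\<sigma> * (1 - real N * real (N + 1) / (real n * real (n + 1)))) * V (n - 1) x = F n x"
begin

text \<open>Passing from the weight of index \<open>n - 1\<close> to that of index \<open>n\<close>
  costs the factor \<open>\<sigma> / (n (n + 1))\<close>, which turns the zeroth-order coefficient
  \<open>n (n + 1) - N (N + 1)\<close> into \<open>\<sigma> * coef n\<close>.\<close>

definition coef :: "nat \<Rightarrow> real" where
  "coef n = 1 - real N * real (N + 1) / (real n * real (n + 1))"

definition energy :: "nat \<Rightarrow> real" where
  "energy n = integral {0..1} (\<lambda>x. (1 + (real (n + 1) * x)\<^sup>2) * (cmod (V n x))\<^sup>2)"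

definition source :: "nat \<Rightarrow> real" where
  "source n = integral {0..1} (\<lambda>x. (cmod (F n x))\<^sup>2)"

lemma coef_N: "coef N = 0" using N1 by (simp add: coef_def)

lemma coef_bounds: "n \<ge> N \<Longrightarrow> 0 \<le> coef n \<and> coef n \<le> 1"
  using N1 mult_mono[of "real N" "real n" "real (N + 1)" "real (n + 1)"]
  by (auto simp: coef_def divide_simps)

lemma contV: "continuous_on {0..1} (V n)"
  by (rule has_vector_derivative_continuous_on[OF dV])

lemma contF: "n \<ge> N \<Longrightarrow> continuous_on {0..1} (F n)"
proof -
  assume n: "n \<ge> N"
  have "continuous_on {0..1} (\<lambda>x. of_real (x\<^sup>2 * (real (n + 1) * real (n + 2) / \<sigma>)) * V (Suc n) x + (of_real (2 * real (n + 1) * x) + s) * V n x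
       + of_real (\<sigma> * (1 - real N * real (N + 1) / (real n * real (n + 1)))) * V (n - 1) x)"
    using sg by (intro continuous_intros contV) auto
  then show ?thesis using eq[OF n] by (simp cong: continuous_on_cong_simp)
qed

lemma energy_nonneg: "energy n \<ge> 0"
  unfolding energy_def by (intro integral_nonneg integrable_continuous_interval continuous_intros contV) auto

lemma mass_le_energy: "integral {0..1} (\<lambda>x. (cmod (V n x))\<^sup>2) \<le> energy n"
  unfolding energy_def
  by (intro integral_le integrable_continuous_interval continuous_intros contV) (auto simp: algebra_simps)

text \<open>At \<open>x = 0\<close> the equation degenerates to
  \<open>s V n + \<sigma> coef n V (n - 1) = F n\<close>. Multiplying by \<open>cmod (V n 0)\<close>
  and splitting the coupling evenly, the sum over \<open>n\<close> absorbs both halves of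
  \<open>\<sigma>\<close>; the gap \<open>\<eta>\<close> is what is left to control the
  source.\<close>

lemma boundary_sum:
  assumes eta: "\<eta> > 0" "cmod s \<ge> \<sigma> + \<eta>"
  shows "(\<Sum>n=N..N+j. (cmod (V n 0))\<^sup>2) \<le> (\<Sum>n=N..N+j. (cmod (F n 0))\<^sup>2) / \<eta>\<^sup>2"
proof -
  let ?B = "\<lambda>n. (cmod (V n 0))\<^sup>2" and ?H = "\<lambda>n. (cmod (F n 0))\<^sup>2"
  have p: "(\<sigma> + \<eta>) * ?B n \<le> ?H n / (2 * \<eta>) + \<eta> / 2 * ?B n + \<sigma> / 2 * (?B n + (if n = N then 0 else ?B (n - 1)))"
    if n: "n \<ge> N" for n
  proof -
    let ?v = "cmod (V n 0)" and ?f = "cmod (F n 0)" and ?u = "cmod (V (n - 1) 0)"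
    have "s * V n 0 = F n 0 - of_real (\<sigma> * coef n) * V (n - 1) 0"
      using eq[OF n, of 0] unfolding coef_def by (simp add: algebra_simps)
    then have "cmod s * ?v \<le> ?f + cmod (of_real (\<sigma> * coef n) * V (n - 1) 0)"
      by (metis norm_mult norm_triangle_ineq4)
    then have "cmod s * ?v \<le> ?f + \<sigma> * coef n * ?u"
      using sg coef_bounds[OF n] by (simp add: norm_mult del: of_real_mult)
    moreover have "(\<sigma> + \<eta>) * ?v \<le> cmod s * ?v" using eta by (intro mult_right_mono) auto
    ultimately have "(\<sigma> + \<eta>) * ?v * ?v \<le> (?f + \<sigma> * coef n * ?u) * ?v"
      by (intro mult_right_mono) auto
    then have 1: "(\<sigma> + \<eta>) * ?v\<^sup>2 \<le> ?f * ?v + \<sigma> * (coef n * (?u * ?v))"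
      by (simp add: power2_eq_square algebra_simps)
    have "(?f / sqrt \<eta>) * (sqrt \<eta> * ?v) \<le> (?f / sqrt \<eta>)\<^sup>2 / 2 + (sqrt \<eta> * ?v)\<^sup>2 / 2"
      by (rule mult_le_half_squares)
    then have 2: "?f * ?v \<le> ?f\<^sup>2 / (2 * \<eta>) + \<eta> / 2 * ?v\<^sup>2"
      using eta(1) by (simp add: power_mult_distrib power_divide)
    have "coef n * (?u * ?v) \<le> (if n = N then 0 else 1) * (?u * ?v)"
      using coef_bounds[OF n] coef_N by (intro mult_right_mono) auto
    also have "\<dots> \<le> (?v\<^sup>2 + (if n = N then 0 else ?u\<^sup>2)) / 2"
      using mult_le_half_squares[of ?u ?v] by (auto simp: add_divide_distrib)
    finally have "\<sigma> * (coef n * (?u * ?v)) \<le> \<sigma> * ((?v\<^sup>2 + (if n = N then 0 else ?u\<^sup>2)) / 2)"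
      using sg by (intro mult_left_mono) auto
    with 1 2 show ?thesis by simp
  qed
  have "(\<Sum>n=N..N+j. (\<sigma> + \<eta>) * ?B n) \<le> (\<Sum>n=N..N+j. ?H n / (2 * \<eta>) + \<eta> / 2 * ?B n + \<sigma> / 2 * (?B n + (if n = N then 0 else ?B (n - 1))))"
    by (rule sum_mono) (use p in auto)
  also have "\<dots> = (\<Sum>n=N..N+j. ?H n) / (2 * \<eta>) + \<eta> / 2 * (\<Sum>n=N..N+j. ?B n)
      + \<sigma> / 2 * ((\<Sum>n=N..N+j. ?B n) + (\<Sum>n=N..N+j. if n = N then 0 else ?B (n - 1)))"
    by (simp only: sum.distrib sum_divide_distrib[symmetric] sum_distrib_left[symmetric])
  also have "\<dots> \<le> (\<Sum>n=N..N+j. ?H n) / (2 * \<eta>) + \<eta> / 2 * (\<Sum>n=N..N+j. ?B n)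
      + \<sigma> / 2 * ((\<Sum>n=N..N+j. ?B n) + (\<Sum>n=N..N+j. ?B n))"
    using sg by (intro add_left_mono mult_left_mono sum_shift_le) auto
  finally have "\<eta> / 2 * (\<Sum>n=N..N+j. ?B n) \<le> (\<Sum>n=N..N+j. ?H n) / (2 * \<eta>)"
    unfolding sum_distrib_left[symmetric] by (simp add: algebra_simps)
  then show ?thesis using eta(1) by (simp add: field_simps power2_eq_square)
qed

text \<open>The general estimate with \<open>m = n + 1\<close> and
  \<open>k = n (n + 1) / \<sigma>\<close>, for which every error gains at least
  \<open>1 / N\<close>. For \<open>n = N\<close> the coefficient of \<open>V (n - 1)\<close>
  vanishes, so nothing below the hierarchy enters, and nothing above \<open>n\<close> enters
  either.\<close>

lemma real_part_bound:
  assumes n: "n \<ge> N" and a: "\<bar>Re s\<bar> \<le> A" "A \<le> 2 * real N"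
  shows "integral {0..1} (\<lambda>x. (2 * real (n + 1) * x + Re s)\<^sup>2 * (cmod (V n x))\<^sup>2) \<le>
     source n + (2 * (3 + A) + 2 * \<sigma>\<^sup>2 + \<sigma>\<^sup>2 * A) / real N *
       (energy n + (if n = N then 0 else energy (n - 1) + (cmod (V (n - 1) 0))\<^sup>2))"
proof -
  let ?k = "real n * real (n + 1) / \<sigma>" and ?m = "real (n + 1)"
  have n1: "n \<ge> 1" "real N \<ge> 1" "real n \<ge> real N" using n N1 by auto
  have A0: "A \<ge> 0" using a by linarith
  let ?E = "if n = N then 0 else energy (n - 1)" and ?B = "if n = N then 0 else (cmod (V (n - 1) 0))\<^sup>2"
  let ?U = "integral {0..1} (\<lambda>x. (cmod (V (n - 1) x))\<^sup>2)"
  have U: "?U \<ge> 0" "?U \<le> energy (n - 1)"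
    using mass_le_energy by (auto intro!: integral_nonneg integrable_continuous_interval continuous_intros contV)
  have dU: "(V (n - 1) has_vector_derivative of_real ?k * V n x) (at x within {0..1})" if "x \<in> {0..1}" for x
    using dV[OF that, of "n - 1"] n1(1) by simp
  have "integral {0..1} (\<lambda>x. (2 * ?m * x + Re s)\<^sup>2 * (cmod (V n x))\<^sup>2) \<le>
     integral {0..1} (\<lambda>x. (cmod (F n x))\<^sup>2)
     + 2 * (3 + A) / ?m * integral {0..1} (\<lambda>x. (1 + (?m * x)\<^sup>2) * (cmod (V n x))\<^sup>2)
     + 2 * \<sigma> * coef n * ?m / ?k * ?U + \<sigma> * coef n * A / ?k * (cmod (V (n - 1) 0))\<^sup>2"
    by (rule real_part_estimate[OF dV dU contF[OF n]])
      (use eq[OF n] sg n1 a coef_bounds[OF n] in \<open>auto simp: coef_def mult_ac\<close>)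
  also have "2 * (3 + A) / ?m * integral {0..1} (\<lambda>x. (1 + (?m * x)\<^sup>2) * (cmod (V n x))\<^sup>2) \<le> 2 * (3 + A) / real N * energy n"
    unfolding energy_def[symmetric] using energy_nonneg n1 A0
    by (intro mult_right_mono divide_left_mono) auto
  also have "2 * \<sigma> * coef n * ?m / ?k * ?U \<le> 2 * \<sigma>\<^sup>2 / real N * ?E"
  proof (cases "n = N")
    case False
    have "2 * \<sigma> * coef n * ?m / ?k = 2 * \<sigma>\<^sup>2 * coef n / real n"
    proof -
      have "?m \<noteq> 0" "real n \<noteq> 0" using n1 by auto
      then show ?thesis using sg unfolding power2_eq_square by (simp del: of_nat_add of_nat_Suc add: divide_simps)
    qed
    also have "\<dots> \<le> 2 * \<sigma>\<^sup>2 / real N"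
      using coef_bounds[OF n] n1 mult_left_mono[of "coef n" 1 "2 * \<sigma>\<^sup>2"] by (intro frac_le) auto
    finally show ?thesis using U False by (simp only: if_False) (intro mult_mono; simp)
  qed (simp add: coef_N)
  also have "\<sigma> * coef n * A / ?k * (cmod (V (n - 1) 0))\<^sup>2 \<le> \<sigma>\<^sup>2 * A / real N * ?B"
  proof (cases "n = N")
    case False
    have "\<sigma> * coef n * A / ?k = \<sigma>\<^sup>2 * A * coef n / (real n * ?m)"
    proof -
      have "?m \<noteq> 0" "real n \<noteq> 0" using n1 by auto
      then show ?thesis using sg unfolding power2_eq_square by (simp del: of_nat_add of_nat_Suc add: divide_simps)
    qed
    also have "\<dots> \<le> \<sigma>\<^sup>2 * A / real N"
      using coef_bounds[OF n] n1 mult_left_mono[of "coef n" 1 "\<sigma>\<^sup>2 * A"] A0 mult_mono[of "real N" "real n" 1 ?m]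
      by (intro frac_le) auto
    finally show ?thesis using False by (simp only: if_False) (intro mult_right_mono; simp)
  qed (simp add: coef_N)
  finally have 1: "integral {0..1} (\<lambda>x. (2 * ?m * x + Re s)\<^sup>2 * (cmod (V n x))\<^sup>2) \<le> source n
     + (2 * (3 + A) / real N * energy n + 2 * \<sigma>\<^sup>2 / real N * ?E + \<sigma>\<^sup>2 * A / real N * ?B)"
    by (simp add: source_def)
  have E0: "?E \<ge> 0" "?B \<ge> 0" "energy n \<ge> 0" using energy_nonneg by auto
  define K where "K = (2 * (3 + A) + 2 * \<sigma>\<^sup>2 + \<sigma>\<^sup>2 * A) / real N"
  have sA: "0 \<le> \<sigma>\<^sup>2 * A" "0 \<le> \<sigma>\<^sup>2" using A0 by auto
  have "2 * (3 + A) / real N \<le> K" "2 * \<sigma>\<^sup>2 / real N \<le> K" "\<sigma>\<^sup>2 * A / real N \<le> K"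
    unfolding K_def using sA A0 by (auto intro!: divide_right_mono)
  then have "2 * (3 + A) / real N * energy n + 2 * \<sigma>\<^sup>2 / real N * ?E + \<sigma>\<^sup>2 * A / real N * ?B
     \<le> K * energy n + K * ?E + K * ?B"
    using E0 by (meson add_mono mult_right_mono)
  also have "\<dots> = K * (energy n + (if n = N then 0 else energy (n - 1) + (cmod (V (n - 1) 0))\<^sup>2))"
    by (cases "n = N") (simp_all add: distrib_left)
  finally show ?thesis using 1 unfolding K_def by (rule order_trans[OF _ add_left_mono, rotated])
qed

lemma real_part_sum:
  assumes a: "\<bar>Re s\<bar> \<le> A" "A \<le> 2 * real N"
  shows "(\<Sum>n=N..N+j. integral {0..1} (\<lambda>x. (2 * real (n + 1) * x + Re s)\<^sup>2 * (cmod (V n x))\<^sup>2)) \<le>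
     (\<Sum>n=N..N+j. source n) + (2 * (3 + A) + 2 * \<sigma>\<^sup>2 + \<sigma>\<^sup>2 * A) / real N *
       (2 * (\<Sum>n=N..N+j. energy n) + (\<Sum>n=N..N+j. (cmod (V n 0))\<^sup>2))"
proof -
  let ?K = "(2 * (3 + A) + 2 * \<sigma>\<^sup>2 + \<sigma>\<^sup>2 * A) / real N"
  let ?G = "\<lambda>n. energy n + (cmod (V n 0))\<^sup>2"
  have K: "?K \<ge> 0" using a by (intro divide_nonneg_nonneg add_nonneg_nonneg mult_nonneg_nonneg) auto
  have "(\<Sum>n=N..N+j. integral {0..1} (\<lambda>x. (2 * real (n + 1) * x + Re s)\<^sup>2 * (cmod (V n x))\<^sup>2)) \<le>
     (\<Sum>n=N..N+j. source n + ?K * (energy n + (if n = N then 0 else ?G (n - 1))))"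
    using real_part_bound[OF _ a] by (intro sum_mono) auto
  also have "\<dots> = (\<Sum>n=N..N+j. source n) + ?K * ((\<Sum>n=N..N+j. energy n) + (\<Sum>n=N..N+j. if n = N then 0 else ?G (n - 1)))"
    by (simp only: sum.distrib sum_distrib_left[symmetric])
  also have "\<dots> \<le> (\<Sum>n=N..N+j. source n) + ?K * ((\<Sum>n=N..N+j. energy n) + (\<Sum>n=N..N+j. ?G n))"
    using K energy_nonneg by (intro add_left_mono mult_left_mono sum_shift_le) auto
  also have "\<dots> = (\<Sum>n=N..N+j. source n) + ?K * (2 * (\<Sum>n=N..N+j. energy n) + (\<Sum>n=N..N+j. (cmod (V n 0))\<^sup>2))"
    by (simp add: sum.distrib)
  finally show ?thesis .
qed

text \<open>For \<open>Re s \<ge> 1\<close> the squared multiplier dominates the energy density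
  \<open>1 + y^2\<close>. The factor 4 in the condition on \<open>N\<close> leaves the energies with
  weight one half on the right, which is absorbed on the left.\<close>

lemma energy_sum_right_half_plane:
  assumes a: "\<bar>Re s\<bar> \<le> A" "A \<le> 2 * real N" "Re s \<ge> 1"
    and K: "4 * (2 * (3 + A) + 2 * \<sigma>\<^sup>2 + \<sigma>\<^sup>2 * A) \<le> real N"
  shows "(\<Sum>n=N..N+j. energy n) \<le> 2 * (\<Sum>n=N..N+j. source n) + (\<Sum>n=N..N+j. (cmod (V n 0))\<^sup>2)"
proof -
  have "energy n \<le> integral {0..1} (\<lambda>x. (2 * real (n + 1) * x + Re s)\<^sup>2 * (cmod (V n x))\<^sup>2)" for n
    unfolding energy_def
  proof (intro integral_le integrable_continuous_interval continuous_intros contV mult_right_mono)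
    fix x :: real assume x: "x \<in> {0..1}"
    let ?y = "real (n + 1) * x"
    have y: "?y \<ge> 0" using x by simp
    have "0 \<le> ?y * Re s" "1 \<le> (Re s)\<^sup>2" using y a(3) by (auto simp: one_le_power)
    moreover have "(2 * ?y + Re s)\<^sup>2 = 4 * ?y\<^sup>2 + 4 * (?y * Re s) + (Re s)\<^sup>2" by (simp add: power2_eq_square algebra_simps)
    ultimately have "1 + ?y\<^sup>2 \<le> (2 * ?y + Re s)\<^sup>2" using zero_le_power2[of ?y] by linarith
    then show "1 + (real (n + 1) * x)\<^sup>2 \<le> (2 * real (n + 1) * x + Re s)\<^sup>2" by (simp add: mult_ac)
  qed auto
  then have "(\<Sum>n=N..N+j. energy n) \<le> (\<Sum>n=N..N+j. integral {0..1} (\<lambda>x. (2 * real (n + 1) * x + Re s)\<^sup>2 * (cmod (V n x))\<^sup>2))"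
    by (intro sum_mono)
  also note real_part_sum[OF a(1,2)]
  also have "(2 * (3 + A) + 2 * \<sigma>\<^sup>2 + \<sigma>\<^sup>2 * A) / real N * (2 * (\<Sum>n=N..N+j. energy n) + (\<Sum>n=N..N+j. (cmod (V n 0))\<^sup>2))
     \<le> 1 / 4 * (2 * (\<Sum>n=N..N+j. energy n) + (\<Sum>n=N..N+j. (cmod (V n 0))\<^sup>2))"
    using K N1 energy_nonneg by (intro mult_right_mono add_nonneg_nonneg sum_nonneg mult_nonneg_nonneg) (auto simp: field_simps)
  finally show ?thesis using sum_nonneg[of "{N..N+j}" "\<lambda>n. (cmod (V n 0))\<^sup>2"] unfolding distrib_left by simp
qed

lemma imag_part_sum:
  assumes d: "\<delta> > 0"
  shows "\<bar>Im s\<bar> * (\<Sum>n=N..N+j. integral {0..1} (\<lambda>x. (cmod (V n x))\<^sup>2)) \<le>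
     (\<Sum>n=N..N+j. source n) / \<delta> + (\<delta> / 4 + 1 / (\<sigma> * real N)) * (\<Sum>n=N..N+j. energy n)
     + (\<Sum>n=N..N+j. integral {0..1} (\<lambda>x. max ((real (n + 1) * x)\<^sup>2) (\<sigma>\<^sup>2 - (real (n + 1) * x)\<^sup>2) / \<sigma> * (cmod (V n x))\<^sup>2))
     + (\<sigma> + 1 / \<sigma>) * energy (Suc (N + j))"
proof -
  define q where "q = (\<lambda>n x. (real (n + 1) * x)\<^sup>2)"
  let ?M = "\<lambda>n x. max (q n x) (\<sigma>\<^sup>2 - q n x) / \<sigma>"
  have N0: "real N > 0" using N1 by simp
  have pt: "\<bar>Im s\<bar> * (\<Sum>n=N..N+j. (cmod (V n x))\<^sup>2) \<le>
     (\<Sum>n=N..N+j. (cmod (F n x))\<^sup>2 / \<delta> + (\<delta> / 4 + 1 / (\<sigma> * real N)) * ((1 + q n x) * (cmod (V n x))\<^sup>2) + ?M n x * (cmod (V n x))\<^sup>2)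
     + (\<sigma> + 1 / \<sigma>) * ((1 + q (Suc (N + j)) x) * (cmod (V (Suc (N + j)) x))\<^sup>2)" if x: "x \<in> {0..1}" for x
  proof -
    have "\<bar>Im s\<bar> * (\<Sum>n=N..N+j. (cmod (V n x))\<^sup>2) \<le>
     (\<Sum>n=N..N+j. cmod (F n x) * cmod (V n x) + (max (q n x) (\<sigma>\<^sup>2 - q n x) + q n x / real N) / \<sigma> * (cmod (V n x))\<^sup>2)
     + (\<sigma> + 1 / \<sigma>) * (1 + q (Suc (N + j)) x) * (cmod (V (Suc (N + j)) x))\<^sup>2"
      unfolding q_def
      by (rule imag_part_estimate[OF sg _ _ _ N1, where c = coef])
        (use eq[OF _ x] coef_bounds coef_N in \<open>auto simp: coef_def\<close>)
    also have "(\<Sum>n=N..N+j. cmod (F n x) * cmod (V n x) + (max (q n x) (\<sigma>\<^sup>2 - q n x) + q n x / real N) / \<sigma> * (cmod (V n x))\<^sup>2)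
      \<le> (\<Sum>n=N..N+j. (cmod (F n x))\<^sup>2 / \<delta> + (\<delta> / 4 + 1 / (\<sigma> * real N)) * ((1 + q n x) * (cmod (V n x))\<^sup>2) + ?M n x * (cmod (V n x))\<^sup>2)"
    proof (rule sum_mono)
      fix n assume "n \<in> {N..N+j}"
      let ?v = "cmod (V n x)" and ?f = "cmod (F n x)"
      have q0: "q n x \<ge> 0" unfolding q_def by simp
      \<comment> \<open>Young's inequality, weighted so that \<open>?v^2\<close> receives
        \<open>\<delta> / 4\<close>, a quarter of the coercivity constant available when the
        estimates are combined.\<close>
      have "(?f * sqrt (2 / \<delta>)) * (sqrt (\<delta> / 2) * ?v) \<le> (?f * sqrt (2 / \<delta>))\<^sup>2 / 2 + (sqrt (\<delta> / 2) * ?v)\<^sup>2 / 2"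
        by (rule mult_le_half_squares)
      moreover have "sqrt (2 / \<delta>) * sqrt (\<delta> / 2) = 1" using d by (simp add: real_sqrt_mult[symmetric])
      moreover have "(?f * sqrt (2 / \<delta>)) * (sqrt (\<delta> / 2) * ?v) = ?f * ?v * (sqrt (2 / \<delta>) * sqrt (\<delta> / 2))"
        by (simp only: mult_ac)
      moreover have "(?f * sqrt (2 / \<delta>))\<^sup>2 / 2 + (sqrt (\<delta> / 2) * ?v)\<^sup>2 / 2 = ?f\<^sup>2 / \<delta> + \<delta> / 4 * ?v\<^sup>2"
        using d by (simp add: power_mult_distrib)
      ultimately have "?f * ?v \<le> ?f\<^sup>2 / \<delta> + \<delta> / 4 * ?v\<^sup>2" by simp
      moreover have "\<delta> / 4 * ?v\<^sup>2 \<le> \<delta> / 4 * ((1 + q n x) * ?v\<^sup>2)"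
        using d q0 mult_right_mono[of 1 "1 + q n x" "?v\<^sup>2"] by (intro mult_left_mono) auto
      moreover have "(q n x / real N) / \<sigma> * ?v\<^sup>2 \<le> 1 / (\<sigma> * real N) * ((1 + q n x) * ?v\<^sup>2)"
        using sg N0 by (simp add: field_simps)
      ultimately show "?f * ?v + (max (q n x) (\<sigma>\<^sup>2 - q n x) + q n x / real N) / \<sigma> * ?v\<^sup>2
         \<le> ?f\<^sup>2 / \<delta> + (\<delta> / 4 + 1 / (\<sigma> * real N)) * ((1 + q n x) * ?v\<^sup>2) + ?M n x * ?v\<^sup>2"
        unfolding add_divide_distrib distrib_right by linarith
    qed
    finally show ?thesis by (simp only: mult.assoc)
  qed
  have qc: "continuous_on {0..1} (q n)" for n unfolding q_def by (intro continuous_intros)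
  have iV: "(\<lambda>x. (cmod (V n x))\<^sup>2) integrable_on {0..1}" for n
    by (intro integrable_continuous_interval continuous_intros contV)
  have iE: "(\<lambda>x. (1 + q n x) * (cmod (V n x))\<^sup>2) integrable_on {0..1}" for n
    by (intro integrable_continuous_interval continuous_intros contV qc)
  have iM: "(\<lambda>x. ?M n x * (cmod (V n x))\<^sup>2) integrable_on {0..1}" for n
    using sg by (intro integrable_continuous_interval continuous_intros contV qc) auto
  have iF: "(\<lambda>x. (cmod (F n x))\<^sup>2) integrable_on {0..1}" if "n \<ge> N" for n
    by (intro integrable_continuous_interval continuous_intros contF that)
  have eE: "energy n = integral {0..1} (\<lambda>x. (1 + q n x) * (cmod (V n x))\<^sup>2)" for n
    unfolding energy_def q_def ..
  have L: "((\<lambda>x. \<bar>Im s\<bar> * (\<Sum>n=N..N+j. (cmod (V n x))\<^sup>2)) has_integral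
      \<bar>Im s\<bar> * (\<Sum>n=N..N+j. integral {0..1} (\<lambda>x. (cmod (V n x))\<^sup>2))) {0..1}"
    by (intro has_integral_mult_right has_integral_sum integrable_integral iV) auto
  have R: "((\<lambda>x. (\<Sum>n=N..N+j. (cmod (F n x))\<^sup>2 / \<delta> + (\<delta> / 4 + 1 / (\<sigma> * real N)) * ((1 + q n x) * (cmod (V n x))\<^sup>2) + ?M n x * (cmod (V n x))\<^sup>2)
     + (\<sigma> + 1 / \<sigma>) * ((1 + q (Suc (N + j)) x) * (cmod (V (Suc (N + j)) x))\<^sup>2)) has_integral
     (\<Sum>n=N..N+j. source n / \<delta> + (\<delta> / 4 + 1 / (\<sigma> * real N)) * energy n + integral {0..1} (\<lambda>x. ?M n x * (cmod (V n x))\<^sup>2))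
     + (\<sigma> + 1 / \<sigma>) * energy (Suc (N + j))) {0..1}"
    unfolding eE source_def
    by (intro has_integral_add has_integral_mult_right has_integral_divide has_integral_sum integrable_integral iV iE iM iF) auto
  have "\<bar>Im s\<bar> * (\<Sum>n=N..N+j. integral {0..1} (\<lambda>x. (cmod (V n x))\<^sup>2)) \<le>
     (\<Sum>n=N..N+j. source n / \<delta> + (\<delta> / 4 + 1 / (\<sigma> * real N)) * energy n + integral {0..1} (\<lambda>x. ?M n x * (cmod (V n x))\<^sup>2))
     + (\<sigma> + 1 / \<sigma>) * energy (Suc (N + j))"
    by (rule has_integral_le[OF L R pt])
  then show ?thesis unfolding q_def
    by (simp only: sum.distrib sum_divide_distrib[symmetric] sum_distrib_left[symmetric])
qed

text \<open>The last term is the only tail: it vanishes in the limit once \<open>u \<in> X\<^sup>\<sigma>\<close> is known, whereas in the right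
  half-plane the preceding estimate needs no such knowledge.\<close>

lemma energy_sum:
  assumes a: "\<bar>Re s\<bar> \<le> A" "A \<le> 2 * real N"
    and d: "\<delta> > 0" and M: "M \<ge> 0"
    and pos: "\<And>y. y \<ge> 0 \<Longrightarrow> \<delta> * (1 + y\<^sup>2) \<le> M * (2 * y + Re s)\<^sup>2 + \<bar>Im s\<bar> - max (y\<^sup>2) (\<sigma>\<^sup>2 - y\<^sup>2) / \<sigma>"
    and K: "2 * M * (2 * (3 + A) + 2 * \<sigma>\<^sup>2 + \<sigma>\<^sup>2 * A) + 1 / \<sigma> \<le> \<delta> / 4 * real N"
  shows "\<delta> / 2 * (\<Sum>n=N..N+j. energy n) \<le> (M + 1 / \<delta>) * (\<Sum>n=N..N+j. source n)
     + \<delta> * (\<Sum>n=N..N+j. (cmod (V n 0))\<^sup>2) + (\<sigma> + 1 / \<sigma>) * energy (Suc (N + j))"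
proof -
  define q where "q = (\<lambda>n x. (real (n + 1) * x)\<^sup>2)"
  let ?m = "\<lambda>n x. max (q n x) (\<sigma>\<^sup>2 - q n x) / \<sigma>"
  let ?IV = "\<lambda>n. integral {0..1} (\<lambda>x. (cmod (V n x))\<^sup>2)"
  let ?IM = "\<lambda>n. integral {0..1} (\<lambda>x. ?m n x * (cmod (V n x))\<^sup>2)"
  let ?IP = "\<lambda>n. integral {0..1} (\<lambda>x. (2 * real (n + 1) * x + Re s)\<^sup>2 * (cmod (V n x))\<^sup>2)"
  define K' where "K' = (2 * (3 + A) + 2 * \<sigma>\<^sup>2 + \<sigma>\<^sup>2 * A) / real N"
  have N0: "real N > 0" using N1 by simp
  have A0: "A \<ge> 0" using a by linarith
  have K0: "K' \<ge> 0" unfolding K'_def using A0 by (intro divide_nonneg_nonneg add_nonneg_nonneg mult_nonneg_nonneg) auto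
  have "(2 * M * (2 * (3 + A) + 2 * \<sigma>\<^sup>2 + \<sigma>\<^sup>2 * A) + 1 / \<sigma>) / real N \<le> \<delta> / 4"
    using K N0 by (simp add: divide_le_eq)
  then have K4: "2 * M * K' + 1 / (\<sigma> * real N) \<le> \<delta> / 4"
    unfolding K'_def times_divide_eq_right[symmetric] add_divide_distrib[of _ "1 / \<sigma>"] divide_divide_eq_left .
  have qc: "continuous_on {0..1} (q n)" for n unfolding q_def by (intro continuous_intros)
  \<comment> \<open>The coercivity hypothesis at \<open>y = (n + 1) x\<close>, integrated against
    \<open>(cmod (V n x))^2\<close>.\<close>
  have low: "\<delta> * energy n \<le> M * ?IP n + \<bar>Im s\<bar> * ?IV n - ?IM n" for n
  proof (rule has_integral_le)
    show "((\<lambda>x. \<delta> * ((1 + q n x) * (cmod (V n x))\<^sup>2)) has_integral \<delta> * energy n) {0..1}"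
      unfolding energy_def q_def by (intro has_integral_mult_right integrable_integral integrable_continuous_interval continuous_intros contV)
    show "((\<lambda>x. M * ((2 * real (n + 1) * x + Re s)\<^sup>2 * (cmod (V n x))\<^sup>2) + \<bar>Im s\<bar> * (cmod (V n x))\<^sup>2 - ?m n x * (cmod (V n x))\<^sup>2)
        has_integral M * ?IP n + \<bar>Im s\<bar> * ?IV n - ?IM n) {0..1}"
      using sg by (intro has_integral_diff has_integral_add has_integral_mult_right integrable_integral integrable_continuous_interval continuous_intros contV qc) auto
    fix x :: real assume x: "x \<in> {0..1}"
    have "\<delta> * (1 + q n x) \<le> M * (2 * real (n + 1) * x + Re s)\<^sup>2 + \<bar>Im s\<bar> - ?m n x"
      using pos[of "real (n + 1) * x"] x unfolding q_def by (simp add: mult_ac)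
    then have "\<delta> * (1 + q n x) * (cmod (V n x))\<^sup>2 \<le> (M * (2 * real (n + 1) * x + Re s)\<^sup>2 + \<bar>Im s\<bar> - ?m n x) * (cmod (V n x))\<^sup>2"
      by (intro mult_right_mono) auto
    then show "\<delta> * ((1 + q n x) * (cmod (V n x))\<^sup>2) \<le> M * ((2 * real (n + 1) * x + Re s)\<^sup>2 * (cmod (V n x))\<^sup>2) + \<bar>Im s\<bar> * (cmod (V n x))\<^sup>2 - ?m n x * (cmod (V n x))\<^sup>2"
      by (simp only: mult.assoc distrib_right left_diff_distrib)
  qed
  let ?E = "\<Sum>n=N..N+j. energy n" and ?S = "\<Sum>n=N..N+j. source n" and ?B = "\<Sum>n=N..N+j. (cmod (V n 0))\<^sup>2"
  \<comment> \<open>The budget: of \<open>\<delta> * E\<close> on the left, one quarter pays for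
    Young's inequality, another for the errors \<open>2 * M * K'\<close> and
    \<open>1 / (\<sigma> * real N)\<close>, and one half survives.\<close>
  have alg: "\<delta> / 2 * E \<le> (M + 1 / \<delta>) * S + \<delta> * B + T"
    if "\<delta> * E \<le> M * P + I - Q" "M * P \<le> M * (S + K' * (2 * E + B))"
      "I \<le> S / \<delta> + (\<delta> / 4 + 1 / (\<sigma> * real N)) * E + Q + T"
      "(2 * M * K' + 1 / (\<sigma> * real N)) * E \<le> \<delta> / 4 * E" "M * K' * B \<le> \<delta> * B" for E S B T P I Q
  proof -
    have "M * (S + K' * (2 * E + B)) = M * S + 2 * M * K' * E + M * K' * B"
      "(\<delta> / 4 + 1 / (\<sigma> * real N)) * E = \<delta> / 4 * E + 1 / (\<sigma> * real N) * E"
      "(2 * M * K' + 1 / (\<sigma> * real N)) * E = 2 * M * K' * E + 1 / (\<sigma> * real N) * E"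
      "(M + 1 / \<delta>) * S = M * S + S / \<delta>" "\<delta> * E = \<delta> / 4 * E + \<delta> / 4 * E + \<delta> / 2 * E"
      by (simp_all add: algebra_simps)
    then show ?thesis using that by linarith
  qed
  have E0: "?E \<ge> 0" "?B \<ge> 0" using energy_nonneg by (auto intro: sum_nonneg)
  have "\<delta> * ?E \<le> (\<Sum>n=N..N+j. M * ?IP n + \<bar>Im s\<bar> * ?IV n - ?IM n)"
    unfolding sum_distrib_left by (intro sum_mono low)
  also have "\<dots> = M * (\<Sum>n=N..N+j. ?IP n) + \<bar>Im s\<bar> * (\<Sum>n=N..N+j. ?IV n) - (\<Sum>n=N..N+j. ?IM n)"
    by (simp only: sum.distrib sum_subtractf sum_distrib_left[symmetric])
  finally have 1: "\<delta> * ?E \<le> M * (\<Sum>n=N..N+j. ?IP n) + \<bar>Im s\<bar> * (\<Sum>n=N..N+j. ?IV n) - (\<Sum>n=N..N+j. ?IM n)" .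
  have 2: "M * (\<Sum>n=N..N+j. ?IP n) \<le> M * (?S + K' * (2 * ?E + ?B))"
    unfolding K'_def using M by (intro mult_left_mono real_part_sum a)
  have 3: "\<bar>Im s\<bar> * (\<Sum>n=N..N+j. ?IV n) \<le> ?S / \<delta> + (\<delta> / 4 + 1 / (\<sigma> * real N)) * ?E + (\<Sum>n=N..N+j. ?IM n) + (\<sigma> + 1 / \<sigma>) * energy (Suc (N + j))"
    unfolding q_def by (rule imag_part_sum[OF d])
  have 4: "(2 * M * K' + 1 / (\<sigma> * real N)) * ?E \<le> \<delta> / 4 * ?E"
    using K4 E0 by (intro mult_right_mono)
  have "0 \<le> 1 / (\<sigma> * real N)" "0 \<le> M * K'" using sg N0 K0 M by auto
  then have 5: "M * K' * ?B \<le> \<delta> * ?B"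
    using K4 d E0 by (intro mult_right_mono) linarith+
  show ?thesis by (rule alg[OF 1 2 3 4 5])
qed

end

section \<open>Smooth functions and the spaces X and Y\<close>

text \<open>One-sided derivatives on the closed interval are unique, so the choice inside
  \<open>nderiv\<close> is immaterial on \<open>[0,1]\<close> and depends only on the values of the
  function there.\<close>

lemma smooth_derivs_unique:
  assumes D: "smooth_derivs u D" and E: "smooth_derivs v E" and uv: "\<And>x. x \<in> {0..1} \<Longrightarrow> u x = v x"
    and x: "x \<in> {0..1}"
  shows "D n x = E n x"
  using x
proof (induction n arbitrary: x)
  case 0
  then show ?case using D E uv by (simp add: smooth_derivs_def)
next
  case (Suc n)
  have "(D n has_vector_derivative D (Suc n) x) (at x within {0..1})"
    using D Suc.prems by (simp add: smooth_derivs_def)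
  moreover have "(D n has_vector_derivative E (Suc n) x) (at x within {0..1})"
    by (rule has_vector_derivative_transform[where f = "E n" and S = "{0..1}", OF Suc.prems Suc.IH])
      (use E Suc.prems in \<open>auto simp: smooth_derivs_def\<close>)
  ultimately show ?case
    using vector_derivative_unique_within_closed_interval[of 0 1 x] Suc.prems by (metis box_real(2) zero_less_one)
qed

lemma smooth_derivs_nderiv: "smooth01 u \<Longrightarrow> smooth_derivs u (nderiv u)"
proof -
  assume "smooth01 u"
  then have "smooth_derivs u (SOME D. smooth_derivs u D)" unfolding smooth01_def by (rule someI_ex)
  moreover have "nderiv u = (SOME D. smooth_derivs u D)" by (intro ext) (simp add: nderiv_def)
  ultimately show ?thesis by simp
qed

lemma smooth01I: "smooth_derivs u D \<Longrightarrow> smooth01 u"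
  by (auto simp: smooth01_def)

lemma nderiv_eq: "smooth_derivs u D \<Longrightarrow> x \<in> {0..1} \<Longrightarrow> nderiv u n x = D n x"
  using smooth_derivs_unique[OF smooth_derivs_nderiv[OF smooth01I]] by blast

lemma nderiv_0: "smooth01 u \<Longrightarrow> x \<in> {0..1} \<Longrightarrow> nderiv u 0 x = u x"
  using smooth_derivs_nderiv by (auto simp: smooth_derivs_def)

lemma nderiv_has_derivative:
  "smooth01 u \<Longrightarrow> x \<in> {0..1} \<Longrightarrow> (nderiv u n has_vector_derivative nderiv u (Suc n) x) (at x within {0..1})"
  using smooth_derivs_nderiv by (auto simp: smooth_derivs_def)

lemma nderiv_continuous: "smooth01 u \<Longrightarrow> continuous_on {0..1} (nderiv u n)"
  by (rule has_vector_derivative_continuous_on[OF nderiv_has_derivative])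

lemma smooth_derivs_linear:
  assumes "smooth01 f" "smooth01 g"
  shows "smooth_derivs (\<lambda>y. a * f y + g y) (\<lambda>n y. a * nderiv f n y + nderiv g n y)"
  unfolding smooth_derivs_def using assms
  by (auto simp: nderiv_0 intro!: has_vector_derivative_add has_vector_derivative_mult_right nderiv_has_derivative)

lemma nderiv_linear:
  assumes "smooth01 f" "smooth01 g" "x \<in> {0..1}"
  shows "nderiv (\<lambda>y. a * f y + g y) n x = a * nderiv f n x + nderiv g n x"
  by (rule nderiv_eq[OF smooth_derivs_linear[OF assms(1,2)] assms(3)])

lemma smooth01_linear: "smooth01 f \<Longrightarrow> smooth01 g \<Longrightarrow> smooth01 (\<lambda>y. a * f y + g y)"
  by (rule smooth01I[OF smooth_derivs_linear])

lemma smooth_derivs_shift: "smooth01 u \<Longrightarrow> smooth_derivs (nderiv u 1) (\<lambda>n. nderiv u (n + 1))"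
  by (auto simp: smooth_derivs_def nderiv_has_derivative)

lemma nderiv_shift: "smooth01 u \<Longrightarrow> x \<in> {0..1} \<Longrightarrow> nderiv (nderiv u 1) n x = nderiv u (n + 1) x"
  by (rule nderiv_eq[OF smooth_derivs_shift])

lemma smooth_derivs_zero: "smooth_derivs (\<lambda>x. 0) (\<lambda>n x. 0)"
  by (auto simp: smooth_derivs_def)

lemma nderiv_zero: "x \<in> {0..1} \<Longrightarrow> nderiv (\<lambda>x. 0) n x = 0"
  by (rule nderiv_eq[OF smooth_derivs_zero])

section \<open>The weights, and each norm as a single series\<close>

definition gw :: "real \<Rightarrow> nat \<Rightarrow> real" where
  "gw \<sigma> n = \<sigma> ^ n / (fact n * fact (Suc n))"

lemma gw_pos: "\<sigma> > 0 \<Longrightarrow> gw \<sigma> n > 0" by (simp add: gw_def)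

lemma gw_Suc: "\<sigma> > 0 \<Longrightarrow> gw \<sigma> n = gw \<sigma> (Suc n) * (real (n + 1) * real (n + 2) / \<sigma>)"
  by (simp add: gw_def divide_simps)

lemma gw_square: "(gw \<sigma> n)\<^sup>2 = \<sigma> ^ (2*n) / ((fact n)^2 * (fact (Suc n))^2)"
  by (simp add: gw_def power_divide power_mult_distrib power_mult[symmetric] mult.commute)

lemma cterm_alt: "cterm \<sigma> k 0 d u n = (gw \<sigma> n)\<^sup>2 * real n ^ k * integral {0..1} (\<lambda>x. (x / \<sigma>) ^ k * (cmod (nderiv u (n + d) x))\<^sup>2)"
  by (simp only: cterm_def gw_square add_0_right)

lemma cterm_zero: "cterm \<sigma> k 0 d (\<lambda>x. 0) n = 0"
proof -
  have "integral {0..1} (\<lambda>x. (x / \<sigma>) ^ k * (cmod (nderiv (\<lambda>x. 0) (n + d) x))\<^sup>2) = integral {0..1} (\<lambda>x::real. 0::real)"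
    by (rule integral_cong) (simp add: nderiv_zero)
  then show ?thesis unfolding cterm_alt by simp
qed

lemma bterm_alt: "bterm \<sigma> d u n = \<sigma> * (gw \<sigma> n)\<^sup>2 * (cmod (nderiv u (n + d) 0))\<^sup>2"
  by (simp add: bterm_def gw_square)

lemma cterm_integrable:
  assumes "smooth01 u"
  shows "(\<lambda>x. (x / \<sigma>) ^ k * (cmod (nderiv u m x))\<^sup>2) integrable_on {0..1}"
  unfolding divide_inverse
  by (intro integrable_continuous_interval continuous_intros nderiv_continuous assms)

lemma cterm_nonneg: "\<sigma> > 0 \<Longrightarrow> smooth01 u \<Longrightarrow> cterm \<sigma> k 0 d u n \<ge> 0"
  unfolding cterm_alt by (intro mult_nonneg_nonneg integral_nonneg cterm_integrable) auto

lemma bterm_nonneg: "\<sigma> > 0 \<Longrightarrow> bterm \<sigma> d u n \<ge> 0"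
  unfolding bterm_alt by (intro mult_nonneg_nonneg) auto

lemma cmod_linear_square_le: "(cmod (a * z + w))\<^sup>2 \<le> 2 * (cmod a)\<^sup>2 * (cmod z)\<^sup>2 + 2 * (cmod w)\<^sup>2"
proof -
  have "(cmod (a * z + w))\<^sup>2 \<le> (cmod a * cmod z + cmod w)\<^sup>2"
    using norm_triangle_ineq[of "a * z" w] by (intro power_mono) (auto simp: norm_mult)
  also have "\<dots> \<le> 2 * (cmod a * cmod z)\<^sup>2 + 2 * (cmod w)\<^sup>2"
    using sum_squares_bound[of "cmod a * cmod z" "cmod w"] by (simp add: power2_sum)
  finally show ?thesis by (simp add: power_mult_distrib)
qed

lemma cterm_linear_le:
  assumes sg: "\<sigma> > 0" and f: "smooth01 f" and g: "smooth01 g"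
  shows "cterm \<sigma> k 0 d (\<lambda>y. a * f y + g y) n \<le> 2 * (cmod a)\<^sup>2 * cterm \<sigma> k 0 d f n + 2 * cterm \<sigma> k 0 d g n"
proof -
  let ?w = "\<lambda>x. (x / \<sigma>) ^ k"
  have "integral {0..1} (\<lambda>x. ?w x * (cmod (nderiv (\<lambda>y. a * f y + g y) (n + d) x))\<^sup>2)
     \<le> integral {0..1} (\<lambda>x. 2 * (cmod a)\<^sup>2 * (?w x * (cmod (nderiv f (n + d) x))\<^sup>2) + 2 * (?w x * (cmod (nderiv g (n + d) x))\<^sup>2))"
  proof (rule integral_le)
    fix x :: real assume x: "x \<in> {0..1}"
    have "?w x * (cmod (nderiv (\<lambda>y. a * f y + g y) (n + d) x))\<^sup>2
      \<le> ?w x * (2 * (cmod a)\<^sup>2 * (cmod (nderiv f (n + d) x))\<^sup>2 + 2 * (cmod (nderiv g (n + d) x))\<^sup>2)"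
      unfolding nderiv_linear[OF f g x] using x sg by (intro mult_left_mono cmod_linear_square_le) auto
    then show "?w x * (cmod (nderiv (\<lambda>y. a * f y + g y) (n + d) x))\<^sup>2
      \<le> 2 * (cmod a)\<^sup>2 * (?w x * (cmod (nderiv f (n + d) x))\<^sup>2) + 2 * (?w x * (cmod (nderiv g (n + d) x))\<^sup>2)"
      by (simp only: distrib_left mult_ac)
  qed (intro integrable_add integrable_on_mult_right cterm_integrable f g smooth01_linear)+
  also have "\<dots> = 2 * (cmod a)\<^sup>2 * integral {0..1} (\<lambda>x. ?w x * (cmod (nderiv f (n + d) x))\<^sup>2)
      + 2 * integral {0..1} (\<lambda>x. ?w x * (cmod (nderiv g (n + d) x))\<^sup>2)"
    by (subst integral_add) (auto intro!: integrable_on_mult_right cterm_integrable f g)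
  finally have "(gw \<sigma> n)\<^sup>2 * real n ^ k * integral {0..1} (\<lambda>x. ?w x * (cmod (nderiv (\<lambda>y. a * f y + g y) (n + d) x))\<^sup>2)
     \<le> (gw \<sigma> n)\<^sup>2 * real n ^ k * (2 * (cmod a)\<^sup>2 * integral {0..1} (\<lambda>x. ?w x * (cmod (nderiv f (n + d) x))\<^sup>2)
      + 2 * integral {0..1} (\<lambda>x. ?w x * (cmod (nderiv g (n + d) x))\<^sup>2))"
    by (intro mult_left_mono) auto
  then show ?thesis unfolding cterm_alt by (simp only: distrib_left mult_ac)
qed

lemma bterm_linear_le:
  assumes sg: "\<sigma> > 0" and f: "smooth01 f" and g: "smooth01 g"
  shows "bterm \<sigma> d (\<lambda>y. a * f y + g y) n \<le> 2 * (cmod a)\<^sup>2 * bterm \<sigma> d f n + 2 * bterm \<sigma> d g n"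
proof -
  have "\<sigma> * (gw \<sigma> n)\<^sup>2 * (cmod (nderiv (\<lambda>y. a * f y + g y) (n + d) 0))\<^sup>2
    \<le> \<sigma> * (gw \<sigma> n)\<^sup>2 * (2 * (cmod a)\<^sup>2 * (cmod (nderiv f (n + d) 0))\<^sup>2 + 2 * (cmod (nderiv g (n + d) 0))\<^sup>2)"
    using nderiv_linear[OF f g, of 0] sg by (intro mult_left_mono) (auto simp: cmod_linear_square_le)
  then show ?thesis unfolding bterm_alt by (simp only: distrib_left mult_ac)
qed

text \<open>Merging the parts of the norm into one series of nonnegative terms makes membership a
  single summability statement and the squared norm a single sum.\<close>

definition Xterm :: "real \<Rightarrow> (real \<Rightarrow> complex) \<Rightarrow> nat \<Rightarrow> real" where
  "Xterm \<sigma> u n = cterm \<sigma> 0 0 1 u n + cterm \<sigma> 1 0 1 u n + cterm \<sigma> 2 0 1 u n + bterm \<sigma> 1 u n"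

definition Yterm :: "real \<Rightarrow> (real \<Rightarrow> complex) \<Rightarrow> nat \<Rightarrow> real" where
  "Yterm \<sigma> u n = cterm \<sigma> 0 0 0 u n + cterm \<sigma> 1 0 0 u n + bterm \<sigma> 0 u n"

context
  fixes \<sigma> :: real
  assumes sg: "\<sigma> > 0"
begin

lemma Xterm_nonneg: "smooth01 u \<Longrightarrow> Xterm \<sigma> u n \<ge> 0"
  unfolding Xterm_def by (intro add_nonneg_nonneg cterm_nonneg bterm_nonneg sg)

lemma Yterm_nonneg: "smooth01 u \<Longrightarrow> Yterm \<sigma> u n \<ge> 0"
  unfolding Yterm_def by (intro add_nonneg_nonneg cterm_nonneg bterm_nonneg sg)

lemma Xterm_linear_le:
  "smooth01 f \<Longrightarrow> smooth01 g \<Longrightarrow> Xterm \<sigma> (\<lambda>y. a * f y + g y) n \<le> 2 * (cmod a)\<^sup>2 * Xterm \<sigma> f n + 2 * Xterm \<sigma> g n"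
  using cterm_linear_le[OF sg, of f g 0 1 a n] cterm_linear_le[OF sg, of f g 1 1 a n]
    cterm_linear_le[OF sg, of f g 2 1 a n] bterm_linear_le[OF sg, of f g 1 a n]
  unfolding Xterm_def distrib_left by linarith

lemma Yterm_linear_le:
  "smooth01 f \<Longrightarrow> smooth01 g \<Longrightarrow> Yterm \<sigma> (\<lambda>y. a * f y + g y) n \<le> 2 * (cmod a)\<^sup>2 * Yterm \<sigma> f n + 2 * Yterm \<sigma> g n"
  using cterm_linear_le[OF sg, of f g 0 0 a n] cterm_linear_le[OF sg, of f g 1 0 a n]
    bterm_linear_le[OF sg, of f g 0 a n]
  unfolding Yterm_def distrib_left by linarith

lemma summable_dominated:
  fixes f g :: "nat \<Rightarrow> real"
  assumes "summable g" "\<And>n. 0 \<le> f n" "\<And>n. f n \<le> g n"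
  shows "summable f"
  using assms by (intro summable_comparison_test[OF _ assms(1)]) auto

lemma Xsp_iff: "u \<in> Xsp \<sigma> \<longleftrightarrow> smooth01 u \<and> u 1 = 0 \<and> summable (Xterm \<sigma> u)"
proof -
  have "summable (cterm \<sigma> 0 0 1 u) \<and> summable (cterm \<sigma> 1 0 1 u) \<and> summable (cterm \<sigma> 2 0 1 u) \<and> summable (bterm \<sigma> 1 u)
      \<longleftrightarrow> summable (Xterm \<sigma> u)" if u: "smooth01 u"
  proof
    assume "summable (cterm \<sigma> 0 0 1 u) \<and> summable (cterm \<sigma> 1 0 1 u) \<and> summable (cterm \<sigma> 2 0 1 u) \<and> summable (bterm \<sigma> 1 u)"
    then show "summable (Xterm \<sigma> u)" unfolding Xterm_def[abs_def] by (intro summable_add) auto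
  next
    assume S: "summable (Xterm \<sigma> u)"
    note nn = cterm_nonneg[OF sg u, of 0 1] cterm_nonneg[OF sg u, of 1 1] cterm_nonneg[OF sg u, of 2 1] bterm_nonneg[OF sg, of 1 u]
    show "summable (cterm \<sigma> 0 0 1 u) \<and> summable (cterm \<sigma> 1 0 1 u) \<and> summable (cterm \<sigma> 2 0 1 u) \<and> summable (bterm \<sigma> 1 u)"
      by (intro conjI; rule summable_dominated[OF S]) (auto simp: Xterm_def nn add_nonneg_nonneg simp del: One_nat_def)
  qed
  then show ?thesis unfolding Xsp_def by blast
qed

lemma Ysp_iff: "u \<in> Ysp \<sigma> \<longleftrightarrow> smooth01 u \<and> summable (Yterm \<sigma> u)"
proof -
  have "summable (cterm \<sigma> 0 0 0 u) \<and> summable (cterm \<sigma> 1 0 0 u) \<and> summable (bterm \<sigma> 0 u)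
      \<longleftrightarrow> summable (Yterm \<sigma> u)" if u: "smooth01 u"
  proof
    assume "summable (cterm \<sigma> 0 0 0 u) \<and> summable (cterm \<sigma> 1 0 0 u) \<and> summable (bterm \<sigma> 0 u)"
    then show "summable (Yterm \<sigma> u)" unfolding Yterm_def[abs_def] by (intro summable_add) auto
  next
    assume S: "summable (Yterm \<sigma> u)"
    note nn = cterm_nonneg[OF sg u, of 0 0] cterm_nonneg[OF sg u, of 1 0] bterm_nonneg[OF sg, of 0 u]
    show "summable (cterm \<sigma> 0 0 0 u) \<and> summable (cterm \<sigma> 1 0 0 u) \<and> summable (bterm \<sigma> 0 u)"
      by (intro conjI; rule summable_dominated[OF S]) (auto simp: Yterm_def nn add_nonneg_nonneg simp del: One_nat_def)
  qed
  then show ?thesis unfolding Ysp_def by blast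
qed

lemma Xnorm_eq: "u \<in> Xsp \<sigma> \<Longrightarrow> Xnorm \<sigma> u = sqrt (suminf (Xterm \<sigma> u))"
  unfolding Xsp_def Xnorm_def Xterm_def[abs_def] by (simp add: suminf_add[symmetric] summable_add)

lemma Ynorm_eq: "u \<in> Ysp \<sigma> \<Longrightarrow> Ynorm \<sigma> u = sqrt (suminf (Yterm \<sigma> u))"
  unfolding Ysp_def Ynorm_def Yterm_def[abs_def] by (simp add: suminf_add[symmetric] summable_add)

lemma suminf_Xterm_nonneg: "u \<in> Xsp \<sigma> \<Longrightarrow> suminf (Xterm \<sigma> u) \<ge> 0"
  by (auto simp: Xsp_iff Xterm_nonneg intro: suminf_nonneg)

lemma suminf_Yterm_nonneg: "u \<in> Ysp \<sigma> \<Longrightarrow> suminf (Yterm \<sigma> u) \<ge> 0"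
  by (auto simp: Ysp_iff Yterm_nonneg intro: suminf_nonneg)

lemma Xnorm_nonneg: "u \<in> Xsp \<sigma> \<Longrightarrow> Xnorm \<sigma> u \<ge> 0"
  by (simp add: Xnorm_eq suminf_Xterm_nonneg)

lemma Ynorm_nonneg: "u \<in> Ysp \<sigma> \<Longrightarrow> Ynorm \<sigma> u \<ge> 0"
  by (simp add: Ynorm_eq suminf_Yterm_nonneg)

lemma Xnorm_square: "u \<in> Xsp \<sigma> \<Longrightarrow> (Xnorm \<sigma> u)\<^sup>2 = suminf (Xterm \<sigma> u)"
  by (simp add: Xnorm_eq suminf_Xterm_nonneg)

lemma Ynorm_square: "u \<in> Ysp \<sigma> \<Longrightarrow> (Ynorm \<sigma> u)\<^sup>2 = suminf (Yterm \<sigma> u)"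
  by (simp add: Ynorm_eq suminf_Yterm_nonneg)

lemma Xsp_linear:
  assumes "f \<in> Xsp \<sigma>" "g \<in> Xsp \<sigma>"
  shows "(\<lambda>y. a * f y + g y) \<in> Xsp \<sigma>"
proof -
  have sm: "smooth01 f" "smooth01 g" "summable (Xterm \<sigma> f)" "summable (Xterm \<sigma> g)" using assms by (auto simp: Xsp_iff)
  have "summable (\<lambda>n. 2 * (cmod a)\<^sup>2 * Xterm \<sigma> f n + 2 * Xterm \<sigma> g n)" using sm by (intro summable_add summable_mult)
  then have "summable (Xterm \<sigma> (\<lambda>y. a * f y + g y))"
    by (rule summable_dominated) (auto intro: Xterm_nonneg Xterm_linear_le smooth01_linear sm)
  then show ?thesis using assms sm by (auto simp: Xsp_iff smooth01_linear)
qed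

lemma Ysp_linear:
  assumes "f \<in> Ysp \<sigma>" "g \<in> Ysp \<sigma>"
  shows "(\<lambda>y. a * f y + g y) \<in> Ysp \<sigma>"
proof -
  have sm: "smooth01 f" "smooth01 g" "summable (Yterm \<sigma> f)" "summable (Yterm \<sigma> g)" using assms by (auto simp: Ysp_iff)
  have "summable (\<lambda>n. 2 * (cmod a)\<^sup>2 * Yterm \<sigma> f n + 2 * Yterm \<sigma> g n)" using sm by (intro summable_add summable_mult)
  then have "summable (Yterm \<sigma> (\<lambda>y. a * f y + g y))"
    by (rule summable_dominated) (auto intro: Yterm_nonneg Yterm_linear_le smooth01_linear sm)
  then show ?thesis using sm by (auto simp: Ysp_iff smooth01_linear)
qed

lemma Yterm_zero: "Yterm \<sigma> (\<lambda>x. 0) = (\<lambda>n. 0)"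
  by (intro ext) (simp add: Yterm_def cterm_zero bterm_alt nderiv_zero)

lemma zero_Ysp: "(\<lambda>x. 0) \<in> Ysp \<sigma>"
  using smooth01I[OF smooth_derivs_zero] by (simp add: Ysp_iff Yterm_zero)

lemma Ynorm_zero: "Ynorm \<sigma> (\<lambda>x. 0) = 0"
  by (simp add: Ynorm_eq[OF zero_Ysp] Yterm_zero)

lemma zero_Xsp: "(\<lambda>x. 0) \<in> Xsp \<sigma>"
proof -
  have "Xterm \<sigma> (\<lambda>x. 0) = (\<lambda>n. 0)" by (intro ext) (simp add: Xterm_def cterm_zero bterm_alt nderiv_zero)
  then show ?thesis using smooth01I[OF smooth_derivs_zero] by (simp add: Xsp_iff)
qed

text \<open>The terms of \<open>u'\<close> in the norm of Y are exactly those of \<open>u\<close> in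
  the norm of X with the part \<open>k = 2\<close> omitted, so the comparison holds term by
  term.\<close>

lemma derivative_Ysp:
  assumes u: "u \<in> Xsp \<sigma>"
  shows "nderiv u 1 \<in> Ysp \<sigma>" and "Ynorm \<sigma> (nderiv u 1) \<le> Xnorm \<sigma> u"
proof -
  have sm: "smooth01 u" "summable (Xterm \<sigma> u)" using u by (auto simp: Xsp_iff)
  have sm1: "smooth01 (nderiv u 1)" by (rule smooth01I[OF smooth_derivs_shift[OF sm(1)]])
  have c: "cterm \<sigma> k 0 0 (nderiv u 1) n = cterm \<sigma> k 0 1 u n" for k n
    unfolding cterm_alt by (auto intro!: integral_cong simp: nderiv_shift[OF sm(1)] simp del: One_nat_def)
  have b: "bterm \<sigma> 0 (nderiv u 1) n = bterm \<sigma> 1 u n" for n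
    unfolding bterm_alt using nderiv_shift[OF sm(1), of 0 n] by (simp del: One_nat_def)
  have le: "Yterm \<sigma> (nderiv u 1) n \<le> Xterm \<sigma> u n" for n
    unfolding Yterm_def Xterm_def c b using cterm_nonneg[OF sg sm(1), of 2 1 n] by simp
  have "summable (Yterm \<sigma> (nderiv u 1))"
    by (rule summable_dominated[OF sm(2)]) (use le Yterm_nonneg[OF sm1] in auto)
  then show 1: "nderiv u 1 \<in> Ysp \<sigma>" using sm1 by (simp add: Ysp_iff)
  have "suminf (Yterm \<sigma> (nderiv u 1)) \<le> suminf (Xterm \<sigma> u)"
    by (rule suminf_le) (use le sm \<open>summable (Yterm \<sigma> (nderiv u 1))\<close> in auto)
  then show "Ynorm \<sigma> (nderiv u 1) \<le> Xnorm \<sigma> u" unfolding Ynorm_eq[OF 1] Xnorm_eq[OF u] by simp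
qed

end

section \<open>A one-dimensional Sobolev inequality\<close>

lemma integral_square_le:
  fixes h :: "real \<Rightarrow> real"
  assumes h: "continuous_on {0..1} h"
  shows "(integral {0..1} h)\<^sup>2 \<le> integral {0..1} (\<lambda>x. (h x)\<^sup>2)"
proof -
  define m where "m = integral {0..1} h"
  have i: "h integrable_on {0..1}" "(\<lambda>x. (h x)\<^sup>2) integrable_on {0..1}"
    by (auto intro!: integrable_continuous_interval continuous_intros h)
  have "((\<lambda>x. (h x)\<^sup>2 - 2 * m * h x + m\<^sup>2) has_integral (integral {0..1} (\<lambda>x. (h x)\<^sup>2) - 2 * m * m + m\<^sup>2)) {0..1}"
    using has_integral_const_real[of "m\<^sup>2" 0 1] unfolding m_def
    by (intro has_integral_add has_integral_diff has_integral_mult_right integrable_integral i) auto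
  then have "0 \<le> integral {0..1} (\<lambda>x. (h x)\<^sup>2) - 2 * m * m + m\<^sup>2"
  proof (rule has_integral_nonneg)
    fix x
    have "(h x)\<^sup>2 - 2 * m * h x + m\<^sup>2 = (h x - m)\<^sup>2" by (simp add: power2_eq_square algebra_simps)
    then show "0 \<le> (h x)\<^sup>2 - 2 * m * h x + m\<^sup>2" by simp
  qed
  then show ?thesis unfolding m_def[symmetric] by (simp add: power2_eq_square)
qed

text \<open>The value at \<open>x\<close> is compared with the value at an arbitrary
  \<open>t\<close> through the integral of the derivative, and the resulting inequality is averaged
  over \<open>t\<close>.\<close>

lemma sup_bound:
  fixes g g' :: "real \<Rightarrow> complex"
  assumes g: "\<And>x. x \<in> {0..1} \<Longrightarrow> (g has_vector_derivative g' x) (at x within {0..1})"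
    and g': "continuous_on {0..1} g'" and x: "x \<in> {0..1}"
  shows "(cmod (g x))\<^sup>2 \<le> 2 * integral {0..1} (\<lambda>t. (cmod (g t))\<^sup>2) + 2 * integral {0..1} (\<lambda>t. (cmod (g' t))\<^sup>2)"
proof -
  let ?J = "integral {0..1} (\<lambda>t. cmod (g' t))" and ?K = "integral {0..1} (\<lambda>t. (cmod (g' t))\<^sup>2)"
  have cg: "continuous_on {0..1} g" by (rule has_vector_derivative_continuous_on[OF g])
  have ftc: "cmod (g b - g a) \<le> ?J" if ab: "0 \<le> a" "a \<le> b" "b \<le> 1" for a b
  proof -
    have sub: "{a..b} \<subseteq> {0..1}" using ab by auto
    have "(g' has_integral g b - g a) {a..b}"
      by (rule fundamental_theorem_of_calculus[OF ab(2)])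
        (use g ab in \<open>auto intro: has_vector_derivative_within_subset[OF _ sub]\<close>)
    then have "cmod (g b - g a) = cmod (integral {a..b} g')" by (simp add: integral_unique)
    also have "\<dots> \<le> integral {a..b} (\<lambda>t. cmod (g' t))"
      using continuous_on_subset[OF g' sub] by (intro integral_norm_bound_integral integrable_continuous_interval continuous_intros) auto
    also have "\<dots> \<le> ?J"
      using continuous_on_subset[OF g' sub] g' sub by (intro integral_subset_le integrable_continuous_interval continuous_intros) auto
    finally show ?thesis .
  qed
  have pt: "(cmod (g x))\<^sup>2 \<le> 2 * (cmod (g t))\<^sup>2 + 2 * ?K" if t: "t \<in> {0..1}" for t
  proof -
    have "cmod (g x - g t) \<le> ?J"
      using ftc[of t x] ftc[of x t] x t by (cases "t \<le> x") (auto simp: norm_minus_commute)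
    then have "(cmod (g x - g t))\<^sup>2 \<le> ?J\<^sup>2" by (intro power_mono) auto
    also have "\<dots> \<le> ?K" by (intro integral_square_le continuous_intros g')
    finally have "(cmod (g x - g t))\<^sup>2 \<le> ?K" .
    moreover have "(cmod (1 * g t + (g x - g t)))\<^sup>2 \<le> 2 * (cmod 1)\<^sup>2 * (cmod (g t))\<^sup>2 + 2 * (cmod (g x - g t))\<^sup>2"
      by (rule cmod_linear_square_le)
    ultimately show ?thesis by simp
  qed
  have L: "((\<lambda>t::real. (cmod (g x))\<^sup>2) has_integral (cmod (g x))\<^sup>2) {0..1}"
    using has_integral_const_real[of "(cmod (g x))\<^sup>2" 0 1] by simp
  have R: "((\<lambda>t. 2 * (cmod (g t))\<^sup>2 + 2 * ?K) has_integral 2 * integral {0..1} (\<lambda>t. (cmod (g t))\<^sup>2) + 2 * ?K) {0..1}"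
  proof (rule has_integral_add)
    show "((\<lambda>t::real. 2 * ?K) has_integral 2 * ?K) {0..1}"
      using has_integral_const_real[of "2 * ?K" 0 1] by simp
  qed (intro has_integral_mult_right integrable_integral integrable_continuous_interval continuous_intros cg)
  show ?thesis by (rule has_integral_le[OF L R pt])
qed

section \<open>The parameter region\<close>

text \<open>The curve \<open>(Re s)\<^sup>2 = 4 \<sigma> |Im s|\<close> is where the imaginary-part estimate degenerates at the zero
  \<open>y = - Re s / 2\<close> of the real-part multiplier.\<close>

definition good :: "real \<Rightarrow> complex set" where
  "good \<sigma> = {s. Re s > 0 \<and> \<sigma> < cmod s} \<union> {s. Re s \<le> 0 \<and> \<sigma> < \<bar>Im s\<bar> \<and> (Re s)\<^sup>2 < 4 * \<sigma> * \<bar>Im s\<bar>}"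

text \<open>Only \<open>Re s = - c \<le> 0\<close> needs work. If
  \<open>c^2 \<ge> 4 \<sigma> |Im s|\<close>, then \<open>c > 2 \<sigma>\<close> because
  \<open>|Im s| > \<sigma>\<close>. With \<open>r = |s|\<close>, the second region would give
  \<open>c r < 2 \<sigma> (r - c) \<le> 2 \<sigma> r\<close>, a contradiction; the third one is
  excluded by an upper bound for \<open>r\<close>.\<close>

lemma Omega_subset_good:
  assumes sg: "\<sigma> > 0"
  shows "Omega \<sigma> \<subseteq> good \<sigma>"
proof
  fix s assume s: "s \<in> Omega \<sigma>"
  show "s \<in> good \<sigma>"
  proof (cases "Re s > 0")
    case True
    then show ?thesis using s by (auto simp: Omega_def Omega1_def good_def)
  next
    case False
    define c b r where "c = - Re s" and "b = \<bar>Im s\<bar>" and "r = cmod s"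
    have c0: "c \<ge> 0" and bs: "b > \<sigma>" using False s by (auto simp: Omega_def Omega1_def c_def b_def)
    have r2: "r\<^sup>2 = c\<^sup>2 + b\<^sup>2" unfolding r_def c_def b_def cmod_power2 by simp
    have rb: "r \<ge> b" unfolding r_def b_def by (rule abs_Im_le_cmod)
    have rp: "r > 0" using rb bs sg by linarith
    have "c\<^sup>2 < 4 * \<sigma> * b"
    proof (rule ccontr)
      assume "\<not> c\<^sup>2 < 4 * \<sigma> * b"
      then have le: "4 * \<sigma> * b \<le> c\<^sup>2" by simp
      have "(2 * \<sigma>)\<^sup>2 < 4 * \<sigma> * b" using bs sg by (simp add: power2_eq_square)
      then have "(2 * \<sigma>)\<^sup>2 < c\<^sup>2" using le by linarith
      then have c2: "c > 2 * \<sigma>" using c0 by (rule power2_less_imp_less)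
      consider "s \<in> Omega2 \<sigma>" | "s \<in> Omega3 \<sigma>" using s by (auto simp: Omega_def)
      then show False
      proof cases
        case 1
        then have 1: "\<sigma> < r - c" "c * r / (2 * (r - c)) < \<sigma>"
          by (auto simp: Omega2_def r_def c_def)
        then have "c * r < \<sigma> * (2 * (r - c))" using sg by (simp add: divide_less_eq)
        also have "\<dots> \<le> \<sigma> * (2 * r)" using sg c0 by (intro mult_left_mono) auto
        finally have "c * r < (2 * \<sigma>) * r" by (simp only: mult_ac)
        then have "c < 2 * \<sigma>" using rp by (simp only: mult_less_cancel_right_pos)
        then show False using c2 by simp
      next
        case 2
        then have 2: "\<sigma> * (r - \<sigma> - c) > (\<sigma> * (1 - c / r) - c / 2)\<^sup>2"
          by (auto simp: Omega3_def r_def c_def)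
        \<comment> \<open>The summand \<open>2 * \<sigma>\<close> is chosen so that the cross term
          of the square is exactly \<open>c^2\<close>, which matches
          \<open>r^2 = c^2 + b^2\<close>.\<close>
        have "r \<le> c\<^sup>2 / (4 * \<sigma>) + 2 * \<sigma>"
        proof (rule power2_le_imp_le)
          have "b \<le> c\<^sup>2 / (4 * \<sigma>)" using le sg by (simp add: field_simps)
          then have "b\<^sup>2 \<le> (c\<^sup>2 / (4 * \<sigma>))\<^sup>2" using bs sg by (intro power_mono) auto
          moreover have "(c\<^sup>2 / (4 * \<sigma>) + 2 * \<sigma>)\<^sup>2 = (c\<^sup>2 / (4 * \<sigma>))\<^sup>2 + c\<^sup>2 + 4 * \<sigma>\<^sup>2"
          proof -
            have "2 * (c\<^sup>2 / (4 * \<sigma>)) * (2 * \<sigma>) = c\<^sup>2" using sg by simp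
            moreover have "(2 * \<sigma>)\<^sup>2 = 4 * \<sigma>\<^sup>2" by (simp add: power_mult_distrib)
            ultimately show ?thesis unfolding power2_sum by linarith
          qed
          ultimately show "r\<^sup>2 \<le> (c\<^sup>2 / (4 * \<sigma>) + 2 * \<sigma>)\<^sup>2" using r2 zero_le_power2[of \<sigma>] by linarith
        qed (use sg in auto)
        then have "\<sigma> * r \<le> \<sigma> * (c\<^sup>2 / (4 * \<sigma>) + 2 * \<sigma>)" using sg by (intro mult_left_mono) auto
        moreover have "\<sigma> * (c\<^sup>2 / (4 * \<sigma>) + 2 * \<sigma>) = c\<^sup>2 / 4 + 2 * \<sigma>\<^sup>2"
          using sg by (simp add: distrib_left power2_eq_square)
        moreover have "(c / 2 - \<sigma>)\<^sup>2 = c\<^sup>2 / 4 - \<sigma> * c + \<sigma>\<^sup>2"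
          by (simp add: power2_eq_square algebra_simps)
        moreover have "\<sigma> * (r - \<sigma> - c) = \<sigma> * r - \<sigma>\<^sup>2 - \<sigma> * c"
          by (simp add: power2_eq_square algebra_simps)
        ultimately have "\<sigma> * (r - \<sigma> - c) \<le> (c / 2 - \<sigma>)\<^sup>2" by linarith
        \<comment> \<open>Here \<open>c > 2 * \<sigma>\<close> is essential: the base
          \<open>c / 2 - \<sigma>\<close> is positive, so enlarging it enlarges the square.\<close>
        also have "\<dots> \<le> (c / 2 - \<sigma> + \<sigma> * c / r)\<^sup>2"
          using c2 sg rp c0 by (intro power_mono) auto
        also have "\<dots> = (\<sigma> * (1 - c / r) - c / 2)\<^sup>2"
          by (subst power2_minus[symmetric]) (simp add: algebra_simps)
        finally show False using 2 by simp
      qed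
    qed
    then show ?thesis using bs False by (simp add: good_def b_def c_def)
  qed
qed

text \<open>On either side of the imaginary axis the conditions weaken as the real part grows, and
  at a crossing \<open>|Im s| > \<sigma>\<close> implies \<open>|s| > \<sigma>\<close>.\<close>

lemma good_add_nonneg:
  assumes "s \<in> good \<sigma>" "t \<ge> 0"
  shows "s + of_real t \<in> good \<sigma>"
proof (cases "Re s > 0")
  case True
  then have "cmod s \<le> cmod (s + of_real t)"
    unfolding cmod_def using assms by (auto intro!: power_mono)
  then show ?thesis using assms True by (auto simp: good_def)
next
  case False
  then have s: "\<sigma> < \<bar>Im s\<bar>" "(Re s)\<^sup>2 < 4 * \<sigma> * \<bar>Im s\<bar>" using assms by (auto simp: good_def)
  show ?thesis
  proof (cases "Re s + t > 0")
    case True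
    then show ?thesis using s abs_Im_le_cmod[of "s + of_real t"] by (auto simp: good_def)
  next
    case f: False
    have "\<bar>Re s + t\<bar> \<le> \<bar>Re s\<bar>" using f assms False by linarith
    then have "(Re s + t)\<^sup>2 \<le> (Re s)\<^sup>2" by (simp add: abs_le_square_iff)
    then show ?thesis using s f by (auto simp: good_def)
  qed
qed

lemma good_cmod_gt: "s \<in> good \<sigma> \<Longrightarrow> \<sigma> < cmod s"
  using abs_Im_le_cmod[of s] by (auto simp: good_def)

text \<open>The pointwise content of \<open>M\<close> times the real-part estimate plus the
  imaginary-part estimate, with \<open>\<delta> * (1 + y^2)\<close> as the density of the energy.
  Asking for all \<open>y \<ge> 0\<close> makes it uniform in \<open>n\<close>, where
  \<open>y = (n + 1) x\<close>.\<close>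

definition coercive_at :: "real \<Rightarrow> real \<Rightarrow> real \<Rightarrow> complex \<Rightarrow> bool" where
  "coercive_at \<sigma> M \<delta> s \<longleftrightarrow> (\<forall>y\<ge>0. \<delta> * (1 + y\<^sup>2) \<le> M * (2 * y + Re s)\<^sup>2 + \<bar>Im s\<bar> - max (y\<^sup>2) (\<sigma>\<^sup>2 - y\<^sup>2) / \<sigma>)"

lemma coercive_at_mono:
  assumes "coercive_at \<sigma> M \<delta> s" "M \<le> M'" "\<delta>' \<le> \<delta>"
  shows "coercive_at \<sigma> M' \<delta>' s"
  unfolding coercive_at_def
proof (intro allI impI)
  fix y :: real assume "y \<ge> 0"
  have "\<delta>' * (1 + y\<^sup>2) \<le> \<delta> * (1 + y\<^sup>2)" "M * (2 * y + Re s)\<^sup>2 \<le> M' * (2 * y + Re s)\<^sup>2"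
    using assms by (auto intro!: mult_right_mono)
  moreover have "\<delta> * (1 + y\<^sup>2) \<le> M * (2 * y + Re s)\<^sup>2 + \<bar>Im s\<bar> - max (y\<^sup>2) (\<sigma>\<^sup>2 - y\<^sup>2) / \<sigma>"
    using assms(1) \<open>y \<ge> 0\<close> by (simp add: coercive_at_def)
  ultimately show "\<delta>' * (1 + y\<^sup>2) \<le> M' * (2 * y + Re s)\<^sup>2 + \<bar>Im s\<bar> - max (y\<^sup>2) (\<sigma>\<^sup>2 - y\<^sup>2) / \<sigma>" by argo
qed

lemma coercive_atI:
  assumes sg: "\<sigma> > 0"
    and "\<And>y. y \<ge> 0 \<Longrightarrow> \<delta> * (1 + y\<^sup>2) \<le> M * (2 * y + Re s)\<^sup>2 + \<bar>Im s\<bar> - y\<^sup>2 / \<sigma>"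
    and "\<And>y. y \<ge> 0 \<Longrightarrow> \<delta> * (1 + y\<^sup>2) \<le> M * (2 * y + Re s)\<^sup>2 + \<bar>Im s\<bar> - (\<sigma> - y\<^sup>2 / \<sigma>)"
  shows "coercive_at \<sigma> M \<delta> s"
proof -
  have "(\<sigma>\<^sup>2 - y\<^sup>2) / \<sigma> = \<sigma> - y\<^sup>2 / \<sigma>" for y :: real
    using sg by (simp add: diff_divide_distrib power2_eq_square)
  then show ?thesis using assms unfolding coercive_at_def max_def by simp
qed

text \<open>Here \<open>(2 y + Re s)^2 \<ge> y^2 + h^2\<close>. The part
  \<open>1 + 1 / \<sigma>\<close> of the constant pays for \<open>y^2 + y^2 / \<sigma>\<close>, and
  the part \<open>(1 + \<sigma>) / h^2\<close> pays for \<open>1 + \<sigma>\<close>.\<close>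

lemma coercive_right:
  assumes sg: "\<sigma> > 0" and h: "h > 0" "Re s \<ge> h"
  shows "coercive_at \<sigma> ((1 + 1 / \<sigma>) + (1 + \<sigma>) / h\<^sup>2) 1 s"
proof -
  let ?M = "(1 + 1 / \<sigma>) + (1 + \<sigma>) / h\<^sup>2"
  have key: "(1 + y\<^sup>2) + \<sigma> + y\<^sup>2 / \<sigma> \<le> ?M * (2 * y + Re s)\<^sup>2" if y: "y \<ge> 0" for y
  proof -
    have "h\<^sup>2 \<le> (Re s)\<^sup>2" "0 \<le> y * Re s" using h y by (auto intro: power_mono)
    moreover have "(2 * y + Re s)\<^sup>2 = 4 * y\<^sup>2 + 4 * (y * Re s) + (Re s)\<^sup>2"
      by (simp add: power2_eq_square algebra_simps)
    ultimately have 1: "y\<^sup>2 + h\<^sup>2 \<le> (2 * y + Re s)\<^sup>2" using zero_le_power2[of y] by linarith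
    have "(1 + 1 / \<sigma>) * y\<^sup>2 + (1 + \<sigma>) / h\<^sup>2 * h\<^sup>2 \<le> ?M * (y\<^sup>2 + h\<^sup>2)"
      using sg by (simp only: distrib_left distrib_right) (simp add: add_nonneg_nonneg)
    also have "\<dots> \<le> ?M * (2 * y + Re s)\<^sup>2" using 1 sg by (intro mult_left_mono) auto
    finally have "(1 + 1 / \<sigma>) * y\<^sup>2 + (1 + \<sigma>) / h\<^sup>2 * h\<^sup>2 \<le> ?M * (2 * y + Re s)\<^sup>2" .
    moreover have "(1 + \<sigma>) / h\<^sup>2 * h\<^sup>2 = 1 + \<sigma>" using h by simp
    moreover have "(1 + 1 / \<sigma>) * y\<^sup>2 = y\<^sup>2 + y\<^sup>2 / \<sigma>" by (simp add: distrib_right)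
    ultimately show ?thesis by linarith
  qed
  define M where "M = ?M"
  have "coercive_at \<sigma> M 1 s"
  proof (rule coercive_atI[OF sg])
    fix y :: real assume y: "y \<ge> 0"
    define z where "z = y\<^sup>2 / \<sigma>"
    define P where "P = M * (2 * y + Re s)\<^sup>2"
    have "1 + y\<^sup>2 + \<sigma> + z \<le> P" using key[OF y] by (simp only: M_def z_def P_def)
    moreover have "0 \<le> z" using sg by (simp add: z_def)
    ultimately have "1 * (1 + y\<^sup>2) \<le> P + \<bar>Im s\<bar> - z \<and> 1 * (1 + y\<^sup>2) \<le> P + \<bar>Im s\<bar> - (\<sigma> - z)"
      using sg abs_ge_zero[of "Im s"] by (intro conjI) simp_all
    then show "1 * (1 + y\<^sup>2) \<le> M * (2 * y + Re s)\<^sup>2 + \<bar>Im s\<bar> - y\<^sup>2 / \<sigma>"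
      "1 * (1 + y\<^sup>2) \<le> M * (2 * y + Re s)\<^sup>2 + \<bar>Im s\<bar> - (\<sigma> - y\<^sup>2 / \<sigma>)" by (simp_all only: z_def P_def)
  qed
  then show ?thesis by (simp only: M_def)
qed

text \<open>Let \<open>u = y + Re s / 2\<close> be half the multiplier. Young's inequality for
  \<open>y = u - Re s / 2\<close> with parameter \<open>\<theta> = \<delta> \<sigma>\<close> puts a
  large constant on \<open>u^2\<close>, which \<open>M\<close> pays for, and leaves
  \<open>(1 / \<sigma> + \<delta>) (1 + \<theta>) (Re s)^2 / 4\<close>. This is
  \<open>(Re s)^2 / (4 \<sigma>)\<close>, the critical parabola, plus a term of order
  \<open>\<delta>\<close>, which the slack \<open>g\<close> covers.\<close>

lemma coercive_left:
  assumes sg: "\<sigma> > 0" and g: "g > 0" "\<bar>Im s\<bar> \<ge> \<sigma> + g" "\<bar>Im s\<bar> \<ge> (Re s)\<^sup>2 / (4 * \<sigma>) + g" and A: "\<bar>Re s\<bar> \<le> A"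
    and d: "0 < \<delta>" "\<delta> \<le> 1" "\<delta> \<le> 1 / \<sigma>" "\<delta> * ((2 + \<sigma>) * A\<^sup>2 / 4 + 1) \<le> g"
  shows "coercive_at \<sigma> ((1 / \<sigma> + \<delta>) * (1 + 1 / (\<delta> * \<sigma>))) \<delta> s"
proof (rule coercive_atI[OF sg])
  let ?M = "(1 / \<sigma> + \<delta>) * (1 + 1 / (\<delta> * \<sigma>))" and ?a = "Re s"
  have M0: "?M \<ge> 0" using sg d by (intro mult_nonneg_nonneg add_nonneg_nonneg) auto
  have dg: "\<delta> \<le> g"
  proof -
    have "\<delta> * 1 \<le> \<delta> * ((2 + \<sigma>) * A\<^sup>2 / 4 + 1)" using d sg by (intro mult_left_mono) auto
    then show ?thesis using d(4) by linarith
  qed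
  fix y :: real assume y: "y \<ge> 0"
  define u where "u = y + ?a / 2"
  define \<theta> where "\<theta> = \<delta> * \<sigma>"
  have t0: "\<theta> > 0" using d sg by (simp add: \<theta>_def)
  have "y\<^sup>2 \<le> (1 + 1 / \<theta>) * u\<^sup>2 + (1 + \<theta>) * (?a / 2)\<^sup>2"
  proof -
    have "0 \<le> (u / sqrt \<theta> + sqrt \<theta> * (?a / 2))\<^sup>2" by simp
    also have "\<dots> = u\<^sup>2 / \<theta> + \<theta> * (?a / 2)\<^sup>2 + u * ?a"
      using t0 by (simp add: power2_sum power_divide power_mult_distrib)
    finally have "0 \<le> u\<^sup>2 / \<theta> + \<theta> * (?a / 2)\<^sup>2 + u * ?a" .
    moreover have "y\<^sup>2 = u\<^sup>2 + (?a / 2)\<^sup>2 - u * ?a"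
      unfolding u_def by (simp add: power2_eq_square algebra_simps)
    moreover have "(1 + 1 / \<theta>) * u\<^sup>2 = u\<^sup>2 + u\<^sup>2 / \<theta>" "(1 + \<theta>) * (?a / 2)\<^sup>2 = (?a / 2)\<^sup>2 + \<theta> * (?a / 2)\<^sup>2"
      by (simp_all only: distrib_right mult_1 times_divide_eq_left)
    ultimately have "y\<^sup>2 \<le> u\<^sup>2 + u\<^sup>2 / \<theta> + ((?a / 2)\<^sup>2 + \<theta> * (?a / 2)\<^sup>2)" by linarith
    then show ?thesis using \<open>(1 + 1 / \<theta>) * u\<^sup>2 = _\<close> \<open>(1 + \<theta>) * (?a / 2)\<^sup>2 = _\<close> by simp
  qed
  then have "(1 / \<sigma> + \<delta>) * y\<^sup>2 \<le> (1 / \<sigma> + \<delta>) * ((1 + 1 / \<theta>) * u\<^sup>2 + (1 + \<theta>) * (?a / 2)\<^sup>2)"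
    using sg d by (intro mult_left_mono) auto
  also have "\<dots> = ?M * u\<^sup>2 + (1 / \<sigma> + \<delta>) * (1 + \<theta>) * (?a / 2)\<^sup>2"
    unfolding \<theta>_def by (subst distrib_left) (simp only: mult.assoc)
  also have "?M * u\<^sup>2 \<le> ?M * (2 * y + ?a)\<^sup>2"
  proof (rule mult_left_mono[OF _ M0])
    have "(2 * y + ?a)\<^sup>2 = 4 * u\<^sup>2" unfolding u_def by (simp add: power2_eq_square algebra_simps)
    then show "u\<^sup>2 \<le> (2 * y + ?a)\<^sup>2" using zero_le_power2[of u] by linarith
  qed
  also have "(1 / \<sigma> + \<delta>) * (1 + \<theta>) * (?a / 2)\<^sup>2 \<le> \<bar>Im s\<bar> - \<delta>"
  proof -
    have "(1 / \<sigma> + \<delta>) * (1 + \<theta>) * (?a / 2)\<^sup>2 = ?a\<^sup>2 / (4 * \<sigma>) + \<delta> * ((2 + \<delta> * \<sigma>) * ?a\<^sup>2 / 4)"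
      unfolding \<theta>_def using sg by (simp add: field_simps power2_eq_square)
    also have "\<delta> * ((2 + \<delta> * \<sigma>) * ?a\<^sup>2 / 4) \<le> \<delta> * ((2 + \<sigma>) * A\<^sup>2 / 4)"
      using d sg A mult_right_mono[of \<delta> 1 \<sigma>] by (intro mult_left_mono divide_right_mono mult_mono) (auto simp: power2_le_iff_abs_le)
    finally show ?thesis using g d by (simp add: distrib_left)
  qed
  finally have fin: "(1 / \<sigma> + \<delta>) * y\<^sup>2 \<le> ?M * (2 * y + ?a)\<^sup>2 + (\<bar>Im s\<bar> - \<delta>)" by simp
  define P z where "P = ?M * (2 * y + ?a)\<^sup>2" and "z = y\<^sup>2 / \<sigma>"
  have "(1 / \<sigma> + \<delta>) * y\<^sup>2 = z + \<delta> * y\<^sup>2" unfolding z_def by (simp add: distrib_right)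
  then have "z + \<delta> * y\<^sup>2 \<le> P + (\<bar>Im s\<bar> - \<delta>)" using fin unfolding P_def by simp
  then have "\<delta> * (1 + y\<^sup>2) \<le> P + \<bar>Im s\<bar> - z" by (simp add: distrib_left)
  then show "\<delta> * (1 + y\<^sup>2) \<le> ?M * (2 * y + ?a)\<^sup>2 + \<bar>Im s\<bar> - y\<^sup>2 / \<sigma>" unfolding P_def z_def .
  \<comment> \<open>In the other branch of the maximum the term in \<open>y^2\<close> has the good
    sign and pays for \<open>\<delta> * y^2\<close>; the constant terms need
    \<open>|Im s| \<ge> \<sigma> + g\<close> and \<open>\<delta> \<le> g\<close>.\<close>
  have "\<delta> * y\<^sup>2 \<le> 1 / \<sigma> * y\<^sup>2" using d by (intro mult_right_mono) auto
  then have "\<delta> * y\<^sup>2 \<le> z" unfolding z_def by simp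
  moreover have "0 \<le> P" unfolding P_def by (rule mult_nonneg_nonneg[OF M0]) simp
  ultimately have "\<delta> * (1 + y\<^sup>2) \<le> P + \<bar>Im s\<bar> - (\<sigma> - z)"
    using g(2) dg by (simp add: distrib_left)
  then show "\<delta> * (1 + y\<^sup>2) \<le> ?M * (2 * y + ?a)\<^sup>2 + \<bar>Im s\<bar> - (\<sigma> - y\<^sup>2 / \<sigma>)" unfolding P_def z_def .
qed

lemma coercive_locally:
  assumes sg: "\<sigma> > 0" and s0: "s0 \<in> good \<sigma>"
  obtains U M \<delta> where "open U" "s0 \<in> U" "\<delta> > 0" "\<And>s. s \<in> U \<Longrightarrow> coercive_at \<sigma> M \<delta> s"
proof (cases "Re s0 > 0")
  case True
  let ?U = "{s. Re s > Re s0 / 2}"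
  have "open ?U" by (intro open_Collect_less continuous_intros)
  then show ?thesis using True coercive_right[OF sg, of "Re s0 / 2"] by (intro that[of ?U 1 "(1 + 1 / \<sigma>) + (1 + \<sigma>) / (Re s0 / 2)\<^sup>2"]) auto
next
  case False
  then have s: "\<sigma> < \<bar>Im s0\<bar>" "(Re s0)\<^sup>2 < 4 * \<sigma> * \<bar>Im s0\<bar>" using s0 by (auto simp: good_def)
  \<comment> \<open>Half of the available slack, so that the inequalities hold strictly at
    \<open>s0\<close> and persist in an open neighbourhood.\<close>
  define g where "g = min (\<bar>Im s0\<bar> - \<sigma>) (\<bar>Im s0\<bar> - (Re s0)\<^sup>2 / (4 * \<sigma>)) / 2"
  define A where "A = \<bar>Re s0\<bar> + 1"
  define \<delta> where "\<delta> = min (min 1 (1 / \<sigma>)) (g / ((2 + \<sigma>) * A\<^sup>2 / 4 + 1))"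
  let ?U = "{s. \<sigma> + g < \<bar>Im s\<bar>} \<inter> {s. (Re s)\<^sup>2 / (4 * \<sigma>) + g < \<bar>Im s\<bar>} \<inter> {s. \<bar>Re s\<bar> < A}"
  have "(Re s0)\<^sup>2 / (4 * \<sigma>) < \<bar>Im s0\<bar>" using s sg by (simp add: field_simps)
  then have g: "g > 0" using s by (simp add: g_def)
  have op: "open ?U" using sg by (intro open_Int open_Collect_less continuous_intros) auto
  have D: "(2 + \<sigma>) * A\<^sup>2 / 4 + 1 > 0" using sg by (intro add_nonneg_pos) auto
  have d: "0 < \<delta>" "\<delta> \<le> 1" "\<delta> \<le> 1 / \<sigma>" "\<delta> \<le> g / ((2 + \<sigma>) * A\<^sup>2 / 4 + 1)"
    unfolding \<delta>_def using sg g D by auto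
  have d4: "\<delta> * ((2 + \<sigma>) * A\<^sup>2 / 4 + 1) \<le> g" using d(4) D by (simp add: pos_le_divide_eq)
  have m: "s0 \<in> ?U"
    using g s \<open>(Re s0)\<^sup>2 / (4 * \<sigma>) < \<bar>Im s0\<bar>\<close> unfolding g_def A_def by (auto simp: min_def field_simps)
  show ?thesis
    by (rule that[OF op m d(1)], rule coercive_left[OF sg g _ _ _ d(1-3) d4]) auto
qed

text \<open>Both constants are encoded in one index, \<open>M = k\<close> and
  \<open>\<delta> = 1 / (k + 1)\<close>. By monotonicity the open sets \<open>U k\<close> are
  nested, so a finite subcover reduces to a single one.\<close>

lemma coercive_on_compact:
  assumes sg: "\<sigma> > 0" and K: "compact K" "K \<subseteq> good \<sigma>"
  obtains M \<delta> where "M \<ge> 0" "\<delta> > 0" "\<And>s. s \<in> K \<Longrightarrow> coercive_at \<sigma> M \<delta> s"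
proof -
  define U where "U k = interior {s. coercive_at \<sigma> (real k) (1 / real (Suc k)) s}" for k
  have mono: "U k \<subseteq> U l" if "k \<le> l" for k l
  proof -
    have "1 / real (Suc l) \<le> 1 / real (Suc k)" using that by (simp add: frac_le)
    then show ?thesis unfolding U_def using that by (intro interior_mono) (auto elim!: coercive_at_mono)
  qed
  have "K \<subseteq> (\<Union>k. U k)"
  proof
    fix s assume "s \<in> K"
    then obtain W M \<delta> where W: "open W" "s \<in> W" "\<delta> > 0" "\<And>s. s \<in> W \<Longrightarrow> coercive_at \<sigma> M \<delta> s"
      using coercive_locally[OF sg] K by (metis subsetD)
    obtain k1 k2 where k: "M \<le> real k1" "1 / \<delta> \<le> real k2" using real_arch_simple by meson
    define k where "k = max k1 k2"
    have "real k2 \<le> real (Suc k)" unfolding k_def by simp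
    then have "1 / \<delta> \<le> real (Suc k)" using k(2) by linarith
    then have "1 / real (Suc k) \<le> \<delta>" using W(3) by (simp add: field_simps)
    moreover have "M \<le> real k" using k(1) unfolding k_def by simp
    ultimately have "W \<subseteq> {s. coercive_at \<sigma> (real k) (1 / real (Suc k)) s}" using W(4) coercive_at_mono by blast
    then have "s \<in> U k" unfolding U_def using W by (meson interiorI)
    then show "s \<in> (\<Union>k. U k)" by auto
  qed
  moreover have "open (U k)" for k unfolding U_def by simp
  ultimately obtain C where C: "finite C" "K \<subseteq> (\<Union>k\<in>C. U k)"
    by (metis compactE_image[OF K(1)])
  define m where "m = Max (insert 0 C)"
  have "U k \<subseteq> U m" if "k \<in> C" for k using that C(1) mono unfolding m_def by simp
  then have "K \<subseteq> U m" using C(2) by blast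
  then have "coercive_at \<sigma> (real m) (1 / real (Suc m)) s" if "s \<in> K" for s
    using that interior_subset unfolding U_def by blast
  then show ?thesis by (intro that[of "real m" "1 / real (Suc m)"]) auto
qed

lemma cmod_gap_on_compact:
  assumes K: "compact K" "K \<subseteq> good \<sigma>"
  obtains \<eta> where "\<eta> > 0" "\<And>s. s \<in> K \<Longrightarrow> \<sigma> + \<eta> \<le> cmod s"
proof (cases "K = {}")
  case True
  then show ?thesis using that[of 1] by auto
next
  case False
  obtain s1 where s1: "s1 \<in> K" "\<And>s. s \<in> K \<Longrightarrow> cmod s1 \<le> cmod s"
    using continuous_attains_inf[OF K(1) False, of cmod] continuous_on_norm_id by blast
  then show ?thesis using good_cmod_gt[of s1 \<sigma>] K by (intro that[of "cmod s1 - \<sigma>"]) auto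
qed

section \<open>Smooth solutions of the first-order equation\<close>

text \<open>With exponent \<open>p + 2\<close> this is the integrating factor of
  \<open>x^2 w' + ((p + 2) x + s) w\<close>, and with exponent \<open>p\<close> it is the factor
  that then multiplies the right-hand side. At \<open>t = 0\<close> the exponential evaluates to 1
  by the convention for division, and the power gives the value 0 as soon as
  \<open>p \<ge> 1\<close>.\<close>

definition weight :: "complex \<Rightarrow> nat \<Rightarrow> real \<Rightarrow> complex" where
  "weight s p t = of_real (t ^ p) * exp (- s / of_real t)"

lemma cmod_weight: "t \<ge> 0 \<Longrightarrow> cmod (weight s p t) = t ^ p * exp (- Re s / t)"
  by (simp add: weight_def norm_mult norm_power Re_divide_of_real)

lemma cmod_weight_le: "t \<ge> 0 \<Longrightarrow> Re s \<ge> 0 \<Longrightarrow> cmod (weight s p t) \<le> t ^ p"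
  by (simp add: cmod_weight mult_left_le divide_nonneg_nonneg)

lemma weight_add2: "weight s (p + 2) t = of_real (t\<^sup>2) * weight s p t"
  by (simp add: weight_def power_add power2_eq_square mult_ac)

lemma weight_nonzero: "t \<noteq> 0 \<Longrightarrow> weight s p t \<noteq> 0"
  by (simp add: weight_def)

lemma weight_derivative:
  assumes "x \<noteq> 0"
  shows "(weight s (p + 2) has_vector_derivative (of_real (real (p + 2) * x) + s) * weight s p x) (at x within S)"
proof -
  have nz: "complex_of_real x \<noteq> 0" using assms by simp
  have "((\<lambda>z. z ^ (p + 2) * exp (- s / z)) has_field_derivative
      (of_real (real (p + 2) * x) + s) * (of_real (x ^ p) * exp (- s / of_real x))) (at (of_real x))"
    by (rule derivative_eq_intros refl nz | simp add: nz)+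
      (use nz in \<open>simp add: field_simps power2_eq_square\<close>)
  from has_vector_derivative_real_field[OF this]
  have "((\<lambda>t. of_real t ^ (p + 2) * exp (- s / of_real t)) has_vector_derivative
      (of_real (real (p + 2) * x) + s) * weight s p x) (at x)" by (simp add: weight_def)
  then show ?thesis
    unfolding weight_def[abs_def] of_real_power by (rule has_vector_derivative_at_within)
qed

lemma weight_continuous:
  assumes "Re s \<ge> 0" "p \<ge> 1"
  shows "continuous_on {0..1} (weight s p)"
  unfolding continuous_on_eq_continuous_within
proof
  fix x :: real assume x: "x \<in> {0..1}"
  show "continuous (at x within {0..1}) (weight s p)"
  proof (cases "x = 0")
    case True
    have "((\<lambda>t::real. t ^ p) \<longlongrightarrow> 0 ^ p) (at 0 within {0..1})" by (intro tendsto_intros)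
    then have lim: "((\<lambda>t::real. t ^ p) \<longlongrightarrow> 0) (at 0 within {0..1})" using assms by (simp add: power_0_left)
    have "(weight s p \<longlongrightarrow> 0) (at 0 within {0..1})"
      by (rule Lim_null_comparison[OF _ lim])
        (use assms cmod_weight_le in \<open>auto simp: eventually_at_filter intro!: always_eventually\<close>)
    moreover have "weight s p 0 = 0" using assms by (simp add: weight_def power_0_left)
    ultimately show ?thesis using True by (simp add: continuous_within)
  next
    case False
    then show ?thesis unfolding weight_def[abs_def] by (auto intro!: continuous_intros)
  qed
qed

lemma weight_has_integral:
  assumes "Re s \<ge> 0" "0 \<le> x" "x \<le> 1"
  shows "((\<lambda>t. (of_real (real (p + 2) * t) + s) * weight s p t) has_integral weight s (p + 2) x) {0..x}"
proof -
  have "((\<lambda>t. (of_real (real (p + 2) * t) + s) * weight s p t) has_integral weight s (p + 2) x - weight s (p + 2) 0) {0..x}"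
  proof (rule fundamental_theorem_of_calculus_interior)
    show "continuous_on {0..x} (weight s (p + 2))"
      using weight_continuous[of s "p + 2"] assms by (auto intro: continuous_on_subset)
    show "(weight s (p + 2) has_vector_derivative (of_real (real (p + 2) * t) + s) * weight s p t) (at t)"
      if "t \<in> {0<..<x}" for t using that by (intro weight_derivative) auto
  qed (use assms in auto)
  then show ?thesis by (simp add: weight_def)
qed

text \<open>The modulus of the weight is the weight for the real parameter \<open>Re s\<close>, so
  its derivative formula can be integrated and the term \<open>(p + 2) t \<ge> 0\<close> dropped.
  The averaging kernel of the solution formula thus has mass at most
  \<open>1 / Re s\<close>.\<close>

lemma weight_integral_le:
  assumes "Re s > 0" "0 \<le> x" "x \<le> 1" "p \<ge> 1"
  shows "Re s * integral {0..x} (\<lambda>t. cmod (weight s p t)) \<le> cmod (weight s (p + 2) x)"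
proof -
  define a where "a = Re s"
  have cw: "cmod (weight s q t) = Re (weight (of_real a) q t)" if "t \<ge> 0" for q t
  proof -
    have "weight (of_real a) q t = of_real (t ^ q * exp (- a / t))"
      unfolding weight_def by (simp flip: exp_of_real)
    then show ?thesis unfolding cmod_weight[OF that] a_def by (simp only: Re_complex_of_real)
  qed
  have c: "continuous_on {0..x} (\<lambda>t. cmod (weight s p t))"
    using weight_continuous[of s p] assms by (auto intro!: continuous_on_norm intro: continuous_on_subset)
  have R: "((\<lambda>t. Re ((of_real (real (p + 2) * t) + of_real a) * weight (of_real a) p t)) has_integral Re (weight (of_real a) (p + 2) x)) {0..x}"
    using has_integral_Re[OF weight_has_integral[of "of_real a" x p]] assms by (simp add: a_def)
  have L: "((\<lambda>t. a * cmod (weight s p t)) has_integral a * integral {0..x} (\<lambda>t. cmod (weight s p t))) {0..x}"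
    by (intro has_integral_mult_right integrable_integral integrable_continuous_interval c)
  have "a * integral {0..x} (\<lambda>t. cmod (weight s p t)) \<le> Re (weight (of_real a) (p + 2) x)"
  proof (rule has_integral_le[OF L R])
    fix t assume t: "t \<in> {0..x}"
    have "Re ((of_real (real (p + 2) * t) + of_real a) * weight (of_real a) p t) = (real (p + 2) * t + a) * cmod (weight s p t)"
      using t by (simp only: of_real_add[symmetric] cw Re_complex_of_real atLeastAtMost_iff)
        (simp add: of_real_add[symmetric] del: of_real_add)
    moreover have "a * cmod (weight s p t) \<le> (real (p + 2) * t + a) * cmod (weight s p t)"
      using t by (intro mult_right_mono) auto
    ultimately show "a * cmod (weight s p t) \<le> Re ((of_real (real (p + 2) * t) + of_real a) * weight (of_real a) p t)"
      by (simp only:)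
  qed
  then show ?thesis using cw[of x "p + 2"] assms by (simp add: a_def)
qed

lemma inverse_weight_derivative:
  assumes "x \<noteq> 0"
  shows "((\<lambda>t. inverse (weight s (p + 2) t)) has_vector_derivative
     - ((of_real (real (p + 2) * x) + s) / of_real (x\<^sup>2)) * inverse (weight s (p + 2) x)) (at x within S)"
proof -
  let ?w = "weight s (p + 2) x"
  have nz: "?w \<noteq> 0" "weight s p x \<noteq> 0" using assms weight_nonzero by blast+
  have "((\<lambda>t. inverse (weight s (p + 2) t)) has_vector_derivative
     ((of_real (real (p + 2) * x) + s) * weight s p x) * (- (inverse ?w * inverse ?w))) (at x within S)"
  proof -
    have "(inverse has_field_derivative - (inverse ?w * inverse ?w)) (at ?w)"
      using DERIV_inverse'[OF DERIV_ident nz(1)] by simp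
    from field_vector_diff_chain_within[OF weight_derivative[OF assms] has_field_derivative_at_within[OF this]]
    show ?thesis by (simp add: o_def)
  qed
  moreover have "((of_real (real (p + 2) * x) + s) * weight s p x) * (- (inverse ?w * inverse ?w))
      = - ((of_real (real (p + 2) * x) + s) / of_real (x\<^sup>2)) * inverse ?w"
  proof -
    have "weight s p x * inverse ?w = 1 / of_real (x\<^sup>2)"
      using nz assms unfolding weight_add2 by (simp add: field_simps)
    then show ?thesis by (simp add: divide_inverse mult_ac)
  qed
  ultimately show ?thesis by simp
qed

text \<open>Variation of constants from the singular point, with zero constant of integration. The
  point of the argument is continuity at 0.\<close>

lemma first_order_solution:
  assumes s: "Re s > 0" and p: "p \<ge> 1" and g: "continuous_on {0..1} g"
  shows "\<exists>w. continuous_on {0..1} w \<and> (\<forall>x\<in>{0<..1}. (w has_vector_derivative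
     (g x - (of_real (real (p + 2) * x) + s) * w x) / of_real (x\<^sup>2)) (at x within {0..1}))"
proof -
  let ?q = "\<lambda>x::real. complex_of_real (real (p + 2) * x) + s"
  define \<Phi> where "\<Phi> x = integral {0..x} (\<lambda>t. weight s p t * g t)" for x
  \<comment> \<open>\<open>g 0 / s\<close> is the only value at 0 compatible with the equation,
    whose leading term vanishes there.\<close>
  define w where "w x = (if x = 0 then g 0 / s else \<Phi> x * inverse (weight s (p + 2) x))" for x
  have s0: "s \<noteq> 0" using s by auto
  have cw: "continuous_on {0..1} (weight s p)" using weight_continuous s p by simp
  have cI: "continuous_on {0..1} (\<lambda>t. weight s p t * g t)" using cw g by (intro continuous_intros)
  have d\<Phi>: "(\<Phi> has_vector_derivative weight s p x * g x) (at x within {0..1})" if "x \<in> {0..1}" for x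
    unfolding \<Phi>_def using integral_has_vector_derivative[OF cI that] by simp
  have dw: "(w has_vector_derivative (g x - ?q x * w x) / of_real (x\<^sup>2)) (at x within {0..1})" if x: "x \<in> {0<..1}" for x
  proof -
    have x0: "x \<noteq> 0" "x \<in> {0..1}" using x by auto
    have nz: "weight s p x \<noteq> 0" using x0 by (intro weight_nonzero)
    have "((\<lambda>x. \<Phi> x * inverse (weight s (p + 2) x)) has_vector_derivative
       (\<Phi> x * (- (?q x / of_real (x\<^sup>2)) * inverse (weight s (p + 2) x)) + weight s p x * g x * inverse (weight s (p + 2) x))) (at x within {0..1})"
      by (rule has_vector_derivative_mult[OF d\<Phi>[OF x0(2)] inverse_weight_derivative[OF x0(1)]])
    moreover have "\<Phi> x * (- (?q x / of_real (x\<^sup>2)) * inverse (weight s (p + 2) x)) + weight s p x * g x * inverse (weight s (p + 2) x)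
        = (g x - ?q x * w x) / of_real (x\<^sup>2)"
    proof -
      have "weight s p x * inverse (weight s (p + 2) x) = 1 / of_real (x\<^sup>2)"
        using nz x0 unfolding weight_add2 by (simp add: field_simps)
      then have "weight s p x * g x * inverse (weight s (p + 2) x) = g x / of_real (x\<^sup>2)"
        by (metis (no_types, lifting) mult.commute mult.left_commute mult_1 times_divide_eq_right)
      then show ?thesis using x0 by (simp add: w_def diff_divide_distrib)
    qed
    ultimately have "((\<lambda>x. \<Phi> x * inverse (weight s (p + 2) x)) has_vector_derivative (g x - ?q x * w x) / of_real (x\<^sup>2)) (at x within {0..1})"
      by simp
    then show ?thesis
      by (rule has_vector_derivative_transform_within[where d = x]) (use x in \<open>auto simp: w_def dist_real_def\<close>)
  qed
  have "continuous (at x within {0..1}) w" if x: "x \<in> {0..1}" for x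
  proof (cases "x = 0")
    case False
    then show ?thesis using dw[of x] x by (auto intro: has_vector_derivative_continuous)
  next
    case True
    \<comment> \<open>Subtracting the constant function \<open>g 0 / s\<close> changes the
      right-hand side into \<open>e\<close>, which vanishes at 0. The kernel bound then makes
      \<open>w x - w 0\<close> small.\<close>
    define e where "e t = g t - (g 0 / s) * ?q t" for t
    have e0: "e 0 = 0" using s0 by (simp add: e_def)
    have ce: "continuous_on {0..1} e" unfolding e_def using g by (intro continuous_intros)
    have "\<exists>d>0. \<forall>x\<in>{0..1}. dist x 0 < d \<longrightarrow> dist (w x) (w 0) < \<epsilon>" if "\<epsilon> > 0" for \<epsilon>
    proof -
      let ?\<epsilon> = "\<epsilon> / 2 * Re s"
      have "?\<epsilon> > 0" using that s by simp
      then obtain d where d: "d > 0" "\<And>t. t \<in> {0..1} \<Longrightarrow> dist t 0 < d \<Longrightarrow> dist (e t) (e 0) < ?\<epsilon>"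
        using ce unfolding continuous_on_iff by (metis atLeastAtMost_iff order_refl zero_le_one)
      have "dist (w x) (w 0) < \<epsilon>" if x: "x \<in> {0..1}" "dist x 0 < d" for x
      proof (cases "x = 0")
        case True
        then show ?thesis using \<open>\<epsilon> > 0\<close> by simp
      next
        case False
        have x01: "0 \<le> x" "x \<le> 1" using x by auto
        let ?W = "weight s (p + 2) x"
        have nz: "?W \<noteq> 0" using False by (intro weight_nonzero)
        have sub: "{0..x} \<subseteq> {0..1}" using x01 by auto
        have h1: "((\<lambda>t. weight s p t * g t) has_integral \<Phi> x) {0..x}"
          unfolding \<Phi>_def using continuous_on_subset[OF cI sub] by (intro integrable_integral integrable_continuous_interval)
        have h2: "((\<lambda>t. (g 0 / s) * (?q t * weight s p t)) has_integral (g 0 / s) * ?W) {0..x}"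
          using weight_has_integral[of s x p] s x01 by (intro has_integral_mult_right) auto
        have "((\<lambda>t. weight s p t * e t) has_integral \<Phi> x - (g 0 / s) * ?W) {0..x}"
        proof -
          have "weight s p t * e t = weight s p t * g t - (g 0 / s) * (?q t * weight s p t)" for t
            unfolding e_def by (simp only: right_diff_distrib mult_ac)
          then show ?thesis using has_integral_diff[OF h1 h2] by (simp only:)
        qed
        then have eq: "\<Phi> x - (g 0 / s) * ?W = integral {0..x} (\<lambda>t. weight s p t * e t)" by (simp add: integral_unique)
        have cwx: "continuous_on {0..x} (\<lambda>t. cmod (weight s p t))"
          using continuous_on_subset[OF cw sub] by (intro continuous_intros)
        have "cmod (\<Phi> x - (g 0 / s) * ?W) \<le> integral {0..x} (\<lambda>t. ?\<epsilon> * cmod (weight s p t))"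
          unfolding eq
        proof (rule integral_norm_bound_integral)
          show "(\<lambda>t. weight s p t * e t) integrable_on {0..x}"
            using continuous_on_subset[OF cw sub] continuous_on_subset[OF ce sub]
            by (intro integrable_continuous_interval continuous_intros)
          show "(\<lambda>t. ?\<epsilon> * cmod (weight s p t)) integrable_on {0..x}"
            by (intro integrable_continuous_interval continuous_on_mult continuous_on_const cwx)
          fix t assume t: "t \<in> {0..x}"
          then have "t \<in> {0..1}" "dist t 0 < d" using x x01 by (auto simp: dist_real_def)
          then have "cmod (e t) \<le> ?\<epsilon>" using d(2)[of t] e0 by (simp add: dist_norm)
          then show "norm (weight s p t * e t) \<le> ?\<epsilon> * cmod (weight s p t)"
            unfolding norm_mult by (subst mult.commute) (intro mult_right_mono, auto)
        qed
        also have "\<dots> = \<epsilon> / 2 * (Re s * integral {0..x} (\<lambda>t. cmod (weight s p t)))"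
          by (simp add: mult_ac)
        also have "\<dots> \<le> \<epsilon> / 2 * cmod ?W"
          using weight_integral_le[OF s x01 p] \<open>\<epsilon> > 0\<close> by (intro mult_left_mono) auto
        finally have "cmod (\<Phi> x - (g 0 / s) * ?W) \<le> \<epsilon> / 2 * cmod ?W" .
        then have "cmod (\<Phi> x - (g 0 / s) * ?W) * cmod (inverse ?W) \<le> \<epsilon> / 2 * cmod ?W * cmod (inverse ?W)"
          by (intro mult_right_mono) auto
        also have "\<dots> = \<epsilon> / 2" using nz by (simp add: norm_inverse)
        also have "cmod (\<Phi> x - (g 0 / s) * ?W) * cmod (inverse ?W) = cmod (w x - w 0)"
        proof -
          have "(\<Phi> x - (g 0 / s) * ?W) * inverse ?W = \<Phi> x * inverse ?W - (g 0 / s) * (?W * inverse ?W)"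
            by (simp only: left_diff_distrib mult.assoc)
          also have "?W * inverse ?W = 1" using nz by (rule right_inverse)
          also have "\<Phi> x * inverse ?W - (g 0 / s) * 1 = w x - w 0" using False by (simp add: w_def)
          finally show ?thesis by (simp only: norm_mult[symmetric])
        qed
        finally show ?thesis using \<open>\<epsilon> > 0\<close> by (simp add: dist_norm)
      qed
      then show ?thesis using d(1) by blast
    qed
    then show ?thesis using True unfolding continuous_within_eps_delta by blast
  qed
  then have "continuous_on {0..1} w" by (simp add: continuous_on_eq_continuous_within)
  then show ?thesis using dw by blast
qed

text \<open>Multiplied by the integrating factor, \<open>d\<close> becomes a constant. That constant
  equals \<open>weight s p y\<close> times the bounded quantity \<open>y^2 * d y\<close> for every
  \<open>y\<close>, and so tends to 0 with \<open>y\<close>.\<close>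

lemma homogeneous_solution_zero:
  assumes s: "Re s \<ge> 0" and p: "p \<ge> 1"
    and d: "\<And>x. x \<in> {0<..1} \<Longrightarrow> (d has_vector_derivative - ((of_real (real (p + 2) * x) + s) / of_real (x\<^sup>2)) * d x) (at x within {0<..1})"
    and C: "\<And>x. x \<in> {0<..1} \<Longrightarrow> cmod (of_real (x\<^sup>2) * d x) \<le> C"
    and x: "x \<in> {0<..1}"
  shows "d x = 0"
proof -
  define Z where "Z x = weight s (p + 2) x * d x" for x
  have "(Z has_vector_derivative 0) (at x within {0<..1})" if x: "x \<in> {0<..1}" for x
  proof -
    let ?q = "complex_of_real (real (p + 2) * x) + s"
    have "(Z has_vector_derivative weight s (p + 2) x * (- (?q / of_real (x\<^sup>2)) * d x) + ?q * weight s p x * d x) (at x within {0<..1})"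
      unfolding Z_def using x by (intro has_vector_derivative_mult weight_derivative d) auto
    moreover have "weight s (p + 2) x * (- (?q / of_real (x\<^sup>2)) * d x) + ?q * weight s p x * d x = 0"
      unfolding weight_add2 using x by (simp add: field_simps)
    ultimately show ?thesis by simp
  qed
  then have const: "Z y = Z x" if "y \<in> {0<..1}" for y
    using has_vector_derivative_zero_constant[of "{0<..1}" Z] that x by (metis convex_real_interval(6))
  have "cmod (Z x) \<le> C * y" if y: "y \<in> {0<..1}" for y
  proof -
    have "Z x = weight s p y * (of_real (y\<^sup>2) * d y)"
      using const[OF y] unfolding Z_def weight_add2 by (simp only: mult_ac)
    then have "cmod (Z x) = cmod (weight s p y) * cmod (of_real (y\<^sup>2) * d y)"
      by (simp only: norm_mult)
    also have "\<dots> \<le> y * C"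
    proof (rule mult_mono)
      have "y ^ p \<le> y ^ 1" using y p by (intro power_decreasing) auto
      then show "cmod (weight s p y) \<le> y" using cmod_weight_le[of y s p] y s by auto
    qed (use y C in auto)
    finally show ?thesis by (simp add: mult.commute)
  qed
  moreover have "((\<lambda>y. C * y) \<longlongrightarrow> C * 0) (at_right 0)" by (intro tendsto_intros)
  moreover have "eventually (\<lambda>y::real. y \<in> {0<..1}) (at_right 0)"
    using eventually_at_right_real[of 0 1] by (rule eventually_mono) auto
  ultimately have "cmod (Z x) \<le> C * 0"
    by (intro tendsto_lowerbound[where F = "at_right 0"]) (auto elim: eventually_mono)
  then show ?thesis using x weight_nonzero[of x s "p + 2"] by (simp add: Z_def)
qed

text \<open>The derivative of a solution solves the differentiated equation; the difference from \<open>z\<close> is a homogeneous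
  solution, which blows up too fast at \<open>0\<close> unless it vanishes.\<close>

lemma solution_derivative:
  assumes s: "Re s > 0" and p: "p \<ge> 1"
    and w: "continuous_on {0..1} w" and z: "continuous_on {0..1} z"
    and h: "\<And>x. x \<in> {0..1} \<Longrightarrow> (h has_vector_derivative h' x) (at x within {0..1})"
    and dw: "\<And>x. x \<in> {0<..1} \<Longrightarrow> (w has_vector_derivative (h x - (of_real (real (p + 2) * x) + s) * w x) / of_real (x\<^sup>2)) (at x within {0..1})"
    and dz: "\<And>x. x \<in> {0<..1} \<Longrightarrow> (z has_vector_derivative
        (h' x - of_nat (p + 2) * w x - (of_real (real (p + 4) * x) + s) * z x) / of_real (x\<^sup>2)) (at x within {0..1})"
    and x: "x \<in> {0..1}"
  shows "(w has_vector_derivative z x) (at x within {0..1})"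
    and "of_real (x\<^sup>2) * z x + (of_real (real (p + 2) * x) + s) * w x = h x"
proof -
  let ?q = "\<lambda>x::real. complex_of_real (real (p + 2) * x) + s"
  define y where "y x = (h x - ?q x * w x) * of_real (inverse (x\<^sup>2))" for x :: real
  define d where "d x = y x - z x" for x
  have ch: "continuous_on {0..1} h" by (rule has_vector_derivative_continuous_on[OF h])
  have dq: "(?q has_vector_derivative of_nat (p + 2)) (at x within S)" for x S
    by (auto intro!: derivative_eq_intros simp: has_vector_derivative_def scaleR_conv_of_real)
  have dy: "(y has_vector_derivative (h' x - of_nat (p + 2) * w x - (of_real (real (p + 4) * x) + s) * y x) / of_real (x\<^sup>2)) (at x within {0<..1})"
    if x: "x \<in> {0<..1}" for x
  proof -
    have sub: "{0<..1} \<subseteq> {0..1::real}" by auto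
    have x0: "x \<noteq> 0" "x \<in> {0..1}" using x by auto
    let ?w' = "(h x - ?q x * w x) / of_real (x\<^sup>2)"
    have r: "((\<lambda>x. inverse (x\<^sup>2)) has_real_derivative - 2 / x ^ 3) (at x within {0<..1})"
      using x0 by (auto intro!: derivative_eq_intros simp: field_simps power2_eq_square power3_eq_cube)
    have r': "((\<lambda>x. complex_of_real (inverse (x\<^sup>2))) has_vector_derivative of_real (- 2 / x ^ 3)) (at x within {0<..1})"
      by (rule has_vector_derivative_of_real[OF r])
    have "((\<lambda>x. h x - ?q x * w x) has_vector_derivative h' x - (?q x * ?w' + of_nat (p + 2) * w x)) (at x within {0<..1})"
      using dw[OF x] h[OF x0(2)] sub
      by (intro has_vector_derivative_diff has_vector_derivative_mult dq) (auto intro: has_vector_derivative_within_subset)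
    from has_vector_derivative_mult[OF this r']
    have "(y has_vector_derivative ((h x - ?q x * w x) * of_real (- 2 / x ^ 3)
       + (h' x - (?q x * ?w' + of_nat (p + 2) * w x)) * of_real (inverse (x\<^sup>2)))) (at x within {0<..1})"
      unfolding y_def .
    moreover have "(h x - ?q x * w x) * of_real (- 2 / x ^ 3) + (h' x - (?q x * ?w' + of_nat (p + 2) * w x)) * of_real (inverse (x\<^sup>2))
       = (h' x - of_nat (p + 2) * w x - (of_real (real (p + 4) * x) + s) * y x) / of_real (x\<^sup>2)"
    proof -
      define k where "k = h x - ?q x * w x"
      have "complex_of_real (real (p + 4) * x) + s = ?q x + 2 * of_real x" by (simp add: algebra_simps)
      then show ?thesis unfolding y_def k_def[symmetric] using x0
        by (simp only:) (simp add: field_simps power2_eq_square power3_eq_cube)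
    qed
    ultimately show ?thesis by simp
  qed
  have d0: "d x = 0" if x: "x \<in> {0<..1}" for x
  proof -
    have sub: "{0<..1} \<subseteq> {0..1::real}" by auto
    \<comment> \<open>\<open>?k\<close> is \<open>x^2 * d x\<close> and is continuous on the closed
      interval, which supplies the growth bound at 0. The exponent is \<open>p + 2\<close> because
      differentiation adds \<open>2 x\<close> to the first-order coefficient.\<close>
    let ?k = "\<lambda>x. h x - ?q x * w x - of_real (x\<^sup>2) * z x"
    have "continuous_on {0..1} ?k" by (intro continuous_intros ch w z)
    then have "bounded (?k ` {0..1})" by (intro compact_imp_bounded compact_continuous_image) auto
    then obtain C where "\<forall>k\<in>?k ` {0..1}. cmod k \<le> C" unfolding bounded_iff by blast
    then have C: "cmod (?k x) \<le> C" if "x \<in> {0..1}" for x using that by blast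
    show ?thesis
    proof (rule homogeneous_solution_zero[of s "p + 2" d C])
      fix x :: real assume x: "x \<in> {0<..1}"
      have "(d has_vector_derivative (h' x - of_nat (p + 2) * w x - (of_real (real (p + 4) * x) + s) * y x) / of_real (x\<^sup>2)
          - (h' x - of_nat (p + 2) * w x - (of_real (real (p + 4) * x) + s) * z x) / of_real (x\<^sup>2)) (at x within {0<..1})"
        unfolding d_def using dz[OF x] sub
        by (intro has_vector_derivative_diff dy x) (auto intro: has_vector_derivative_within_subset)
      moreover have "(h' x - of_nat (p + 2) * w x - (of_real (real (p + 4) * x) + s) * y x) / of_real (x\<^sup>2)
          - (h' x - of_nat (p + 2) * w x - (of_real (real (p + 4) * x) + s) * z x) / of_real (x\<^sup>2)
          = - ((of_real (real (p + 2 + 2) * x) + s) / of_real (x\<^sup>2)) * d x"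
      proof -
        have "p + 2 + 2 = p + 4" by simp
        then show ?thesis unfolding d_def diff_divide_distrib[symmetric]
          by (simp only:) (simp add: diff_divide_distrib right_diff_distrib)
      qed
      ultimately show "(d has_vector_derivative - ((of_real (real (p + 2 + 2) * x) + s) / of_real (x\<^sup>2)) * d x) (at x within {0<..1})"
        by simp
      have "of_real (x\<^sup>2) * d x = ?k x" using x unfolding d_def y_def by (simp add: field_simps)
      then show "cmod (of_real (x\<^sup>2) * d x) \<le> C" using C[of x] x by simp
    qed (use s p x in auto)
  qed
  have zx: "of_real (x\<^sup>2) * z x + ?q x * w x = h x" if x: "x \<in> {0<..1}" for x
    using d0[OF x] x unfolding d_def y_def by (simp add: field_simps)
  have dwz: "(w has_vector_derivative z x) (at x within {0..1})" if "x \<in> {0<..1}" for x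
    using dw[OF that] d0[OF that] unfolding d_def y_def by (simp add: field_simps)
  \<comment> \<open>Continuity of \<open>z\<close> up to 0 turns \<open>w' = z\<close> on the
    half-open interval into an integral formula, and hence into a one-sided derivative at 0.\<close>
  have wz: "w x = w 0 + integral {0..x} z" if x: "x \<in> {0..1}" for x
  proof -
    have "(z has_integral w x - w 0) {0..x}"
    proof (rule fundamental_theorem_of_calculus_interior)
      show "continuous_on {0..x} w" using w x by (auto intro: continuous_on_subset)
      fix t assume t: "t \<in> {0<..<x}"
      then have "(w has_vector_derivative z t) (at t within {0..1})" using x by (intro dwz) auto
      then show "(w has_vector_derivative z t) (at t)" using t x by (auto simp: at_within_Icc_at)
    qed (use x in auto)
    then show ?thesis by (simp add: integral_unique)
  qed
  have "((\<lambda>x. w 0 + integral {0..x} z) has_vector_derivative z x) (at x within {0..1})"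
    using integral_has_vector_derivative[OF z x] by (auto intro!: derivative_eq_intros)
  then show "(w has_vector_derivative z x) (at x within {0..1})"
    by (rule has_vector_derivative_transform[where g = w and f = "\<lambda>x. w 0 + integral {0..x} z" and S = "{0..1}", OF x wz, rotated])
  show "of_real (x\<^sup>2) * z x + ?q x * w x = h x"
  proof (cases "x = 0")
    case False
    then show ?thesis using zx x by auto
  next
    case True
    let ?k = "\<lambda>x. of_real (x\<^sup>2) * z x + ?q x * w x - h x"
    have cl: "closure {0<..<1::real} = {0..1}" by simp
    have "?k x = 0"
    proof (rule continuous_constant_on_closure[of "{0<..<1}" ?k 0 x])
      show "continuous_on (closure {0<..<1}) ?k" unfolding cl by (intro continuous_intros ch w z)
      show "?k t = 0" if "t \<in> {0<..<1}" for t using zx[of t] that by simp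
      show "x \<in> closure {0<..<1}" unfolding cl by (rule x)
    qed
    then show ?thesis by simp
  qed
qed

text \<open>Smoothness at 0 is not read off the integral formula. Instead \<open>v j\<close> is
  chosen, for each \<open>j\<close>, as a continuous solution of the equation differentiated
  \<open>j\<close> times with \<open>v (j - 1)\<close> inserted, and uniqueness identifies
  \<open>v (Suc j)\<close> with the derivative of \<open>v j\<close>.\<close>

lemma smooth_first_order_solution:
  assumes s: "Re s > 0" and N: "N \<ge> 1"
    and f: "\<And>n x. x \<in> {0..1} \<Longrightarrow> (f n has_vector_derivative f (Suc n) x) (at x within {0..1})"
  shows "\<exists>v. (\<forall>j. \<forall>x\<in>{0..1}. (v j has_vector_derivative v (Suc j) x) (at x within {0..1})) \<and>
     (\<forall>x\<in>{0..1}. of_real (x\<^sup>2) * v (Suc 0) x + (of_real (2 * real (N + 1) * x) + s) * v 0 x = f 0 x)"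
proof -
  define sol where "sol p g w \<longleftrightarrow> continuous_on {0..1} w \<and> (\<forall>x\<in>{0<..1}. (w has_vector_derivative
     (g x - (of_real (real (p + 2) * x) + s) * w x) / of_real (x\<^sup>2)) (at x within {0..1}))" for p and g w :: "real \<Rightarrow> complex"
  define T where "T p g = (SOME w. sol p g w)" for p g
  have T: "sol p g (T p g)" if "p \<ge> 1" "continuous_on {0..1} g" for p g
  proof -
    have "\<exists>w. sol p g w" using first_order_solution[OF s that] unfolding sol_def .
    then show ?thesis unfolding T_def by (rule someI_ex)
  qed
  \<comment> \<open>Each differentiation of the first-order term releases the slope
    \<open>2 * (N + i) + 2\<close>; \<open>\<kappa> j\<close> is the accumulated coefficient of
    \<open>v (j - 1)\<close> in the equation for \<open>v j\<close>.\<close>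
  define \<kappa> :: "nat \<Rightarrow> complex" where "\<kappa> j = of_nat (\<Sum>i<j. 2 * (N + i) + 2)" for j
  define v where "v = rec_nat (T (2 * N) (f 0)) (\<lambda>j w. T (2 * (N + Suc j)) (\<lambda>x. f (Suc j) x - \<kappa> (Suc j) * w x))"
  have v0: "v 0 = T (2 * N) (f 0)" and vS: "v (Suc j) = T (2 * (N + Suc j)) (\<lambda>x. f (Suc j) x - \<kappa> (Suc j) * v j x)" for j
    unfolding v_def by simp_all
  have cf: "continuous_on {0..1} (f n)" for n by (rule has_vector_derivative_continuous_on[OF f])
  define h where "h j x = f j x - (if j = 0 then 0 else \<kappa> j * v (j - 1) x)" for j x
  have sv: "sol (2 * (N + j)) (h j) (v j)" for j
  proof (induction j)
    case 0
    then show ?case using T[of "2 * N" "f 0"] N cf by (simp add: v0 h_def[abs_def])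
  next
    case (Suc j)
    then have "continuous_on {0..1} (v j)" by (simp add: sol_def)
    then have "continuous_on {0..1} (\<lambda>x. f (Suc j) x - \<kappa> (Suc j) * v j x)" by (intro continuous_intros cf)
    from T[OF _ this, of "2 * (N + Suc j)"] show ?case by (simp add: vS h_def[abs_def])
  qed
  define h' where "h' j x = f (Suc j) x - \<kappa> j * v j x" for j x
  have step: "(v j has_vector_derivative v (Suc j) x) (at x within {0..1}) \<and>
      of_real (x\<^sup>2) * v (Suc j) x + (of_real (real (2 * (N + j) + 2) * x) + s) * v j x = h j x"
    if dh: "\<And>x. x \<in> {0..1} \<Longrightarrow> (h j has_vector_derivative h' j x) (at x within {0..1})" and x: "x \<in> {0..1}" for j x
  proof -
    have k: "\<kappa> (Suc j) = \<kappa> j + of_nat (2 * (N + j) + 2)" unfolding \<kappa>_def by simp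
    have "h (Suc j) x = h' j x - of_nat (2 * (N + j) + 2) * v j x" for x
      unfolding h_def h'_def k by (simp add: algebra_simps)
    then have z: "(v (Suc j) has_vector_derivative (h' j x - of_nat (2 * (N + j) + 2) * v j x
        - (of_real (real (2 * (N + j) + 4) * x) + s) * v (Suc j) x) / of_real (x\<^sup>2)) (at x within {0..1})" if "x \<in> {0<..1}" for x
      using sv[of "Suc j"] that unfolding sol_def by (simp add: eval_nat_numeral)
    have c: "continuous_on {0..1} (v j)" "continuous_on {0..1} (v (Suc j))" using sv unfolding sol_def by auto
    have w: "(v j has_vector_derivative (h j x - (of_real (real (2 * (N + j) + 2) * x) + s) * v j x) / of_real (x\<^sup>2)) (at x within {0..1})"
      if "x \<in> {0<..1}" for x using sv[of j] that unfolding sol_def by blast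
    show ?thesis
      using solution_derivative[OF s _ c dh w z x] N by auto
  qed
  \<comment> \<open>The induction interlocks with \<open>step\<close>: the right-hand side at
    \<open>Suc j\<close> contains \<open>v j\<close>, whose derivative is known only after
    \<open>step\<close> at \<open>j\<close>.\<close>
  have dh: "(h j has_vector_derivative h' j x) (at x within {0..1})" if "x \<in> {0..1}" for j x
    using that
  proof (induction j arbitrary: x)
    case 0
    then show ?case using f[of x 0] by (simp add: h_def[abs_def] h'_def \<kappa>_def)
  next
    case (Suc j)
    then have "(v j has_vector_derivative v (Suc j) x) (at x within {0..1})" using step by blast
    then show ?case unfolding h_def[abs_def] h'_def using Suc.prems
      by (auto intro!: has_vector_derivative_diff has_vector_derivative_mult_right f)
  qed
  have "\<forall>j. \<forall>x\<in>{0..1}. (v j has_vector_derivative v (Suc j) x) (at x within {0..1})" using step dh by blast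
  moreover have "of_real (x\<^sup>2) * v (Suc 0) x + (of_real (2 * real (N + 1) * x) + s) * v 0 x = f 0 x" if "x \<in> {0..1}" for x
    using step[OF dh[of _ 0] that] by (simp add: h_def algebra_simps)
  ultimately show ?thesis by blast
qed

section \<open>Estimates for the high derivatives\<close>

lemma taylor_sum_derivative:
  "((\<lambda>x. \<Sum>i<m. of_real ((x - 1) ^ i / fact i) * c i) has_vector_derivative
     (\<Sum>i<m - 1. of_real ((x - 1) ^ i / fact i) * (c (Suc i) :: complex))) (at x within S)"
proof (cases m)
  case (Suc k)
  have "((\<lambda>x. (x - 1) ^ Suc i / fact (Suc i)) has_real_derivative (x - 1) ^ i / fact i) (at x within S)" for i and x :: real
    by (rule derivative_eq_intros refl | simp)+
  then have "((\<lambda>x. of_real ((x - 1) ^ Suc i / fact (Suc i)) * c (Suc i)) has_vector_derivative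
      of_real ((x - 1) ^ i / fact i) * c (Suc i)) (at x within S)" for i
    by (intro has_vector_derivative_mult_left has_vector_derivative_of_real)
  then have "((\<lambda>x. c 0 + (\<Sum>i<k. of_real ((x - 1) ^ Suc i / fact (Suc i)) * c (Suc i))) has_vector_derivative
      0 + (\<Sum>i<k. of_real ((x - 1) ^ i / fact i) * c (Suc i))) (at x within S)"
    by (intro has_vector_derivative_add has_vector_derivative_const has_vector_derivative_sum)
  then show ?thesis unfolding Suc sum.lessThan_Suc_shift by simp
qed simp

text \<open>The \<open>n\<close>-th derivative of the operator, in terms of the derivatives
  \<open>D\<close> of the argument. The finite-rank part is a Taylor polynomial of \<open>u'\<close>
  at 1, so each differentiation shifts its coefficients and drops one term; truncated subtraction
  makes it empty for \<open>n \<ge> N\<close>.\<close>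

definition Lop_deriv :: "nat \<Rightarrow> real \<Rightarrow> complex \<Rightarrow> (nat \<Rightarrow> real \<Rightarrow> complex) \<Rightarrow> nat \<Rightarrow> real \<Rightarrow> complex" where
  "Lop_deriv N lam s D n x = of_real (x\<^sup>2) * D (n + 2) x + (of_real (2 * real (n + 1) * x) + s) * D (n + 1) x
     + (of_nat (n * (n + 1)) - of_nat (N * (N + 1))) * D n x
     + of_real lam * (\<Sum>i<N - n. of_real ((x - 1) ^ i / fact i) * D (Suc (n + i)) 1)"

lemma Lop_deriv_derivative:
  assumes D: "\<And>n. (D n has_vector_derivative D (Suc n) x) (at x within S)"
  shows "(Lop_deriv N lam s D n has_vector_derivative Lop_deriv N lam s D (Suc n) x) (at x within S)"
proof -
  let ?q = "\<lambda>x::real. complex_of_real (2 * real (n + 1) * x) + s"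
  let ?k = "complex_of_nat (n * (n + 1)) - of_nat (N * (N + 1))"
  have d2: "((\<lambda>x. complex_of_real (x\<^sup>2)) has_vector_derivative of_real (2 * x)) (at x within S)"
    by (intro has_vector_derivative_of_real) (auto intro!: derivative_eq_intros)
  have dq: "(?q has_vector_derivative of_real (2 * real (n + 1)) + 0) (at x within S)"
    by (intro has_vector_derivative_add has_vector_derivative_const has_vector_derivative_of_real)
      (auto intro!: derivative_eq_intros)
  have T: "((\<lambda>x. \<Sum>i<N - n. of_real ((x - 1) ^ i / fact i) * D (Suc (n + i)) 1) has_vector_derivative
     (\<Sum>i<N - Suc n. of_real ((x - 1) ^ i / fact i) * D (Suc (Suc n + i)) 1)) (at x within S)"
    using taylor_sum_derivative[where m = "N - n" and c = "\<lambda>i. D (Suc (n + i)) 1"] by simp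
  have main: "((\<lambda>x. of_real (x\<^sup>2) * D (n + 2) x + ?q x * D (n + 1) x + ?k * D n x
     + of_real lam * (\<Sum>i<N - n. of_real ((x - 1) ^ i / fact i) * D (Suc (n + i)) 1)) has_vector_derivative
     (of_real (x\<^sup>2) * D (Suc (n + 2)) x + of_real (2 * x) * D (n + 2) x)
     + (?q x * D (Suc (n + 1)) x + (of_real (2 * real (n + 1)) + 0) * D (n + 1) x) + ?k * D (Suc n) x
     + of_real lam * (\<Sum>i<N - Suc n. of_real ((x - 1) ^ i / fact i) * D (Suc (Suc n + i)) 1)) (at x within S)"
    by (intro has_vector_derivative_add has_vector_derivative_mult has_vector_derivative_mult_right d2 dq T D)
  have e: "(of_real (x\<^sup>2) * D (Suc (n + 2)) x + of_real (2 * x) * D (n + 2) x)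
     + (?q x * D (Suc (n + 1)) x + (of_real (2 * real (n + 1)) + 0) * D (n + 1) x) + ?k * D (Suc n) x
     + of_real lam * (\<Sum>i<N - Suc n. of_real ((x - 1) ^ i / fact i) * D (Suc (Suc n + i)) 1) = Lop_deriv N lam s D (Suc n) x"
    unfolding Lop_deriv_def by (simp add: algebra_simps)
  have l: "(\<lambda>x. of_real (x\<^sup>2) * D (n + 2) x + ?q x * D (n + 1) x + ?k * D n x
     + of_real lam * (\<Sum>i<N - n. of_real ((x - 1) ^ i / fact i) * D (Suc (n + i)) 1)) = Lop_deriv N lam s D n"
    by (intro ext) (simp only: Lop_deriv_def)
  show ?thesis using main unfolding e l .
qed

lemma Lop_eq_Lop_deriv:
  assumes "smooth_derivs u D" "x \<in> {0..1}"
  shows "Lop N lam s u x = Lop_deriv N lam s D 0 x"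
proof -
  have "nderiv u n y = D n y" if "y \<in> {0..1}" for n y by (rule nderiv_eq[OF assms(1) that])
  moreover have "D 0 x = u x" using assms by (simp add: smooth_derivs_def)
  ultimately show ?thesis using assms(2)
    unfolding Lop_def Lop_deriv_def by (simp add: numeral_2_eq_2 distrib_right left_diff_distrib)
qed

lemma smooth_derivs_Lop:
  assumes "smooth01 u"
  shows "smooth_derivs (Lop N lam s u) (Lop_deriv N lam s (nderiv u))"
  unfolding smooth_derivs_def
  using Lop_eq_Lop_deriv[OF smooth_derivs_nderiv[OF assms]] nderiv_has_derivative[OF assms]
  by (auto intro!: Lop_deriv_derivative)

text \<open>The equation is imposed on the open interval only, but both endpoints matter: 0 for the
  recursion of the boundary values, 1 for the tridiagonal system. Continuity extends it.\<close>

lemma Lop_eq_closed: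
  assumes u: "smooth01 u" and f: "smooth01 f" and eq: "\<forall>x\<in>{0<..<1}. Lop N lam s u x = f x" and x: "x \<in> {0..1}"
  shows "Lop N lam s u x = f x"
proof -
  have cl: "closure {0<..<1::real} = {0..1}" by simp
  have "Lop_deriv N lam s (nderiv u) 0 x - nderiv f 0 x = 0"
  proof (rule continuous_constant_on_closure[of "{0<..<1}" "\<lambda>x. Lop_deriv N lam s (nderiv u) 0 x - nderiv f 0 x" 0 x])
    have "(Lop_deriv N lam s (nderiv u) 0 has_vector_derivative Lop_deriv N lam s (nderiv u) (Suc 0) t) (at t within {0..1})"
      if "t \<in> {0..1}" for t by (intro Lop_deriv_derivative nderiv_has_derivative u that)
    then have "continuous_on {0..1} (Lop_deriv N lam s (nderiv u) 0)" by (rule has_vector_derivative_continuous_on)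
    then show "continuous_on (closure {0<..<1}) (\<lambda>x. Lop_deriv N lam s (nderiv u) 0 x - nderiv f 0 x)"
      unfolding cl by (intro continuous_intros nderiv_continuous f)
    show "Lop_deriv N lam s (nderiv u) 0 t - nderiv f 0 t = 0" if "t \<in> {0<..<1}" for t
    proof -
      have t: "t \<in> {0..1}" using that by auto
      have "Lop N lam s u t = f t" using eq that by blast
      then show ?thesis using nderiv_0[OF f t] Lop_eq_Lop_deriv[OF smooth_derivs_nderiv[OF u] t, of N lam s] by (simp only: diff_self)
    qed
    show "x \<in> closure {0<..<1}" unfolding cl by (rule x)
  qed
  then show ?thesis using nderiv_0[OF f x] Lop_eq_Lop_deriv[OF smooth_derivs_nderiv[OF u] x] by simp
qed

lemma Lop_deriv_eq_nderiv:
  assumes u: "smooth01 u" and f: "smooth01 f" and eq: "\<forall>x\<in>{0<..<1}. Lop N lam s u x = f x" and x: "x \<in> {0..1}"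
  shows "Lop_deriv N lam s (nderiv u) n x = nderiv f n x"
  by (rule smooth_derivs_unique[OF smooth_derivs_Lop[OF u] smooth_derivs_nderiv[OF f] Lop_eq_closed[OF u f eq] x])

lemma Lop_linear:
  assumes f: "smooth01 f" and g: "smooth01 g" and x: "x \<in> {0..1}"
  shows "Lop N lam s (\<lambda>y. a * f y + g y) x = a * Lop N lam s f x + Lop N lam s g x"
proof -
  have n: "nderiv (\<lambda>y. a * f y + g y) n t = a * nderiv f n t + nderiv g n t" if "t \<in> {0..1}" for n t
    by (rule nderiv_linear[OF f g that])
  have S: "(\<Sum>i<N. of_real ((x - 1) ^ i / fact i) * nderiv (\<lambda>y. a * f y + g y) (Suc i) 1)
     = a * (\<Sum>i<N. of_real ((x - 1) ^ i / fact i) * nderiv f (Suc i) 1) + (\<Sum>i<N. of_real ((x - 1) ^ i / fact i) * nderiv g (Suc i) 1)"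
    unfolding sum_distrib_left sum.distrib[symmetric] 
  proof (intro sum.cong refl)
    fix i
    have "nderiv (\<lambda>y. a * f y + g y) (Suc i) 1 = a * nderiv f (Suc i) 1 + nderiv g (Suc i) 1" by (rule n) simp
    then show "of_real ((x - 1) ^ i / fact i) * nderiv (\<lambda>y. a * f y + g y) (Suc i) 1
      = a * (of_real ((x - 1) ^ i / fact i) * nderiv f (Suc i) 1) + of_real ((x - 1) ^ i / fact i) * nderiv g (Suc i) 1"
      by (simp only: distrib_left mult_ac)
  qed
  show ?thesis unfolding Lop_def S n[OF x] by (simp add: algebra_simps)
qed

lemma Lop_change_s: "Lop N lam s u x = Lop N lam s' u x + (s - s') * nderiv u 1 x"
  unfolding Lop_def by (simp add: algebra_simps)

definition Vn :: "real \<Rightarrow> (real \<Rightarrow> complex) \<Rightarrow> nat \<Rightarrow> real \<Rightarrow> complex" where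
  "Vn \<sigma> u n x = of_real (gw \<sigma> n) * nderiv u (n + 1) x"

definition Fn :: "real \<Rightarrow> (real \<Rightarrow> complex) \<Rightarrow> nat \<Rightarrow> real \<Rightarrow> complex" where
  "Fn \<sigma> f n x = of_real (gw \<sigma> n) * nderiv f n x"

context
  fixes \<sigma> :: real
  assumes sg: "\<sigma> > 0"
begin

lemma hierarchy_of_Lop:
  assumes N: "N \<ge> 1" and u: "smooth01 u" and f: "smooth01 f" and LE: "\<forall>x\<in>{0<..<1}. Lop N lam s u x = f x"
  shows "hierarchy \<sigma> N s (Vn \<sigma> u) (Fn \<sigma> f)"
proof
  show "\<sigma> > 0" "N \<ge> 1" by (fact sg, fact N)
  show "(Vn \<sigma> u n has_vector_derivative of_real (real (n + 1) * real (n + 2) / \<sigma>) * Vn \<sigma> u (Suc n) x) (at x within {0..1})"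
    if x: "x \<in> {0..1}" for n x
  proof -
    have "(Vn \<sigma> u n has_vector_derivative of_real (gw \<sigma> n) * nderiv u (Suc (n + 1)) x) (at x within {0..1})"
      unfolding Vn_def[abs_def] by (intro has_vector_derivative_mult_right nderiv_has_derivative u x)
    moreover have "of_real (gw \<sigma> n) * nderiv u (Suc (n + 1)) x = of_real (real (n + 1) * real (n + 2) / \<sigma>) * Vn \<sigma> u (Suc n) x"
      unfolding Vn_def gw_Suc[OF sg, of n] of_real_mult by (simp only: mult_ac Suc_eq_plus1)
    ultimately show ?thesis by simp
  qed
  fix n x assume n: "n \<ge> N" and x: "x \<in> {0..1::real}"
  have n1: "n \<ge> 1" using n N by simp
  have V1: "of_real (x\<^sup>2 * (real (n + 1) * real (n + 2) / \<sigma>)) * Vn \<sigma> u (Suc n) x = of_real (gw \<sigma> n) * (of_real (x\<^sup>2) * nderiv u (n + 2) x)"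
    unfolding Vn_def gw_Suc[OF sg, of n] of_real_mult by (simp add: mult_ac)
  have g: "gw \<sigma> (n - 1) * (\<sigma> * (1 - real N * real (N + 1) / (real n * real (n + 1)))) = gw \<sigma> n * (real (n * (n + 1)) - real (N * (N + 1)))"
  proof -
    have "gw \<sigma> (n - 1) = gw \<sigma> n * (real n * real (n + 1) / \<sigma>)" using gw_Suc[OF sg, of "n - 1"] n1 by simp
    moreover have gen: "(r / \<sigma>) * (\<sigma> * (1 - P / r)) = r - P" if "r \<noteq> 0" for r P :: real
      using sg that by (simp add: field_simps)
    have nz: "real n * real (n + 1) \<noteq> 0" using n1 by simp
    ultimately show ?thesis
      unfolding of_nat_mult using gen[OF nz, of "real N * real (N + 1)"] by (metis mult.assoc)
  qed
  have V2: "of_real (\<sigma> * (1 - real N * real (N + 1) / (real n * real (n + 1)))) * Vn \<sigma> u (n - 1) x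
      = of_real (gw \<sigma> n) * ((of_nat (n * (n + 1)) - of_nat (N * (N + 1))) * nderiv u n x)"
  proof -
    have "of_real (\<sigma> * (1 - real N * real (N + 1) / (real n * real (n + 1)))) * Vn \<sigma> u (n - 1) x
       = of_real (gw \<sigma> (n - 1) * (\<sigma> * (1 - real N * real (N + 1) / (real n * real (n + 1))))) * nderiv u n x"
      unfolding Vn_def using n1 by (simp del: of_real_diff of_real_divide of_nat_add)
    also have "\<dots> = of_real (gw \<sigma> n) * ((of_nat (n * (n + 1)) - of_nat (N * (N + 1))) * nderiv u n x)"
      unfolding g of_real_mult of_real_diff of_real_of_nat_eq by (simp only: mult.assoc)
    finally show ?thesis .
  qed
  have "N - n = 0" using n by simp
  then have L: "nderiv f n x = of_real (x\<^sup>2) * nderiv u (n + 2) x + (of_real (2 * real (n + 1) * x) + s) * nderiv u (n + 1) x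
      + (of_nat (n * (n + 1)) - of_nat (N * (N + 1))) * nderiv u n x"
    unfolding Lop_deriv_eq_nderiv[OF u f LE x, symmetric] Lop_deriv_def by simp
  show "of_real (x\<^sup>2 * (real (n + 1) * real (n + 2) / \<sigma>)) * Vn \<sigma> u (Suc n) x + (of_real (2 * real (n + 1) * x) + s) * Vn \<sigma> u n x
       + of_real (\<sigma> * (1 - real N * real (N + 1) / (real n * real (n + 1)))) * Vn \<sigma> u (n - 1) x = Fn \<sigma> f n x"
    unfolding V1 V2 unfolding Fn_def Vn_def L distrib_left[of "of_real (gw \<sigma> n)"]
    by (simp only: mult.left_commute[of "of_real (gw \<sigma> n)"])
qed

section \<open>Comparison of the energies with the terms of the norms\<close>

lemma cterm_Vn: "cterm \<sigma> k 0 1 u n = integral {0..1} (\<lambda>x. (real n * x / \<sigma>) ^ k * (cmod (Vn \<sigma> u n x))\<^sup>2)"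
  unfolding cterm_alt integral_mult_right[symmetric]
  by (rule integral_cong) (simp add: Vn_def norm_mult power_mult_distrib gw_pos[OF sg] less_imp_le power_divide)

lemma bterm_Vn: "bterm \<sigma> 1 u n = \<sigma> * (cmod (Vn \<sigma> u n 0))\<^sup>2"
  unfolding bterm_alt by (simp add: Vn_def norm_mult power_mult_distrib gw_pos[OF sg] less_imp_le)

lemma Vn_continuous: "smooth01 u \<Longrightarrow> continuous_on {0..1} (Vn \<sigma> u n)"
  unfolding Vn_def[abs_def] by (intro continuous_intros nderiv_continuous)

lemma Xterm_le_energy:
  assumes u: "smooth01 u"
  shows "Xterm \<sigma> u n \<le> (1 + 1 / \<sigma> + 1 / \<sigma>\<^sup>2 + \<sigma>) *
    (integral {0..1} (\<lambda>x. (1 + (real (n + 1) * x)\<^sup>2) * (cmod (Vn \<sigma> u n x))\<^sup>2) + (cmod (Vn \<sigma> u n 0))\<^sup>2)"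
proof -
  let ?q = "\<lambda>x. 1 + (real (n + 1) * x)\<^sup>2"
  define E where "E = integral {0..1} (\<lambda>x. ?q x * (cmod (Vn \<sigma> u n x))\<^sup>2)"
  define B where "B = (cmod (Vn \<sigma> u n 0))\<^sup>2"
  have E0: "E \<ge> 0" unfolding E_def by (intro integral_nonneg integrable_continuous_interval continuous_intros Vn_continuous u) auto
  have B0: "B \<ge> 0" by (simp add: B_def)
  have c: "cterm \<sigma> k 0 1 u n \<le> c * E" if c: "\<And>x. x \<in> {0..1} \<Longrightarrow> (real n * x / \<sigma>) ^ k \<le> c * ?q x" for k c
  proof -
    have "cterm \<sigma> k 0 1 u n \<le> integral {0..1} (\<lambda>x. c * (?q x * (cmod (Vn \<sigma> u n x))\<^sup>2))"
      unfolding cterm_Vn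
    proof (rule integral_le)
      show "(\<lambda>x. (real n * x / \<sigma>) ^ k * (cmod (Vn \<sigma> u n x))\<^sup>2) integrable_on {0..1}"
        "(\<lambda>x. c * (?q x * (cmod (Vn \<sigma> u n x))\<^sup>2)) integrable_on {0..1}"
        using sg by (auto intro!: integrable_continuous_interval continuous_intros Vn_continuous u)
      fix x :: real assume "x \<in> {0..1}"
      from mult_right_mono[OF c[OF this], of "(cmod (Vn \<sigma> u n x))\<^sup>2"]
      show "(real n * x / \<sigma>) ^ k * (cmod (Vn \<sigma> u n x))\<^sup>2 \<le> c * (?q x * (cmod (Vn \<sigma> u n x))\<^sup>2)" by (simp add: mult.assoc)
    qed
    then show ?thesis by (simp add: E_def)
  qed
  have nx: "real n * x \<le> ?q x" "(real n * x)\<^sup>2 \<le> ?q x" if x: "x \<in> {0..1}" for x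
  proof -
    have 1: "0 \<le> real n * x" "real n * x \<le> real (n + 1) * x" using x by (auto intro: mult_right_mono)
    have "2 * (real (n + 1) * x) \<le> ?q x" using sum_squares_bound[of 1 "real (n + 1) * x"] by simp
    moreover have "real (n + 1) * x \<le> 2 * (real (n + 1) * x)" using x by simp
    ultimately show "real n * x \<le> ?q x" using 1 by linarith
    have "(real n * x)\<^sup>2 \<le> (real (n + 1) * x)\<^sup>2" using 1 by (intro power_mono)
    then show "(real n * x)\<^sup>2 \<le> ?q x" by simp
  qed
  have c0: "cterm \<sigma> 0 0 1 u n \<le> 1 * E" by (rule c) simp
  have c1: "cterm \<sigma> 1 0 1 u n \<le> (1 / \<sigma>) * E"
    by (rule c) (use nx(1) sg in \<open>simp add: divide_right_mono\<close>)
  have c2: "cterm \<sigma> 2 0 1 u n \<le> (1 / \<sigma>\<^sup>2) * E"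
    by (rule c) (use nx(2) sg in \<open>simp add: divide_right_mono power_divide\<close>)
  have "0 \<le> 1 + 1 / \<sigma> + 1 / \<sigma>\<^sup>2" using sg by (intro add_nonneg_nonneg) auto
  then have k2: "\<sigma> \<le> 1 + 1 / \<sigma> + 1 / \<sigma>\<^sup>2 + \<sigma>" by linarith
  have k1: "1 + 1 / \<sigma> + 1 / \<sigma>\<^sup>2 \<le> 1 + 1 / \<sigma> + 1 / \<sigma>\<^sup>2 + \<sigma>" using sg by linarith
  have b: "bterm \<sigma> 1 u n = \<sigma> * B" unfolding bterm_Vn B_def ..
  have "Xterm \<sigma> u n \<le> (1 + 1 / \<sigma> + 1 / \<sigma>\<^sup>2) * E + \<sigma> * B"
    unfolding Xterm_def b distrib_right using c0 c1 c2 by linarith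
  also have "\<dots> \<le> (1 + 1 / \<sigma> + 1 / \<sigma>\<^sup>2 + \<sigma>) * E + (1 + 1 / \<sigma> + 1 / \<sigma>\<^sup>2 + \<sigma>) * B"
    by (rule add_mono[OF mult_right_mono[OF k1 E0] mult_right_mono[OF k2 B0]])
  finally show ?thesis unfolding E_def B_def by (simp only: distrib_left)
qed

text \<open>This direction is for the tail: it shows that the energies of a function in X tend to 0.
  The norm carries \<open>n\<close> where the energy carries \<open>n + 1\<close>, whence
  \<open>n \<ge> 1\<close> and the factor 4.\<close>

lemma energy_le_Xterm:
  assumes u: "smooth01 u" and n: "n \<ge> 1"
  shows "integral {0..1} (\<lambda>x. (1 + (real (n + 1) * x)\<^sup>2) * (cmod (Vn \<sigma> u n x))\<^sup>2) \<le> (1 + 4 * \<sigma>\<^sup>2) * Xterm \<sigma> u n"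
proof -
  have "integral {0..1} (\<lambda>x. (1 + (real (n + 1) * x)\<^sup>2) * (cmod (Vn \<sigma> u n x))\<^sup>2)
     \<le> cterm \<sigma> 0 0 1 u n + 4 * \<sigma>\<^sup>2 * cterm \<sigma> 2 0 1 u n"
  proof (rule has_integral_le)
    show "((\<lambda>x. (1 + (real (n + 1) * x)\<^sup>2) * (cmod (Vn \<sigma> u n x))\<^sup>2) has_integral
       integral {0..1} (\<lambda>x. (1 + (real (n + 1) * x)\<^sup>2) * (cmod (Vn \<sigma> u n x))\<^sup>2)) {0..1}"
      by (intro integrable_integral integrable_continuous_interval continuous_intros Vn_continuous u)
    show "((\<lambda>x. (real n * x / \<sigma>) ^ 0 * (cmod (Vn \<sigma> u n x))\<^sup>2 + 4 * \<sigma>\<^sup>2 * ((real n * x / \<sigma>) ^ 2 * (cmod (Vn \<sigma> u n x))\<^sup>2)) has_integral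
       cterm \<sigma> 0 0 1 u n + 4 * \<sigma>\<^sup>2 * cterm \<sigma> 2 0 1 u n) {0..1}"
      unfolding cterm_Vn using sg
      by (intro has_integral_add has_integral_mult_right integrable_integral integrable_continuous_interval continuous_intros Vn_continuous u) auto
    fix x :: real assume x: "x \<in> {0..1}"
    have "real (n + 1) * x \<le> 2 * (real n * x)" using n x mult_right_mono[of "real (n + 1)" "2 * real n" x] by simp
    then have "(real (n + 1) * x)\<^sup>2 \<le> (2 * (real n * x))\<^sup>2" using x by (intro power_mono) auto
    also have "\<dots> = 4 * \<sigma>\<^sup>2 * (real n * x / \<sigma>) ^ 2" using sg by (simp add: power_mult_distrib power_divide)
    finally have "(1 + (real (n + 1) * x)\<^sup>2) * (cmod (Vn \<sigma> u n x))\<^sup>2 \<le> (1 + 4 * \<sigma>\<^sup>2 * (real n * x / \<sigma>) ^ 2) * (cmod (Vn \<sigma> u n x))\<^sup>2"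
      by (intro mult_right_mono) auto
    then show "(1 + (real (n + 1) * x)\<^sup>2) * (cmod (Vn \<sigma> u n x))\<^sup>2
      \<le> (real n * x / \<sigma>) ^ 0 * (cmod (Vn \<sigma> u n x))\<^sup>2 + 4 * \<sigma>\<^sup>2 * ((real n * x / \<sigma>) ^ 2 * (cmod (Vn \<sigma> u n x))\<^sup>2)"
      by (simp only: distrib_right mult.assoc power_0)
  qed
  also have "\<dots> \<le> 1 * Xterm \<sigma> u n + 4 * \<sigma>\<^sup>2 * Xterm \<sigma> u n"
    unfolding Xterm_def
    using cterm_nonneg[OF sg u, of 0 1 n] cterm_nonneg[OF sg u, of 1 1 n] cterm_nonneg[OF sg u, of 2 1 n] bterm_nonneg[OF sg, of 1 u n]
    by (intro add_mono mult_left_mono) auto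
  finally show ?thesis by (simp only: distrib_right)
qed

lemma source_le_Yterm:
  assumes f: "smooth01 f"
  shows "integral {0..1} (\<lambda>x. (cmod (Fn \<sigma> f n x))\<^sup>2) \<le> Yterm \<sigma> f n" "(cmod (Fn \<sigma> f n 0))\<^sup>2 \<le> Yterm \<sigma> f n / \<sigma>"
proof -
  note nn = cterm_nonneg[OF sg f, of 0 0 n] cterm_nonneg[OF sg f, of 1 0 n] bterm_nonneg[OF sg, of 0 f n]
  have "integral {0..1} (\<lambda>x. (cmod (Fn \<sigma> f n x))\<^sup>2) = cterm \<sigma> 0 0 0 f n"
    unfolding cterm_alt integral_mult_right[symmetric]
    by (rule integral_cong) (simp add: Fn_def norm_mult power_mult_distrib gw_pos[OF sg] less_imp_le)
  then show "integral {0..1} (\<lambda>x. (cmod (Fn \<sigma> f n x))\<^sup>2) \<le> Yterm \<sigma> f n" unfolding Yterm_def using nn by linarith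
  have "\<sigma> * (cmod (Fn \<sigma> f n 0))\<^sup>2 = bterm \<sigma> 0 f n"
    unfolding bterm_alt by (simp add: Fn_def norm_mult power_mult_distrib gw_pos[OF sg] less_imp_le)
  then have "\<sigma> * (cmod (Fn \<sigma> f n 0))\<^sup>2 \<le> Yterm \<sigma> f n" unfolding Yterm_def using nn by linarith
  then show "(cmod (Fn \<sigma> f n 0))\<^sup>2 \<le> Yterm \<sigma> f n / \<sigma>" using sg by (simp add: pos_le_divide_eq mult.commute)
qed

lemma sum_Yterm_le:
  assumes "f \<in> Ysp \<sigma>" "finite I"
  shows "(\<Sum>n\<in>I. Yterm \<sigma> f n) \<le> (Ynorm \<sigma> f)\<^sup>2"
  unfolding Ynorm_square[OF sg assms(1)]
  using assms by (intro sum_le_suminf) (auto simp: Ysp_iff[OF sg] Yterm_nonneg[OF sg])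

lemma boundary_estimate:
  assumes N: "N \<ge> 1" and u: "smooth01 u" and f: "f \<in> Ysp \<sigma>" and LE: "\<forall>x\<in>{0<..<1}. Lop N lam s u x = f x"
    and eta: "\<eta> > 0" "cmod s \<ge> \<sigma> + \<eta>"
  shows "(\<Sum>n=N..N+j. (cmod (Vn \<sigma> u n 0))\<^sup>2) \<le> 1 / (\<sigma> * \<eta>\<^sup>2) * (Ynorm \<sigma> f)\<^sup>2"
proof -
  have fs: "smooth01 f" using f by (simp add: Ysp_iff[OF sg])
  interpret hierarchy \<sigma> N s "Vn \<sigma> u" "Fn \<sigma> f" by (rule hierarchy_of_Lop[OF N u fs LE])
  have "(\<Sum>n=N..N+j. (cmod (Fn \<sigma> f n 0))\<^sup>2) \<le> (\<Sum>n=N..N+j. Yterm \<sigma> f n / \<sigma>)"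
    by (intro sum_mono source_le_Yterm fs)
  also have "\<dots> \<le> (Ynorm \<sigma> f)\<^sup>2 / \<sigma>"
    unfolding sum_divide_distrib[symmetric] using sg by (intro divide_right_mono sum_Yterm_le f) auto
  finally have "(\<Sum>n=N..N+j. (cmod (Fn \<sigma> f n 0))\<^sup>2) / \<eta>\<^sup>2 \<le> (Ynorm \<sigma> f)\<^sup>2 / \<sigma> / \<eta>\<^sup>2"
    by (intro divide_right_mono) auto
  then show ?thesis using boundary_sum[OF eta, of j] by simp
qed

lemma high_estimate_of_energy:
  assumes N: "N \<ge> 1" and u: "smooth01 u" and f: "f \<in> Ysp \<sigma>" and LE: "\<forall>x\<in>{0<..<1}. Lop N lam s u x = f x"
    and eta: "\<eta> > 0" "cmod s \<ge> \<sigma> + \<eta>"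
    and E: "(\<Sum>n=N..N+j. integral {0..1} (\<lambda>x. (1 + (real (n + 1) * x)\<^sup>2) * (cmod (Vn \<sigma> u n x))\<^sup>2)) \<le> C * (Ynorm \<sigma> f)\<^sup>2"
  shows "(\<Sum>n=N..N+j. Xterm \<sigma> u n) \<le> (1 + 1 / \<sigma> + 1 / \<sigma>\<^sup>2 + \<sigma>) * (C + 1 / (\<sigma> * \<eta>\<^sup>2)) * (Ynorm \<sigma> f)\<^sup>2"
proof -
  let ?c = "1 + 1 / \<sigma> + 1 / \<sigma>\<^sup>2 + \<sigma>"
  have c0: "?c \<ge> 0" using sg by (intro add_nonneg_nonneg) auto
  have "(\<Sum>n=N..N+j. Xterm \<sigma> u n) \<le> (\<Sum>n=N..N+j. ?c *
    (integral {0..1} (\<lambda>x. (1 + (real (n + 1) * x)\<^sup>2) * (cmod (Vn \<sigma> u n x))\<^sup>2) + (cmod (Vn \<sigma> u n 0))\<^sup>2))"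
    by (intro sum_mono Xterm_le_energy u)
  also have "\<dots> = ?c * ((\<Sum>n=N..N+j. integral {0..1} (\<lambda>x. (1 + (real (n + 1) * x)\<^sup>2) * (cmod (Vn \<sigma> u n x))\<^sup>2)) + (\<Sum>n=N..N+j. (cmod (Vn \<sigma> u n 0))\<^sup>2))"
    by (simp only: sum_distrib_left[symmetric] sum.distrib)
  also have "\<dots> \<le> ?c * (C * (Ynorm \<sigma> f)\<^sup>2 + 1 / (\<sigma> * \<eta>\<^sup>2) * (Ynorm \<sigma> f)\<^sup>2)"
    by (rule mult_left_mono[OF add_mono[OF E boundary_estimate[OF N u f LE eta]] c0])
  also have "\<dots> = ?c * (C + 1 / (\<sigma> * \<eta>\<^sup>2)) * (Ynorm \<sigma> f)\<^sup>2"
    unfolding distrib_right[of C, symmetric] by (simp only: mult.assoc)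
  finally show ?thesis .
qed

lemma sum_source_le:
  assumes f: "f \<in> Ysp \<sigma>"
  shows "(\<Sum>n=N..N+j. integral {0..1} (\<lambda>x. (cmod (Fn \<sigma> f n x))\<^sup>2)) \<le> (Ynorm \<sigma> f)\<^sup>2"
proof -
  have fs: "smooth01 f" using f by (simp add: Ysp_iff[OF sg])
  have "(\<Sum>n=N..N+j. integral {0..1} (\<lambda>x. (cmod (Fn \<sigma> f n x))\<^sup>2)) \<le> (\<Sum>n=N..N+j. Yterm \<sigma> f n)"
    by (intro sum_mono source_le_Yterm fs)
  also have "\<dots> \<le> (Ynorm \<sigma> f)\<^sup>2" by (intro sum_Yterm_le f) auto
  finally show ?thesis .
qed

text \<open>The sum up to \<open>j\<close> is at most the sum up to any \<open>i \<ge> j\<close>.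
  Letting \<open>i\<close> tend to infinity removes the tail, because the energies of
  \<open>u\<close> tend to 0.\<close>

lemma high_estimate:
  assumes N: "N \<ge> 1" and u: "u \<in> Xsp \<sigma>" and f: "f \<in> Ysp \<sigma>" and LE: "\<forall>x\<in>{0<..<1}. Lop N lam s u x = f x"
    and eta: "\<eta> > 0" "cmod s \<ge> \<sigma> + \<eta>"
    and a: "\<bar>Re s\<bar> \<le> A" "A \<le> 2 * real N"
    and d: "\<delta> > 0" and M: "M \<ge> 0" and co: "coercive_at \<sigma> M \<delta> s"
    and K: "2 * M * (2 * (3 + A) + 2 * \<sigma>\<^sup>2 + \<sigma>\<^sup>2 * A) + 1 / \<sigma> \<le> \<delta> / 4 * real N"
  shows "(\<Sum>n=N..N+j. Xterm \<sigma> u n) \<le>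
    (1 + 1 / \<sigma> + 1 / \<sigma>\<^sup>2 + \<sigma>) * (2 / \<delta> * (M + 1 / \<delta> + \<delta> / (\<sigma> * \<eta>\<^sup>2)) + 1 / (\<sigma> * \<eta>\<^sup>2)) * (Ynorm \<sigma> f)\<^sup>2"
proof -
  have us: "smooth01 u" "summable (Xterm \<sigma> u)" using u by (auto simp: Xsp_iff[OF sg])
  have fs: "smooth01 f" using f by (simp add: Ysp_iff[OF sg])
  interpret hierarchy \<sigma> N s "Vn \<sigma> u" "Fn \<sigma> f" by (rule hierarchy_of_Lop[OF N us(1) fs LE])
  define Z where "Z = (Ynorm \<sigma> f)\<^sup>2"
  define G where "G = (M + 1 / \<delta> + \<delta> / (\<sigma> * \<eta>\<^sup>2)) * Z"
  have dB: "(\<Sum>n=N..N+i. (cmod (Vn \<sigma> u n 0))\<^sup>2) \<le> 1 / (\<sigma> * \<eta>\<^sup>2) * Z" for i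
    unfolding Z_def by (rule boundary_estimate[OF N us(1) f LE eta]) 
  have S: "(\<Sum>n=N..N+i. source n) \<le> Z" for i unfolding source_def Z_def by (rule sum_source_le[OF f])
  have main: "\<delta> / 2 * (\<Sum>n=N..N+i. energy n) \<le> G + (\<sigma> + 1 / \<sigma>) * energy (Suc (N + i))" for i
  proof -
    have pos: "\<delta> * (1 + y\<^sup>2) \<le> M * (2 * y + Re s)\<^sup>2 + \<bar>Im s\<bar> - max (y\<^sup>2) (\<sigma>\<^sup>2 - y\<^sup>2) / \<sigma>" if "y \<ge> 0" for y
      using co that unfolding coercive_at_def by blast
    have "(M + 1 / \<delta>) * (\<Sum>n=N..N+i. source n) \<le> (M + 1 / \<delta>) * Z"
      using M d by (intro mult_left_mono S) auto
    moreover have "\<delta> * (\<Sum>n=N..N+i. (cmod (Vn \<sigma> u n 0))\<^sup>2) \<le> \<delta> * (1 / (\<sigma> * \<eta>\<^sup>2) * Z)"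
      using d by (intro mult_left_mono dB) auto
    moreover have "G = (M + 1 / \<delta>) * Z + \<delta> * (1 / (\<sigma> * \<eta>\<^sup>2) * Z)"
      unfolding G_def by (simp add: distrib_right)
    ultimately show ?thesis using energy_sum[OF a d M pos K, of i] by linarith
  qed
  have "(\<lambda>n. (1 + 4 * \<sigma>\<^sup>2) * Xterm \<sigma> u n) \<longlonglongrightarrow> (1 + 4 * \<sigma>\<^sup>2) * 0"
    by (intro tendsto_intros summable_LIMSEQ_zero us)
  then have l: "(\<lambda>n. (1 + 4 * \<sigma>\<^sup>2) * Xterm \<sigma> u n) \<longlonglongrightarrow> 0" by simp
  have "energy \<longlonglongrightarrow> 0"
  proof (rule tendsto_sandwich[OF _ _ tendsto_const l])
    show "eventually (\<lambda>n. 0 \<le> energy n) sequentially" by (simp add: energy_nonneg)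
    show "eventually (\<lambda>n. energy n \<le> (1 + 4 * \<sigma>\<^sup>2) * Xterm \<sigma> u n) sequentially"
      using eventually_ge_at_top[of 1] unfolding energy_def by (rule eventually_mono) (rule energy_le_Xterm[OF us(1)])
  qed
  then have "(\<lambda>i. energy (i + Suc N)) \<longlonglongrightarrow> 0" by (rule LIMSEQ_ignore_initial_segment)
  then have lim: "(\<lambda>i. G + (\<sigma> + 1 / \<sigma>) * energy (i + Suc N)) \<longlonglongrightarrow> G + (\<sigma> + 1 / \<sigma>) * 0"
    by (intro tendsto_intros)
  have "\<delta> / 2 * (\<Sum>n=N..N+j. energy n) \<le> G + (\<sigma> + 1 / \<sigma>) * 0"
  proof (rule tendsto_lowerbound[OF lim])
    show "eventually (\<lambda>i. \<delta> / 2 * (\<Sum>n=N..N+j. energy n) \<le> G + (\<sigma> + 1 / \<sigma>) * energy (i + Suc N)) sequentially"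
      using eventually_ge_at_top[of j]
    proof eventually_elim
      case (elim i)
      have "\<delta> / 2 * (\<Sum>n=N..N+j. energy n) \<le> \<delta> / 2 * (\<Sum>n=N..N+i. energy n)"
        using d elim energy_nonneg by (intro mult_left_mono sum_mono2) auto
      also note main[of i]
      finally show ?case by (simp add: add.commute)
    qed
  qed simp
  then have "(\<Sum>n=N..N+j. energy n) \<le> 2 / \<delta> * G" using d by (simp add: field_simps)
  then have "(\<Sum>n=N..N+j. energy n) \<le> 2 / \<delta> * (M + 1 / \<delta> + \<delta> / (\<sigma> * \<eta>\<^sup>2)) * (Ynorm \<sigma> f)\<^sup>2"
    unfolding G_def Z_def by (simp only: mult.assoc)
  then show ?thesis
    unfolding energy_def by (rule high_estimate_of_energy[OF N us(1) f LE eta])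
qed

text \<open>Here \<open>u\<close> is only assumed smooth, so the bound on the partial sums can be
  used to prove membership in X.\<close>

lemma high_estimate_right:
  assumes N: "N \<ge> 1" and u: "smooth01 u" and f: "f \<in> Ysp \<sigma>" and LE: "\<forall>x\<in>{0<..<1}. Lop N lam s u x = f x"
    and eta: "\<eta> > 0" "cmod s \<ge> \<sigma> + \<eta>"
    and a: "\<bar>Re s\<bar> \<le> A" "A \<le> 2 * real N" "Re s \<ge> 1"
    and K: "4 * (2 * (3 + A) + 2 * \<sigma>\<^sup>2 + \<sigma>\<^sup>2 * A) \<le> real N"
  shows "(\<Sum>n=N..N+j. Xterm \<sigma> u n) \<le>
    (1 + 1 / \<sigma> + 1 / \<sigma>\<^sup>2 + \<sigma>) * ((2 + 1 / (\<sigma> * \<eta>\<^sup>2)) + 1 / (\<sigma> * \<eta>\<^sup>2)) * (Ynorm \<sigma> f)\<^sup>2"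
proof (rule high_estimate_of_energy[OF N u f LE eta])
  have fs: "smooth01 f" using f by (simp add: Ysp_iff[OF sg])
  interpret hierarchy \<sigma> N s "Vn \<sigma> u" "Fn \<sigma> f" by (rule hierarchy_of_Lop[OF N u fs LE])
  have "(\<Sum>n=N..N+j. energy n) \<le> 2 * (\<Sum>n=N..N+j. source n) + (\<Sum>n=N..N+j. (cmod (Vn \<sigma> u n 0))\<^sup>2)"
    by (rule energy_sum_right_half_plane[OF a K])
  also have "\<dots> \<le> 2 * (Ynorm \<sigma> f)\<^sup>2 + 1 / (\<sigma> * \<eta>\<^sup>2) * (Ynorm \<sigma> f)\<^sup>2"
    unfolding source_def by (intro add_mono mult_left_mono sum_source_le f boundary_estimate[OF N u f LE eta]) auto
  finally show "(\<Sum>n=N..N+j. integral {0..1} (\<lambda>x. (1 + (real (n + 1) * x)\<^sup>2) * (cmod (Vn \<sigma> u n x))\<^sup>2)) \<le> (2 + 1 / (\<sigma> * \<eta>\<^sup>2)) * (Ynorm \<sigma> f)\<^sup>2"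
    unfolding energy_def distrib_right .
qed

end

section \<open>Pointwise bounds and the tridiagonal system\<close>

lemma Xterm_le_sup:
  assumes sg: "\<sigma> > 0" and u: "smooth01 u" and B: "\<And>x. x \<in> {0..1} \<Longrightarrow> cmod (nderiv u (n + 1) x) \<le> B"
  shows "Xterm \<sigma> u n \<le> (gw \<sigma> n)\<^sup>2 * (1 + real n / \<sigma> + (real n / \<sigma>)\<^sup>2 + \<sigma>) * B\<^sup>2"
proof -
  have sq: "(cmod (nderiv u (n + 1) x))\<^sup>2 \<le> B\<^sup>2" if "x \<in> {0..1}" for x
    using B[OF that] by (intro power_mono) auto
  have c: "cterm \<sigma> k 0 1 u n \<le> (gw \<sigma> n)\<^sup>2 * ((real n / \<sigma>) ^ k * B\<^sup>2)" for k
  proof -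
    have "integral {0..1} (\<lambda>x. (x / \<sigma>) ^ k * (cmod (nderiv u (n + 1) x))\<^sup>2) \<le> (1 / \<sigma>) ^ k * B\<^sup>2"
    proof (rule has_integral_le)
      show "((\<lambda>x. (x / \<sigma>) ^ k * (cmod (nderiv u (n + 1) x))\<^sup>2) has_integral integral {0..1} (\<lambda>x. (x / \<sigma>) ^ k * (cmod (nderiv u (n + 1) x))\<^sup>2)) {0..1}"
        by (intro integrable_integral cterm_integrable u)
      show "((\<lambda>x::real. (1 / \<sigma>) ^ k * B\<^sup>2) has_integral (1 / \<sigma>) ^ k * B\<^sup>2) {0..1}"
        using has_integral_const_real[of "(1 / \<sigma>) ^ k * B\<^sup>2" 0 1] by simp
      fix x :: real assume x: "x \<in> {0..1}"
      have "(x / \<sigma>) ^ k \<le> (1 / \<sigma>) ^ k" using x sg by (intro power_mono divide_right_mono) auto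
      then show "(x / \<sigma>) ^ k * (cmod (nderiv u (n + 1) x))\<^sup>2 \<le> (1 / \<sigma>) ^ k * B\<^sup>2"
        using sq[OF x] sg by (intro mult_mono) auto
    qed
    then have "(gw \<sigma> n)\<^sup>2 * real n ^ k * integral {0..1} (\<lambda>x. (x / \<sigma>) ^ k * (cmod (nderiv u (n + 1) x))\<^sup>2)
       \<le> (gw \<sigma> n)\<^sup>2 * real n ^ k * ((1 / \<sigma>) ^ k * B\<^sup>2)" by (intro mult_left_mono) auto
    then show ?thesis unfolding cterm_alt by (simp add: power_divide mult_ac)
  qed
  have b: "bterm \<sigma> 1 u n \<le> (gw \<sigma> n)\<^sup>2 * (\<sigma> * B\<^sup>2)"
  proof -
    have "\<sigma> * (gw \<sigma> n)\<^sup>2 * (cmod (nderiv u (n + 1) 0))\<^sup>2 \<le> \<sigma> * (gw \<sigma> n)\<^sup>2 * B\<^sup>2"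
      using sq[of 0] sg by (intro mult_left_mono) auto
    then show ?thesis unfolding bterm_alt by (simp add: mult_ac)
  qed
  have "Xterm \<sigma> u n \<le> (gw \<sigma> n)\<^sup>2 * ((real n / \<sigma>) ^ 0 * B\<^sup>2) + (gw \<sigma> n)\<^sup>2 * ((real n / \<sigma>) ^ 1 * B\<^sup>2)
      + (gw \<sigma> n)\<^sup>2 * ((real n / \<sigma>) ^ 2 * B\<^sup>2) + (gw \<sigma> n)\<^sup>2 * (\<sigma> * B\<^sup>2)"
    unfolding Xterm_def by (intro add_mono c b)
  also have "\<dots> = (gw \<sigma> n)\<^sup>2 * (1 + real n / \<sigma> + (real n / \<sigma>)\<^sup>2 + \<sigma>) * B\<^sup>2"
    by (simp only: distrib_left distrib_right mult.assoc power_0 power_one_right mult_1)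
  finally show ?thesis .
qed

lemma sup_le_of_terms:
  assumes sg: "\<sigma> > 0" and u: "smooth01 u" and x: "x \<in> {0..1}"
    and c: "cterm \<sigma> 0 0 d u n \<le> B\<^sup>2" "cterm \<sigma> 0 0 d u (Suc n) \<le> B\<^sup>2" and B: "B \<ge> 0"
  shows "cmod (nderiv u (n + d) x) \<le> (2 / gw \<sigma> n + 2 / gw \<sigma> (Suc n)) * B"
proof -
  have g: "gw \<sigma> n > 0" "gw \<sigma> (Suc n) > 0" using gw_pos[OF sg] by auto
  have i: "integral {0..1} (\<lambda>x. (cmod (nderiv u (m + d) x))\<^sup>2) \<le> (B / gw \<sigma> m)\<^sup>2" if "cterm \<sigma> 0 0 d u m \<le> B\<^sup>2" for m
    using that gw_pos[OF sg, of m] unfolding cterm_alt by (simp add: field_simps power_divide)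
  have "(cmod (nderiv u (n + d) x))\<^sup>2 \<le> 2 * integral {0..1} (\<lambda>t. (cmod (nderiv u (n + d) t))\<^sup>2) + 2 * integral {0..1} (\<lambda>t. (cmod (nderiv u (Suc (n + d)) t))\<^sup>2)"
    by (intro sup_bound nderiv_has_derivative nderiv_continuous u x)
  also have "\<dots> \<le> 2 * (B / gw \<sigma> n)\<^sup>2 + 2 * (B / gw \<sigma> (Suc n))\<^sup>2"
    using i[OF c(1)] i[OF c(2)] by simp
  also have "\<dots> \<le> (2 * (B / gw \<sigma> n) + 2 * (B / gw \<sigma> (Suc n)))\<^sup>2"
  proof -
    define p q where "p = B / gw \<sigma> n" and "q = B / gw \<sigma> (Suc n)"
    have "0 \<le> p * q" unfolding p_def q_def using B g by simp
    moreover have "(2 * p + 2 * q)\<^sup>2 = 4 * p\<^sup>2 + 8 * (p * q) + 4 * q\<^sup>2"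
      by (simp add: power2_eq_square algebra_simps)
    ultimately have "2 * p\<^sup>2 + 2 * q\<^sup>2 \<le> (2 * p + 2 * q)\<^sup>2" using zero_le_power2[of p] zero_le_power2[of q] by linarith
    then show ?thesis unfolding p_def q_def .
  qed
  finally have "cmod (nderiv u (n + d) x) \<le> 2 * (B / gw \<sigma> n) + 2 * (B / gw \<sigma> (Suc n))"
    by (rule power2_le_imp_le) (use B g in auto)
  then show ?thesis by (simp add: distrib_right)
qed

context
  fixes \<sigma> :: real
  assumes sg: "\<sigma> > 0"
begin

lemma nderiv_le_Xnorm:
  assumes u: "u \<in> Xsp \<sigma>" and x: "x \<in> {0..1}"
  shows "cmod (nderiv u (n + 1) x) \<le> (2 / gw \<sigma> n + 2 / gw \<sigma> (Suc n)) * Xnorm \<sigma> u"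
proof -
  have us: "smooth01 u" "summable (Xterm \<sigma> u)" using u by (auto simp: Xsp_iff[OF sg])
  have "cterm \<sigma> 0 0 1 u m \<le> (Xnorm \<sigma> u)\<^sup>2" for m
  proof -
    have "cterm \<sigma> 0 0 1 u m \<le> Xterm \<sigma> u m" unfolding Xterm_def
      using cterm_nonneg[OF sg us(1), of 1 1 m] cterm_nonneg[OF sg us(1), of 2 1 m] bterm_nonneg[OF sg, of 1 u m] by linarith
    also have "\<dots> = (\<Sum>i\<in>{m}. Xterm \<sigma> u i)" by simp
    also have "\<dots> \<le> suminf (Xterm \<sigma> u)" using us by (intro sum_le_suminf) (auto simp: Xterm_nonneg[OF sg])
    finally show ?thesis by (simp add: Xnorm_square[OF sg u])
  qed
  then show ?thesis by (intro sup_le_of_terms sg us x Xnorm_nonneg u)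
qed

lemma nderiv_le_Ynorm:
  assumes f: "f \<in> Ysp \<sigma>" and x: "x \<in> {0..1}"
  shows "cmod (nderiv f n x) \<le> (2 / gw \<sigma> n + 2 / gw \<sigma> (Suc n)) * Ynorm \<sigma> f"
proof -
  have fs: "smooth01 f" "summable (Yterm \<sigma> f)" using f by (auto simp: Ysp_iff[OF sg])
  have "cterm \<sigma> 0 0 0 f m \<le> (Ynorm \<sigma> f)\<^sup>2" for m
  proof -
    have "cterm \<sigma> 0 0 0 f m \<le> Yterm \<sigma> f m" unfolding Yterm_def
      using cterm_nonneg[OF sg fs(1), of 1 0 m] bterm_nonneg[OF sg, of 0 f m] by linarith
    also have "\<dots> = (\<Sum>i\<in>{m}. Yterm \<sigma> f i)" by simp
    also have "\<dots> \<le> (Ynorm \<sigma> f)\<^sup>2" by (intro sum_Yterm_le sg f) auto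
    finally show ?thesis .
  qed
  then show ?thesis using sup_le_of_terms[OF sg fs(1) x, of 0 n] Ynorm_nonneg[OF sg f] by simp
qed

lemma Xnorm_zero_imp:
  assumes u: "u \<in> Xsp \<sigma>" and 0: "Xnorm \<sigma> u \<le> 0" and x: "x \<in> {0..1}"
  shows "u x = 0"
proof -
  have us: "smooth01 u" "u 1 = 0" using u by (auto simp: Xsp_iff[OF sg])
  have n0: "Xnorm \<sigma> u = 0" using 0 Xnorm_nonneg[OF sg u] by simp
  have d: "nderiv u (Suc 0) y = 0" if "y \<in> {0..1}" for y using nderiv_le_Xnorm[OF u that, of 0] n0 by simp
  have "(nderiv u 0 has_vector_derivative 0) (at y within {0..1})" if "y \<in> {0..1}" for y
    using nderiv_has_derivative[OF us(1) that, of 0] d[OF that] by simp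
  then obtain c where c: "\<And>y. y \<in> {0..1} \<Longrightarrow> nderiv u 0 y = c"
    using has_vector_derivative_zero_constant[of "{0..1}" "nderiv u 0"] by (metis convex_real_interval(5))
  have "c = 0" using c[of 1] nderiv_0[OF us(1), of 1] us(2) by simp
  then show ?thesis using c[OF x] nderiv_0[OF us(1) x] by simp
qed

end

text \<open>Look at the row in which the largest of the moduli up to \<open>N\<close> is the
  diagonal unknown. The diagonal \<open>k + 2\<close> beats the off-diagonal entries
  \<open>k\<close> and 1 by exactly 1, which leaves \<open>A \<le> R + B\<close>.\<close>

lemma tridiagonal_bound:
  fixes a r d :: "nat \<Rightarrow> complex" and \<kappa> :: "nat \<Rightarrow> complex"
  assumes eq: "\<And>n. n < N \<Longrightarrow> d n * a (Suc n) + a (Suc (Suc n)) + \<kappa> n * a n = r n"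
    and a0: "a 0 = 0" and aN: "cmod (a (Suc N)) \<le> B" and r: "\<And>n. n < N \<Longrightarrow> cmod (r n) \<le> R"
    and d: "\<And>n. n < N \<Longrightarrow> cmod (d n) \<ge> k + 2" and \<kappa>: "\<And>n. n < N \<Longrightarrow> cmod (\<kappa> n) \<le> k"
    and R: "R \<ge> 0" and i: "i \<le> Suc N"
  shows "cmod (a i) \<le> R + B"
proof -
  have B: "B \<ge> 0" using norm_ge_zero aN by (rule order_trans)
  define A where "A = Max ((\<lambda>i. cmod (a i)) ` {..N})"
  have A: "cmod (a i) \<le> A" if "i \<le> N" for i unfolding A_def using that by (intro Max_ge) auto
  have "A \<in> (\<lambda>i. cmod (a i)) ` {..N}" unfolding A_def by (intro Max_in) auto
  then obtain j where j: "j \<le> N" "A = cmod (a j)" by auto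
  have "A \<le> R + B"
  proof (cases j)
    case 0
    then show ?thesis using j a0 R B by simp
  next
    case (Suc n)
    then have n: "n < N" using j by simp
    have A0: "A \<ge> 0" using j by simp
    have "d n * a (Suc n) = r n - a (Suc (Suc n)) - \<kappa> n * a n" using eq[OF n] by (simp add: algebra_simps)
    then have "cmod (d n) * A = cmod (r n - a (Suc (Suc n)) - \<kappa> n * a n)"
      using j Suc by (metis norm_mult)
    then have "cmod (d n) * A \<le> cmod (r n) + cmod (a (Suc (Suc n))) + cmod (\<kappa> n) * cmod (a n)"
      using norm_triangle_ineq4[of "r n - a (Suc (Suc n))" "\<kappa> n * a n"] norm_triangle_ineq4[of "r n" "a (Suc (Suc n))"]
      unfolding norm_mult by linarith
    moreover have "cmod (a (Suc (Suc n))) \<le> A + B"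
    proof (cases "Suc n = N")
      case True
      then show ?thesis using aN A0 by simp
    next
      case False
      then have "Suc (Suc n) \<le> N" using n by simp
      from A[OF this] show ?thesis using B by simp
    qed
    moreover have "cmod (\<kappa> n) * cmod (a n) \<le> k * A"
      using \<kappa>[OF n] A[of n] n order_trans[OF norm_ge_zero \<kappa>[OF n]] by (intro mult_mono) auto
    moreover have "(k + 2) * A \<le> cmod (d n) * A" using d[OF n] A0 by (intro mult_right_mono)
    ultimately have "(k + 2) * A \<le> R + (A + B) + k * A" using r[OF n] by linarith
    then show ?thesis by (simp add: distrib_right)
  qed
  show ?thesis
  proof (cases "i = Suc N")
    case True
    then show ?thesis using aN R by simp
  next
    case False
    then show ?thesis using A[of i] i \<open>A \<le> R + B\<close> by simp
  qed
qed

text \<open>A shooting argument: diagonal dominance makes the homogeneous solution started at 0, 1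
  grow in modulus, so it does not vanish at \<open>Suc N\<close> and a multiple of it corrects the
  end value.\<close>

lemma tridiagonal_solvable:
  fixes r d :: "nat \<Rightarrow> complex" and \<kappa> :: "nat \<Rightarrow> complex"
  assumes d: "\<And>n. n < N \<Longrightarrow> cmod (d n) \<ge> k + 2" and \<kappa>: "\<And>n. n < N \<Longrightarrow> cmod (\<kappa> n) \<le> k"
  shows "\<exists>a. a 0 = 0 \<and> a (Suc N) = b \<and> (\<forall>n<N. d n * a (Suc n) + a (Suc (Suc n)) + \<kappa> n * a n = r n)"
proof -
  \<comment> \<open>The state is a pair of consecutive values, since the recursion has order two;
    \<open>h\<close> starts from 0, 1 without source and \<open>p\<close> from 0, 0 with source
    \<open>r\<close>.\<close>
  define P where "P t \<rho> = rec_nat (0, t) (\<lambda>n p. (snd p, \<rho> n - d n * snd p - \<kappa> n * fst p))" for t :: complex and \<rho> :: "nat \<Rightarrow> complex"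
  define h where "h n = fst (P 1 (\<lambda>n. 0) n)" for n
  define p where "p n = fst (P 0 r n)" for n
  have S: "fst (P t \<rho> (Suc n)) = snd (P t \<rho> n)" "snd (P t \<rho> (Suc n)) = \<rho> n - d n * snd (P t \<rho> n) - \<kappa> n * fst (P t \<rho> n)" for t \<rho> n
    unfolding P_def by simp_all
  have h0: "h 0 = 0" "h (Suc 0) = 1" and p0: "p 0 = 0"
    unfolding h_def p_def S by (simp_all add: P_def)
  have hS: "h (Suc (Suc n)) = - d n * h (Suc n) - \<kappa> n * h n" and pS: "p (Suc (Suc n)) = r n - d n * p (Suc n) - \<kappa> n * p n" for n
    unfolding h_def p_def S by simp_all
  have grow: "cmod (h n) \<le> cmod (h (Suc n)) \<and> 1 \<le> cmod (h (Suc n))" if "n \<le> N" for n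
    using that
  proof (induction n)
    case 0
    then show ?case by (simp add: h0)
  next
    case (Suc n)
    then have n: "n < N" and IH: "cmod (h n) \<le> cmod (h (Suc n))" "1 \<le> cmod (h (Suc n))" by auto
    have k0: "0 \<le> k" using \<kappa>[OF n] norm_ge_zero[of "\<kappa> n"] by linarith
    have "cmod (d n * h (Suc n)) = cmod (- h (Suc (Suc n)) - \<kappa> n * h n)" unfolding hS by (simp add: algebra_simps)
    also have "\<dots> \<le> cmod (h (Suc (Suc n))) + cmod (\<kappa> n * h n)"
      using norm_triangle_ineq4[of "- h (Suc (Suc n))" "\<kappa> n * h n"] by simp
    finally have 1: "cmod (d n) * cmod (h (Suc n)) \<le> cmod (h (Suc (Suc n))) + cmod (\<kappa> n) * cmod (h n)" by (simp add: norm_mult)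
    have "cmod (\<kappa> n) * cmod (h n) \<le> k * cmod (h (Suc n))" using \<kappa>[OF n] IH k0 by (intro mult_mono) auto
    moreover have "(k + 2) * cmod (h (Suc n)) \<le> cmod (d n) * cmod (h (Suc n))" using d[OF n] by (intro mult_right_mono) auto
    ultimately have "2 * cmod (h (Suc n)) \<le> cmod (h (Suc (Suc n)))" using 1 by (simp add: distrib_right)
    then show ?case using IH by linarith
  qed
  have hN: "h (Suc N) \<noteq> 0" using grow[of N] by auto
  define t where "t = (b - p (Suc N)) / h (Suc N)"
  show ?thesis
  proof (intro exI[of _ "\<lambda>n. t * h n + p n"] conjI allI impI)
    show "t * h (Suc N) + p (Suc N) = b" unfolding t_def using hN by simp
    show "d n * (t * h (Suc n) + p (Suc n)) + (t * h (Suc (Suc n)) + p (Suc (Suc n))) + \<kappa> n * (t * h n + p n) = r n" for n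
      unfolding hS pS by (simp add: algebra_simps)
  qed (simp add: h0 p0)
qed

text \<open>Each induction step prepends one antiderivative to the chain, with its constant fixed by
  the prescribed value at 1.\<close>

lemma prescribed_derivatives:
  fixes w :: "nat \<Rightarrow> real \<Rightarrow> complex" and a :: "nat \<Rightarrow> complex"
  assumes "\<And>j x. x \<in> {0..1} \<Longrightarrow> (w j has_vector_derivative w (Suc j) x) (at x within {0..1})"
  shows "\<exists>D. (\<forall>j. \<forall>x\<in>{0..1}. (D j has_vector_derivative D (Suc j) x) (at x within {0..1})) \<and>
     (\<forall>i<m. D i 1 = a i) \<and> (\<forall>j. D (m + j) = w j)"
proof (induction m arbitrary: a)
  case 0
  then show ?case using assms by (intro exI[of _ w]) auto
next
  case (Suc m)
  obtain E where E: "\<And>j x. x \<in> {0..1} \<Longrightarrow> (E j has_vector_derivative E (Suc j) x) (at x within {0..1})"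
    "\<And>i. i < m \<Longrightarrow> E i 1 = a (Suc i)" "\<And>j. E (m + j) = w j"
    using Suc.IH[of "\<lambda>i. a (Suc i)"] by blast
  define D where "D = case_nat (\<lambda>x. a 0 + (integral {0..x} (E 0) - integral {0..1} (E 0))) E"
  have c: "continuous_on {0..1} (E 0)" by (rule has_vector_derivative_continuous_on[OF E(1)])
  have D0: "(D 0 has_vector_derivative D (Suc 0) x) (at x within {0..1})" if "x \<in> {0..1}" for x
  proof -
    have "((\<lambda>x. a 0 + (integral {0..x} (E 0) - integral {0..1} (E 0))) has_vector_derivative 0 + (E 0 x - 0)) (at x within {0..1})"
      by (intro has_vector_derivative_add has_vector_derivative_diff has_vector_derivative_const integral_has_vector_derivative[OF c that])
    then show ?thesis unfolding D_def by simp
  qed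
  show ?case
  proof (intro exI[of _ D] conjI allI impI ballI)
    show "(D j has_vector_derivative D (Suc j) x) (at x within {0..1})" if "x \<in> {0..1}" for j x
    proof (cases j)
      case 0
      then show ?thesis using D0[OF that] by simp
    next
      case (Suc i)
      then show ?thesis using E(1)[OF that, of i] by (simp add: D_def)
    qed
    show "D i 1 = a i" if "i < Suc m" for i using that E(2) by (cases i) (auto simp: D_def)
    show "D (Suc m + j) = w j" for j using E(3) by (simp add: D_def)
  qed
qed

section \<open>Estimates for the low derivatives and existence in the right half-plane\<close>

lemma increment_to_one_le:
  fixes g g' :: "real \<Rightarrow> complex"
  assumes g: "\<And>x. x \<in> {0..1} \<Longrightarrow> (g has_vector_derivative g' x) (at x within {0..1})"
    and B: "\<And>x. x \<in> {0..1} \<Longrightarrow> cmod (g' x) \<le> B" and x: "x \<in> {0..1}"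
  shows "cmod (g x) \<le> cmod (g 1) + B"
proof -
  have sub: "{x..1} \<subseteq> {0..1}" using x by auto
  have B0: "0 \<le> B" using order_trans[OF norm_ge_zero B[OF x]] .
  have "(g' has_integral g 1 - g x) {x..1}"
    using x g by (intro fundamental_theorem_of_calculus) (auto intro: has_vector_derivative_within_subset[OF _ sub])
  then have "cmod (g 1 - g x) \<le> B * measure lborel {x..1}"
    using B sub B0 by (intro has_integral_bound_real) auto
  also have "\<dots> \<le> B" using x B0 by (simp add: mult_left_le)
  finally show ?thesis using norm_triangle_ineq4[of "g 1" "g 1 - g x"] by simp
qed

lemma taylor_sum_at_one: "m > 0 \<Longrightarrow> (\<Sum>i<m. of_real ((1 - 1) ^ i / fact i) * c i) = (c 0 :: complex)"
  by (cases m) (simp_all add: sum.lessThan_Suc_shift del: sum.lessThan_Suc)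

text \<open>At 1 the Taylor polynomial reduces to its leading coefficient, so \<open>lam\<close>
  enters only the coefficient of \<open>D (Suc n) 1\<close>. This is the origin of the tridiagonal
  structure and of the dominance of its diagonal for large \<open>lam\<close>.\<close>

lemma Lop_deriv_at_one:
  assumes "n < N"
  shows "Lop_deriv N lam s D n 1 = (of_real lam + s + of_nat (2 * (n + 1))) * D (Suc n) 1 + D (Suc (Suc n)) 1
     + (of_nat (n * (n + 1)) - of_nat (N * (N + 1))) * D n 1"
proof -
  have "(\<Sum>i<N - n. of_real ((1 - 1) ^ i / fact i) * D (Suc (n + i)) 1) = D (Suc (n + 0)) 1"
    using assms by (intro taylor_sum_at_one) auto
  then show ?thesis unfolding Lop_deriv_def by (simp only:) (simp add: algebra_simps)
qed

lemma zero_order_coefficient_bound: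
  assumes "n < N"
  shows "cmod (of_nat (n * (n + 1)) - of_nat (N * (N + 1))) \<le> real (N * (N + 1))"
proof -
  have "n * (n + 1) \<le> N * (N + 1)" using assms by (intro mult_mono) auto
  then have "complex_of_nat (n * (n + 1)) - of_nat (N * (N + 1)) = - of_nat (N * (N + 1) - n * (n + 1))"
    by (simp only: of_nat_diff minus_diff_eq)
  then have "cmod (of_nat (n * (n + 1)) - of_nat (N * (N + 1))) = real (N * (N + 1) - n * (n + 1))"
    by (simp only: norm_minus_cancel norm_of_nat)
  then show ?thesis by (simp only: of_nat_le_iff diff_le_self)
qed

context
  fixes \<sigma> :: real
  assumes sg: "\<sigma> > 0"
begin

text \<open>The first \<open>N\<close> terms of the norm are recovered from the top: a pointwise
  bound for \<open>u\<close> differentiated \<open>N + 1\<close> times, then the values at 1, then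
  integration downwards. \<open>C\<close> is chosen before \<open>lam\<close> and \<open>s\<close>,
  which enter only through diagonal dominance. Membership in X is part of the conclusion, for use in
  the existence proof.\<close>

lemma low_estimate:
  assumes Ch: "Ch \<ge> 0"
  shows "\<exists>C\<ge>0. \<forall>lam s u f. smooth01 u \<longrightarrow> u 1 = 0 \<longrightarrow> f \<in> Ysp \<sigma> \<longrightarrow> (\<forall>x\<in>{0<..<1}. Lop N lam s u x = f x) \<longrightarrow>
     (\<forall>n<N. real (N * (N + 1)) + 2 \<le> cmod (of_real lam + s + of_nat (2 * (n + 1)))) \<longrightarrow>
     (\<forall>j. (\<Sum>n=N..N+j. Xterm \<sigma> u n) \<le> Ch * (Ynorm \<sigma> f)\<^sup>2) \<longrightarrow> u \<in> Xsp \<sigma> \<and> Xnorm \<sigma> u \<le> C * Ynorm \<sigma> f"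
proof -
  define c where "c n = 2 / gw \<sigma> n + 2 / gw \<sigma> (Suc n)" for n
  have c0: "c n \<ge> 0" for n unfolding c_def using gw_pos[OF sg] by (simp add: less_imp_le)
  define b where "b = c N * sqrt Ch"
  define R where "R = (\<Sum>n<N. c n)"
  define T where "T = R + b"
  define g where "g n = (gw \<sigma> n)\<^sup>2 * (1 + real n / \<sigma> + (real n / \<sigma>)\<^sup>2 + \<sigma>)" for n
  define C where "C = sqrt ((\<Sum>n<N. g n) * ((real N + 1) * T)\<^sup>2 + Ch)"
  have b0: "b \<ge> 0" unfolding b_def using c0 Ch by simp
  have R0: "R \<ge> 0" unfolding R_def using c0 by (intro sum_nonneg)
  have g0: "g n \<ge> 0" for n unfolding g_def using sg by (intro mult_nonneg_nonneg add_nonneg_nonneg) auto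
  have C2: "C\<^sup>2 = (\<Sum>n<N. g n) * ((real N + 1) * T)\<^sup>2 + Ch"
    unfolding C_def using Ch g0 by (intro real_sqrt_pow2) (auto intro!: add_nonneg_nonneg mult_nonneg_nonneg sum_nonneg)
  have C0: "C \<ge> 0" unfolding C_def using Ch g0 by (auto intro!: add_nonneg_nonneg mult_nonneg_nonneg sum_nonneg)
  show ?thesis
  proof (intro exI[of _ C] conjI allI impI C0)
    fix lam :: real and s u f
    assume u: "smooth01 u" and u1: "u 1 = 0" and f: "f \<in> Ysp \<sigma>" and LE: "\<forall>x\<in>{0<..<1}. Lop N lam s u x = f x"
      and lam: "\<forall>n<N. real (N * (N + 1)) + 2 \<le> cmod (of_real lam + s + of_nat (2 * (n + 1)))"
      and H: "\<forall>j. (\<Sum>n=N..N+j. Xterm \<sigma> u n) \<le> Ch * (Ynorm \<sigma> f)\<^sup>2"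
    define Z where "Z = Ynorm \<sigma> f"
    have Z0: "Z \<ge> 0" unfolding Z_def by (rule Ynorm_nonneg[OF sg f])
    have fs: "smooth01 f" using f by (simp add: Ysp_iff[OF sg])
    have Xt0: "Xterm \<sigma> u n \<ge> 0" for n by (rule Xterm_nonneg[OF sg u])
    have cX: "cterm \<sigma> 0 0 1 u n \<le> Xterm \<sigma> u n" for n unfolding Xterm_def
      using cterm_nonneg[OF sg u, of 1 1 n] cterm_nonneg[OF sg u, of 2 1 n] bterm_nonneg[OF sg, of 1 u n] by linarith
    have XN: "Xterm \<sigma> u n \<le> (sqrt Ch * Z)\<^sup>2" if "n \<in> {N..N+1}" for n
    proof -
      have "Xterm \<sigma> u n \<le> (\<Sum>n=N..N+1. Xterm \<sigma> u n)" using that Xt0 by (intro member_le_sum) auto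
      also have "\<dots> \<le> Ch * Z\<^sup>2" using H unfolding Z_def by blast
      also have "\<dots> = (sqrt Ch * Z)\<^sup>2" using Ch by (simp add: power_mult_distrib)
      finally show ?thesis .
    qed
    have vN: "cmod (nderiv u (N + 1) x) \<le> b * Z" if x: "x \<in> {0..1}" for x
    proof -
      have "cmod (nderiv u (N + 1) x) \<le> (2 / gw \<sigma> N + 2 / gw \<sigma> (Suc N)) * (sqrt Ch * Z)"
        using order_trans[OF cX XN[of N]] order_trans[OF cX XN[of "Suc N"]] Ch Z0 by (intro sup_le_of_terms sg u x) auto
      then show ?thesis unfolding b_def c_def by (simp only: mult.assoc)
    qed
    have fb: "cmod (nderiv f n 1) \<le> R * Z" if "n < N" for n
    proof -
      have "cmod (nderiv f n 1) \<le> c n * Z" unfolding c_def Z_def by (rule nderiv_le_Ynorm[OF sg f]) simp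
      also have "\<dots> \<le> R * Z" unfolding R_def using that c0 Z0 by (intro mult_right_mono member_le_sum) auto
      finally show ?thesis .
    qed
    have a: "cmod (nderiv u i 1) \<le> R * Z + b * Z" if "i \<le> Suc N" for i
    proof (rule tridiagonal_bound[where a = "\<lambda>i. nderiv u i 1" and r = "\<lambda>n. nderiv f n 1" and N = N and k = "real (N * (N + 1))"
        and d = "\<lambda>n. of_real lam + s + of_nat (2 * (n + 1))" and \<kappa> = "\<lambda>n. of_nat (n * (n + 1)) - of_nat (N * (N + 1))"])
      fix n assume n: "n < N"
      show "(of_real lam + s + of_nat (2 * (n + 1))) * nderiv u (Suc n) 1 + nderiv u (Suc (Suc n)) 1
          + (of_nat (n * (n + 1)) - of_nat (N * (N + 1))) * nderiv u n 1 = nderiv f n 1"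
        unfolding Lop_deriv_at_one[OF n, symmetric] by (rule Lop_deriv_eq_nderiv[OF u fs LE]) simp
      show "cmod (nderiv f n 1) \<le> R * Z" by (rule fb[OF n])
      show "real (N * (N + 1)) + 2 \<le> cmod (of_real lam + s + of_nat (2 * (n + 1)))" using lam n by blast
      show "cmod (of_nat (n * (n + 1)) - of_nat (N * (N + 1))) \<le> real (N * (N + 1))" by (rule zero_order_coefficient_bound[OF n])
    next
      show "nderiv u 0 1 = 0" using nderiv_0[OF u, of 1] u1 by simp
      show "cmod (nderiv u (Suc N) 1) \<le> b * Z" using vN[of 1] by simp
      show "0 \<le> R * Z" using R0 Z0 by simp
    qed (rule that)
    have T0: "T * Z \<ge> 0" unfolding T_def using R0 b0 Z0 by simp
    have TZ: "R * Z + b * Z = T * Z" unfolding T_def by (simp add: distrib_right)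
    \<comment> \<open>Downward induction on the order of the derivative: each integration from 1
      adds one boundary value, bounded by \<open>T * Z\<close>.\<close>
    have low: "cmod (nderiv u (N + 1 - m) x) \<le> (real m + 1) * (T * Z)" if "m \<le> N" "x \<in> {0..1}" for m x
      using that
    proof (induction m arbitrary: x)
      case 0
      have "b * Z \<le> T * Z" unfolding T_def using R0 Z0 by (intro mult_right_mono) auto
      then show ?case using vN[OF 0(2)] by simp
    next
      case (Suc m)
      have e: "N + 1 - m = Suc (N + 1 - Suc m)" using Suc.prems by simp
      have "cmod (nderiv u (N + 1 - Suc m) x) \<le> cmod (nderiv u (N + 1 - Suc m) 1) + (real m + 1) * (T * Z)"
        using Suc e by (intro increment_to_one_le[where g' = "nderiv u (N + 1 - m)"]) (auto simp: e intro!: nderiv_has_derivative u simp del: diff_Suc_Suc)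
      also have "cmod (nderiv u (N + 1 - Suc m) 1) \<le> T * Z" unfolding TZ[symmetric] by (rule a) simp
      finally show ?case by (simp add: algebra_simps)
    qed
    have Xlow: "Xterm \<sigma> u n \<le> g n * (((real N + 1) * T) * Z)\<^sup>2" if n: "n < N" for n
      unfolding g_def
    proof (rule Xterm_le_sup[OF sg u])
      fix x :: real assume x: "x \<in> {0..1}"
      have "N + 1 - (N - n) = n + 1" using n by simp
      then have "cmod (nderiv u (n + 1) x) \<le> (real (N - n) + 1) * (T * Z)" using low[of "N - n" x] x by simp
      also have "\<dots> \<le> (real N + 1) * (T * Z)" using T0 n by (intro mult_right_mono) auto
      finally show "cmod (nderiv u (n + 1) x) \<le> (real N + 1) * T * Z" by (simp only: mult.assoc)
    qed
    have part: "(\<Sum>n<j. Xterm \<sigma> u n) \<le> C\<^sup>2 * Z\<^sup>2" for j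
    proof -
      have "(\<Sum>n<j. Xterm \<sigma> u n) \<le> (\<Sum>n\<in>{..<N} \<union> {N..N+j}. Xterm \<sigma> u n)"
        using Xt0 by (intro sum_mono2) auto
      also have "\<dots> = (\<Sum>n<N. Xterm \<sigma> u n) + (\<Sum>n=N..N+j. Xterm \<sigma> u n)" by (intro sum.union_disjoint) auto
      also have "\<dots> \<le> (\<Sum>n<N. g n * (((real N + 1) * T) * Z)\<^sup>2) + Ch * Z\<^sup>2"
        using Xlow H unfolding Z_def by (intro add_mono sum_mono) auto
      also have "\<dots> = C\<^sup>2 * Z\<^sup>2" unfolding C2 sum_distrib_right[symmetric] power_mult_distrib[of "(real N + 1) * T" Z]
        by (simp only: distrib_right[of _ Ch] mult.assoc)
      finally show ?thesis .
    qed
    have S: "summable (Xterm \<sigma> u)" by (rule summableI_nonneg_bounded[OF Xt0 part])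
    show uX: "u \<in> Xsp \<sigma>" using u u1 S by (simp add: Xsp_iff[OF sg])
    have "(Xnorm \<sigma> u)\<^sup>2 \<le> (C * Z)\<^sup>2"
      unfolding Xnorm_square[OF sg uX] power_mult_distrib by (rule suminf_le_const[OF S part])
    then show "Xnorm \<sigma> u \<le> C * Ynorm \<sigma> f"
      unfolding Z_def by (rule power2_le_imp_le) (use C0 Z0 in \<open>simp add: Z_def\<close>)
  qed
qed

end

text \<open>\<open>v\<close> is a candidate for \<open>u\<close> differentiated \<open>N + 1\<close>
  times, and the tridiagonal system dictates the constants of integration. The equations below level
  \<open>N\<close> then hold by descent.\<close>

lemma existence_right_half_plane:
  assumes N: "N \<ge> 1" and s: "Re s > 0" and f: "smooth01 f"
    and lam: "\<And>n. n < N \<Longrightarrow> real (N * (N + 1)) + 2 \<le> cmod (of_real lam + s + of_nat (2 * (n + 1)))"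
  shows "\<exists>u. smooth01 u \<and> u 1 = 0 \<and> (\<forall>x\<in>{0..1}. Lop N lam s u x = f x)"
proof -
  have df: "(nderiv f (N + n) has_vector_derivative nderiv f (N + Suc n) x) (at x within {0..1})" if "x \<in> {0..1}" for n x
    using nderiv_has_derivative[OF f that, of "N + n"] by simp
  obtain v where v: "\<And>j x. x \<in> {0..1} \<Longrightarrow> (v j has_vector_derivative v (Suc j) x) (at x within {0..1})"
    "\<And>x. x \<in> {0..1} \<Longrightarrow> of_real (x\<^sup>2) * v (Suc 0) x + (of_real (2 * real (N + 1) * x) + s) * v 0 x = nderiv f (N + 0) x"
    using smooth_first_order_solution[where f = "\<lambda>n. nderiv f (N + n)", OF s N df] by blast
  obtain a where a: "a 0 = 0" "a (Suc N) = v 0 1"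
    "\<And>n. n < N \<Longrightarrow> (of_real lam + s + of_nat (2 * (n + 1))) * a (Suc n) + a (Suc (Suc n)) + (of_nat (n * (n + 1)) - of_nat (N * (N + 1))) * a n = nderiv f n 1"
    using tridiagonal_solvable[where N = N and k = "real (N * (N + 1))" and d = "\<lambda>n. of_real lam + s + of_nat (2 * (n + 1))"
        and \<kappa> = "\<lambda>n. of_nat (n * (n + 1)) - of_nat (N * (N + 1))" and b = "v 0 1" and r = "\<lambda>n. nderiv f n 1", OF lam zero_order_coefficient_bound]
    by blast
  obtain D where D: "\<And>j x. x \<in> {0..1} \<Longrightarrow> (D j has_vector_derivative D (Suc j) x) (at x within {0..1})"
    "\<And>i. i < Suc N \<Longrightarrow> D i 1 = a i" "\<And>j. D (Suc N + j) = v j"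
    using prescribed_derivatives[of v "Suc N" a, OF v(1)] by blast
  have sD: "smooth_derivs (D 0) D" using D(1) by (auto simp: smooth_derivs_def)
  have Da: "D i 1 = a i" if "i \<le> Suc N" for i using D(2)[of i] D(3)[of 0] a(2) that by (cases "i = Suc N") auto
  have "Lop_deriv N lam s D (N - m) x = nderiv f (N - m) x" if "m \<le> N" "x \<in> {0..1}" for m x
    using that
  proof (induction m arbitrary: x)
    case 0
    have "D (N + 2) = v (Suc 0)" "D (N + 1) = v 0" using D(3)[of 1] D(3)[of 0] by simp_all
    then show ?case using v(2)[OF 0(2)] unfolding Lop_deriv_def by simp
  next
    case (Suc m)
    define n where "n = N - Suc m"
    have n: "N - m = Suc n" "n < N" using Suc.prems by (auto simp: n_def)
    \<comment> \<open>The defect at level \<open>n\<close> has derivative equal to the defect at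
      level \<open>Suc n\<close>, hence zero, and it vanishes at 1 by the tridiagonal
      system.\<close>
    let ?G = "\<lambda>x. Lop_deriv N lam s D n x - nderiv f n x"
    have "(?G has_vector_derivative 0) (at y within {0..1})" if y: "y \<in> {0..1}" for y
    proof -
      have "(?G has_vector_derivative Lop_deriv N lam s D (Suc n) y - nderiv f (Suc n) y) (at y within {0..1})"
        by (intro has_vector_derivative_diff Lop_deriv_derivative D(1) nderiv_has_derivative f y)
      then show ?thesis using Suc.IH[OF _ y] Suc.prems n by simp
    qed
    then obtain k where k: "\<And>y. y \<in> {0..1} \<Longrightarrow> ?G y = k"
      using has_vector_derivative_zero_constant[of "{0..1}" ?G] by (metis convex_real_interval(5))
    have "?G 1 = 0" unfolding Lop_deriv_at_one[OF n(2)] using a(3)[OF n(2)] n(2) by (simp add: Da)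
    then have "k = 0" using k[of 1] by simp
    then show ?case using k[OF Suc.prems(2)] unfolding n_def by simp
  qed
  from this[of N] have "Lop_deriv N lam s D 0 x = nderiv f 0 x" if "x \<in> {0..1}" for x using that by simp
  then have "\<forall>x\<in>{0..1}. Lop N lam s (D 0) x = f x" using Lop_eq_Lop_deriv[OF sD] nderiv_0[OF f] by simp
  moreover have "D 0 1 = 0" using Da[of 0] a(1) by simp
  ultimately show ?thesis using smooth01I[OF sD] by blast
qed

section \<open>Continuation in the spectral parameter\<close>

lemma geometric_tail:
  fixes z :: "nat \<Rightarrow> complex"
  assumes z: "\<And>k. cmod (z k) \<le> M * (1 / 2) ^ k"
  shows "summable z" and "cmod ((\<Sum>k<K. z k) - suminf z) \<le> 2 * M * (1 / 2) ^ K"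
proof -
  have g: "summable (\<lambda>k. M * (1 / 2) ^ k :: real)" by (intro summable_mult summable_geometric) simp
  show s: "summable z" by (rule summable_comparison_test'[OF g]) (use z in auto)
  have gK: "summable (\<lambda>k. M * (1 / 2) ^ (k + K) :: real)" by (rule summable_ignore_initial_segment[OF g])
  have "cmod (\<Sum>k. z (k + K)) \<le> (\<Sum>k. M * (1 / 2) ^ (k + K))"
    by (rule norm_suminf_le[OF z gK])
  also have "\<dots> = (\<Sum>k. (M * (1 / 2) ^ K) * (1 / 2) ^ k)" by (simp add: power_add mult_ac)
  also have "\<dots> = (M * (1 / 2) ^ K) * (\<Sum>k. (1 / 2) ^ k)" by (intro suminf_mult summable_geometric) simp
  also have "(\<Sum>k. (1 / 2 :: real) ^ k) = 2" by (subst suminf_geometric) auto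
  finally have "cmod (\<Sum>k. z (k + K)) \<le> 2 * M * (1 / 2) ^ K" by (simp add: mult_ac)
  then show "cmod ((\<Sum>k<K. z k) - suminf z) \<le> 2 * M * (1 / 2) ^ K"
    using suminf_minus_initial_segment[OF s, of K] by (simp add: norm_minus_commute)
qed

lemma smooth01_sum:
  fixes u :: "nat \<Rightarrow> real \<Rightarrow> complex"
  assumes "\<And>k. smooth01 (u k)"
  shows "smooth01 (\<lambda>x. \<Sum>k<K. u k x)" and "x \<in> {0..1} \<Longrightarrow> nderiv (\<lambda>x. \<Sum>k<K. u k x) n x = (\<Sum>k<K. nderiv (u k) n x)"
proof -
  have sd: "smooth_derivs (\<lambda>x. \<Sum>k<K. u k x) (\<lambda>n x. \<Sum>k<K. nderiv (u k) n x)"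
    unfolding smooth_derivs_def using assms
    by (auto intro!: sum.cong has_vector_derivative_sum nderiv_has_derivative simp: nderiv_0)
  show "smooth01 (\<lambda>x. \<Sum>k<K. u k x)" by (rule smooth01I[OF sd])
  show "x \<in> {0..1} \<Longrightarrow> nderiv (\<lambda>x. \<Sum>k<K. u k x) n x = (\<Sum>k<K. nderiv (u k) n x)" by (rule nderiv_eq[OF sd])
qed

lemma smooth_derivs_suminf:
  fixes D :: "nat \<Rightarrow> nat \<Rightarrow> real \<Rightarrow> complex"
  assumes D: "\<And>k n x. x \<in> {0..1} \<Longrightarrow> (D k n has_vector_derivative D k (Suc n) x) (at x within {0..1})"
    and M: "\<And>k n x. x \<in> {0..1} \<Longrightarrow> cmod (D k n x) \<le> M n * (1 / 2) ^ k"
    and x: "x \<in> {0..1}"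
  shows "((\<lambda>x. \<Sum>k. D k n x) has_vector_derivative (\<Sum>k. D k (Suc n) x)) (at x within {0..1})"
proof -
  have "\<exists>g. \<forall>x\<in>{0..1}. (\<lambda>k. D k n x) sums g x \<and> (g has_derivative (\<lambda>h. h *\<^sub>R (\<Sum>k. D k (Suc n) x))) (at x within {0..1})"
  proof (rule has_derivative_series[where f' = "\<lambda>k x h. h *\<^sub>R D k (Suc n) x"])
    show "(D k n has_derivative (\<lambda>h. h *\<^sub>R D k (Suc n) x)) (at x within {0..1})" if "x \<in> {0..1}" for k x
      using D[OF that] unfolding has_vector_derivative_def .
    show "(\<lambda>k. D k n 0) sums (\<Sum>k. D k n 0)" by (rule summable_sums[OF geometric_tail(1)[OF M]]) simp
    fix e :: real assume e: "e > 0"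
    have "(\<lambda>K. 2 * M (Suc n) * (1 / 2) ^ K) \<longlonglongrightarrow> 2 * M (Suc n) * 0"
      by (intro tendsto_intros LIMSEQ_realpow_zero) auto
    then have "eventually (\<lambda>K. 2 * M (Suc n) * (1 / 2) ^ K < e) sequentially"
      using e by (intro order_tendstoD(2)) auto
    then show "eventually (\<lambda>K. \<forall>x\<in>{0..1}. \<forall>h. norm ((\<Sum>i<K. h *\<^sub>R D i (Suc n) x) - h *\<^sub>R (\<Sum>k. D k (Suc n) x)) \<le> e * norm h) sequentially"
    proof (rule eventually_mono, intro ballI allI)
      fix K :: nat and x h :: real assume K: "2 * M (Suc n) * (1 / 2) ^ K < e" and x: "x \<in> {0..1}"
      have "norm ((\<Sum>i<K. h *\<^sub>R D i (Suc n) x) - h *\<^sub>R (\<Sum>k. D k (Suc n) x)) = \<bar>h\<bar> * cmod ((\<Sum>i<K. D i (Suc n) x) - (\<Sum>k. D k (Suc n) x))"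
        by (simp only: scaleR_right.sum[symmetric] scaleR_diff_right[symmetric] norm_scaleR)
      also have "\<dots> \<le> \<bar>h\<bar> * e"
        using geometric_tail(2)[OF M[OF x], of "Suc n" K] K by (intro mult_left_mono) auto
      finally show "norm ((\<Sum>i<K. h *\<^sub>R D i (Suc n) x) - h *\<^sub>R (\<Sum>k. D k (Suc n) x)) \<le> e * norm h"
        by (simp add: mult.commute)
    qed
  qed auto
  then obtain g where g: "\<And>x. x \<in> {0..1} \<Longrightarrow> (\<lambda>k. D k n x) sums g x"
    "\<And>x. x \<in> {0..1} \<Longrightarrow> (g has_vector_derivative (\<Sum>k. D k (Suc n) x)) (at x within {0..1})"
    unfolding has_vector_derivative_def by blast
  have e: "(\<Sum>k. D k n y) = g y" if "y \<in> {0..1}" for y using sums_unique[OF g(1)[OF that]] by simp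
  show ?thesis
    by (rule has_vector_derivative_transform[where f = g and S = "{0..1}", OF x e g(2)[OF x]])
qed

context
  fixes \<sigma> :: real
  assumes sg: "\<sigma> > 0"
begin

text \<open>Peeling off one summand at a time with \<open>|a + b|^2 \<le> 2 |a|^2 + 2 |b|^2\<close>
  costs \<open>2 ^ k\<close> on the \<open>k\<close>-th summand. This is harmless against squared
  norms that decay like \<open>(1 / 4) ^ k\<close>.\<close>

lemma Xterm_sum_le:
  assumes "\<And>k. smooth01 (u k)"
  shows "Xterm \<sigma> (\<lambda>x. \<Sum>k<K. u k x) n \<le> 2 * (\<Sum>k<K. 2 ^ k * Xterm \<sigma> (u k) n)"
  using assms
proof (induction K arbitrary: u)
  case 0
  have "Xterm \<sigma> (\<lambda>x. 0) n \<le> (gw \<sigma> n)\<^sup>2 * (1 + real n / \<sigma> + (real n / \<sigma>)\<^sup>2 + \<sigma>) * 0\<^sup>2"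
    by (rule Xterm_le_sup[OF sg smooth01I[OF smooth_derivs_zero]]) (simp add: nderiv_zero)
  then show ?case by simp
next
  case (Suc K)
  have "Xterm \<sigma> (\<lambda>x. \<Sum>k<Suc K. u k x) n = Xterm \<sigma> (\<lambda>x. 1 * u 0 x + (\<Sum>k<K. u (Suc k) x)) n"
    by (simp only: sum.lessThan_Suc_shift mult_1)
  also have "\<dots> \<le> 2 * (cmod 1)\<^sup>2 * Xterm \<sigma> (u 0) n + 2 * Xterm \<sigma> (\<lambda>x. \<Sum>k<K. u (Suc k) x) n"
    by (intro Xterm_linear_le sg Suc.prems smooth01_sum)
  also have "\<dots> \<le> 2 * (cmod 1)\<^sup>2 * Xterm \<sigma> (u 0) n + 2 * (2 * (\<Sum>k<K. 2 ^ k * Xterm \<sigma> (u (Suc k)) n))"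
    by (intro add_left_mono mult_left_mono Suc.IH Suc.prems) auto
  also have "\<dots> = 2 * (\<Sum>k<Suc K. 2 ^ k * Xterm \<sigma> (u k) n)"
    unfolding sum.lessThan_Suc_shift by (simp add: sum_distrib_left mult_ac)
  finally show ?case .
qed

text \<open>The form of completeness that the Neumann series requires. All derivatives converge
  uniformly, so the limit is smooth; its norm is bounded as in Fatou's lemma, by a bound on finite
  partial sums that is uniform in the number of summands.\<close>

lemma Xsp_series:
  assumes u: "\<And>k. u k \<in> Xsp \<sigma>" and B: "\<And>k. Xnorm \<sigma> (u k) \<le> B * (1 / 2) ^ k"
  shows "\<exists>w\<in>Xsp \<sigma>. \<forall>n. \<forall>x\<in>{0..1}. (\<lambda>k. nderiv (u k) n x) sums nderiv w n x"
proof -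
  have us: "smooth01 (u k)" "u k 1 = 0" "summable (Xterm \<sigma> (u k))" for k using u[of k] by (auto simp: Xsp_iff[OF sg])
  have B0: "B \<ge> 0" using order_trans[OF Xnorm_nonneg[OF sg u[of 0]] B[of 0]] by simp
  define c where "c n = (case n of 0 \<Rightarrow> 2 / gw \<sigma> 0 + 2 / gw \<sigma> (Suc 0) | Suc m \<Rightarrow> 2 / gw \<sigma> m + 2 / gw \<sigma> (Suc m))" for n
  have c0: "c n \<ge> 0" for n unfolding c_def using gw_pos[OF sg] by (auto split: nat.split simp: less_imp_le)
  have bound: "cmod (nderiv (u k) n x) \<le> c n * B * (1 / 2) ^ k" if x: "x \<in> {0..1}" for k n x
  proof -
    have S: "cmod (nderiv (u k) (Suc m) x) \<le> c (Suc m) * Xnorm \<sigma> (u k)" if "x \<in> {0..1}" for m x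
      using nderiv_le_Xnorm[OF sg u that, of k m] by (simp add: c_def)
    have "cmod (nderiv (u k) n x) \<le> c n * Xnorm \<sigma> (u k)"
    proof (cases n)
      case 0
      have "cmod (nderiv (u k) 0 x) \<le> cmod (nderiv (u k) 0 1) + c (Suc 0) * Xnorm \<sigma> (u k)"
        by (intro increment_to_one_le[where g' = "nderiv (u k) (Suc 0)"] nderiv_has_derivative us S x)
      then show ?thesis using 0 nderiv_0[OF us(1), of 1 k] us(2) by (simp add: c_def)
    next
      case (Suc m)
      then show ?thesis using S[OF x] by simp
    qed
    also have "\<dots> \<le> c n * (B * (1 / 2) ^ k)" by (intro mult_left_mono B c0)
    finally show ?thesis by (simp only: mult.assoc)
  qed
  define D where "D n x = (\<Sum>k. nderiv (u k) n x)" for n x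
  have sums: "(\<lambda>k. nderiv (u k) n x) sums D n x" if "x \<in> {0..1}" for n x
    unfolding D_def by (rule summable_sums[OF geometric_tail(1)[OF bound[OF that]]])
  have sD: "smooth_derivs (D 0) D"
    unfolding smooth_derivs_def D_def[abs_def]
    using smooth_derivs_suminf[where D = "\<lambda>k. nderiv (u k)" and M = "\<lambda>n. c n * B", OF nderiv_has_derivative[OF us(1)] bound] by auto
  define w where "w = D 0"
  have ws: "smooth01 w" unfolding w_def by (rule smooth01I[OF sD])
  have nw: "nderiv w n x = D n x" if "x \<in> {0..1}" for n x unfolding w_def by (rule nderiv_eq[OF sD that])
  have w1: "w 1 = 0"
  proof -
    have "nderiv (u k) 0 1 = 0" for k using nderiv_0[OF us(1), of 1 k] us(2) by simp
    then show ?thesis unfolding w_def D_def by simp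
  qed
  define g where "g n = (gw \<sigma> n)\<^sup>2 * (1 + real n / \<sigma> + (real n / \<sigma>)\<^sup>2 + \<sigma>)" for n
  let ?U = "\<lambda>K x. \<Sum>k<K. u k x"
  have Us: "smooth01 (?U K)" for K by (intro smooth01_sum us)
  have part: "(\<Sum>n<m. Xterm \<sigma> w n) \<le> 8 * B\<^sup>2" for m
  proof -
    define H where "H = (\<Sum>n<m. g n * (2 * (c (n + 1) * B))\<^sup>2)"
    \<comment> \<open>\<open>8 * B^2\<close> bounds the contribution of the partial sum of the
      functions for every \<open>m\<close> and \<open>K\<close>. The constant \<open>H\<close> of
      the remainder depends on \<open>m\<close>, but its factor tends to 0 with
      \<open>K\<close>.\<close>
    have le: "(\<Sum>n<m. Xterm \<sigma> w n) \<le> 8 * B\<^sup>2 + 2 * (H * ((1 / 2) ^ K)\<^sup>2)" for K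
    proof -
      let ?V = "\<lambda>x. (- 1) * ?U K x + w x"
      have Vs: "smooth01 ?V" by (intro smooth01_linear Us ws)
      have V: "Xterm \<sigma> ?V n \<le> g n * (2 * (c (n + 1) * B))\<^sup>2 * ((1 / 2) ^ K)\<^sup>2" for n
      proof -
        have "Xterm \<sigma> ?V n \<le> g n * (2 * (c (n + 1) * B) * (1 / 2) ^ K)\<^sup>2"
          unfolding g_def
        proof (rule Xterm_le_sup[OF sg Vs])
          fix x :: real assume x: "x \<in> {0..1}"
          have "nderiv ?V (n + 1) x = - ((\<Sum>k<K. nderiv (u k) (n + 1) x) - D (n + 1) x)"
            unfolding nderiv_linear[OF Us ws x] smooth01_sum(2)[OF us(1) x] nw[OF x] by simp
          then show "cmod (nderiv ?V (n + 1) x) \<le> 2 * (c (n + 1) * B) * (1 / 2) ^ K"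
            using geometric_tail(2)[OF bound[OF x], of "n + 1" K] unfolding D_def by (simp only: norm_minus_cancel)
        qed
        then show ?thesis unfolding power_mult_distrib[of "2 * (c (n + 1) * B)" "(1 / 2) ^ K"] by (simp only: mult.assoc)
      qed
      have UB: "(\<Sum>n<m. Xterm \<sigma> (?U K) n) \<le> 4 * B\<^sup>2"
      proof -
        have "(\<Sum>n<m. Xterm \<sigma> (?U K) n) \<le> (\<Sum>n<m. 2 * (\<Sum>k<K. 2 ^ k * Xterm \<sigma> (u k) n))"
          by (intro sum_mono Xterm_sum_le us)
        also have "\<dots> = 2 * (\<Sum>k<K. 2 ^ k * (\<Sum>n<m. Xterm \<sigma> (u k) n))"
          unfolding sum_distrib_left[symmetric] by (subst sum.swap) (simp only: sum_distrib_left)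
        also have "\<dots> \<le> 2 * (\<Sum>k<K. B\<^sup>2 * (1 / 2) ^ k)"
        proof (intro mult_left_mono sum_mono)
          fix k
          have "(\<Sum>n<m. Xterm \<sigma> (u k) n) \<le> (Xnorm \<sigma> (u k))\<^sup>2"
            unfolding Xnorm_square[OF sg u] by (intro sum_le_suminf us) (auto simp: Xterm_nonneg[OF sg us(1)])
          also have "\<dots> \<le> (B * (1 / 2) ^ k)\<^sup>2" by (intro power_mono B Xnorm_nonneg sg u)
          finally have "2 ^ k * (\<Sum>n<m. Xterm \<sigma> (u k) n) \<le> 2 ^ k * (B * (1 / 2) ^ k)\<^sup>2" by (intro mult_left_mono) auto
          also have "\<dots> = B\<^sup>2 * (1 / 2) ^ k * (2 ^ k * (1 / 2) ^ k)" by (simp only: power2_eq_square mult_ac)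
          also have "(2 :: real) ^ k * (1 / 2) ^ k = 1" by (simp add: power_one_over)
          finally show "2 ^ k * (\<Sum>n<m. Xterm \<sigma> (u k) n) \<le> B\<^sup>2 * (1 / 2) ^ k" by simp
        qed simp
        also have "\<dots> = 2 * B\<^sup>2 * (\<Sum>k<K. (1 / 2) ^ k)" by (simp only: sum_distrib_left mult.assoc)
        also have "\<dots> \<le> 2 * B\<^sup>2 * 2"
        proof (rule mult_left_mono)
          have "(\<Sum>k<K. (1 / 2 :: real) ^ k) \<le> (\<Sum>k. (1 / 2) ^ k)" by (intro sum_le_suminf summable_geometric) auto
          also have "\<dots> = 2" by (subst suminf_geometric) auto
          finally show "(\<Sum>k<K. (1 / 2 :: real) ^ k) \<le> 2" .
        qed simp
        finally show ?thesis by simp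
      qed
      have "Xterm \<sigma> w n \<le> 2 * Xterm \<sigma> (?U K) n + 2 * (g n * (2 * (c (n + 1) * B))\<^sup>2 * ((1 / 2) ^ K)\<^sup>2)" for n
      proof -
        have "Xterm \<sigma> w n = Xterm \<sigma> (\<lambda>x. 1 * ?U K x + ?V x) n" by simp
        also have "\<dots> \<le> 2 * (cmod 1)\<^sup>2 * Xterm \<sigma> (?U K) n + 2 * Xterm \<sigma> ?V n" by (rule Xterm_linear_le[OF sg Us Vs])
        finally show ?thesis using V[of n] by simp
      qed
      then have "(\<Sum>n<m. Xterm \<sigma> w n) \<le> (\<Sum>n<m. 2 * Xterm \<sigma> (?U K) n + 2 * (g n * (2 * (c (n + 1) * B))\<^sup>2 * ((1 / 2) ^ K)\<^sup>2))"
        by (intro sum_mono)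
      also have "\<dots> = 2 * (\<Sum>n<m. Xterm \<sigma> (?U K) n) + 2 * (H * ((1 / 2) ^ K)\<^sup>2)"
        unfolding H_def by (simp only: sum.distrib sum_distrib_left sum_distrib_right)
      finally show ?thesis using UB by linarith
    qed
    have "(\<lambda>K. 8 * B\<^sup>2 + 2 * (H * ((1 / 2) ^ K)\<^sup>2)) \<longlonglongrightarrow> 8 * B\<^sup>2 + 2 * (H * 0\<^sup>2)"
      by (intro tendsto_intros LIMSEQ_realpow_zero) auto
    then have "(\<Sum>n<m. Xterm \<sigma> w n) \<le> 8 * B\<^sup>2 + 2 * (H * 0\<^sup>2)"
      by (rule tendsto_lowerbound) (use le in \<open>auto intro: always_eventually\<close>)
    then show ?thesis by simp
  qed
  have "summable (Xterm \<sigma> w)" by (rule summableI_nonneg_bounded[OF Xterm_nonneg[OF sg ws] part])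
  then have "w \<in> Xsp \<sigma>" using ws w1 by (simp add: Xsp_iff[OF sg])
  then show ?thesis using sums nw by (intro bexI[of _ w]) auto
qed

text \<open>The factor 2 is inherited from the two-term inequality with second term zero. It is the
  reason why a continuation step is limited by \<open>1 / 4\<close> in order to contract by
  \<open>1 / 2\<close>.\<close>

lemma Ynorm_scale_le:
  assumes f: "f \<in> Ysp \<sigma>"
  shows "(\<lambda>x. a * f x) \<in> Ysp \<sigma>" and "Ynorm \<sigma> (\<lambda>x. a * f x) \<le> 2 * cmod a * Ynorm \<sigma> f"
proof -
  have "(\<lambda>x. a * f x + 0) \<in> Ysp \<sigma>" by (intro Ysp_linear[OF sg] f zero_Ysp[OF sg])
  then show Y: "(\<lambda>x. a * f x) \<in> Ysp \<sigma>" by simp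
  have fs: "smooth01 f" "summable (Yterm \<sigma> f)" using f by (auto simp: Ysp_iff[OF sg])
  have le: "Yterm \<sigma> (\<lambda>x. a * f x) n \<le> 2 * (cmod a)\<^sup>2 * Yterm \<sigma> f n" for n
    using Yterm_linear_le[OF sg fs(1) smooth01I[OF smooth_derivs_zero], of a n] by (simp add: Yterm_zero[OF sg])
  have "suminf (Yterm \<sigma> (\<lambda>x. a * f x)) \<le> (\<Sum>n. 2 * (cmod a)\<^sup>2 * Yterm \<sigma> f n)"
    using Y fs(2) by (intro suminf_le le summable_mult) (auto simp: Ysp_iff[OF sg])
  also have "\<dots> = 2 * (cmod a)\<^sup>2 * (Ynorm \<sigma> f)\<^sup>2" unfolding Ynorm_square[OF sg f] by (rule suminf_mult[OF fs(2)])
  also have "\<dots> \<le> (2 * cmod a * Ynorm \<sigma> f)\<^sup>2" by (simp add: power_mult_distrib mult_right_mono)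
  finally have "(Ynorm \<sigma> (\<lambda>x. a * f x))\<^sup>2 \<le> (2 * cmod a * Ynorm \<sigma> f)\<^sup>2" unfolding Ynorm_square[OF sg Y] .
  then show "Ynorm \<sigma> (\<lambda>x. a * f x) \<le> 2 * cmod a * Ynorm \<sigma> f"
    by (rule power2_le_imp_le) (use Ynorm_nonneg[OF sg f] in simp)
qed

definition solvable :: "nat \<Rightarrow> real \<Rightarrow> complex \<Rightarrow> bool" where
  "solvable N lam s \<longleftrightarrow> (\<forall>f\<in>Ysp \<sigma>. \<exists>u\<in>Xsp \<sigma>. \<forall>x\<in>{0<..<1}. Lop N lam s u x = f x)"

text \<open>The bound speaks only of \<open>u\<close> already in X, because its proof discards a
  tail that vanishes for such \<open>u\<close>. It gives uniqueness, but existence has to be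
  supplied separately.\<close>

definition apriori :: "nat \<Rightarrow> real \<Rightarrow> real \<Rightarrow> complex \<Rightarrow> bool" where
  "apriori N lam C s \<longleftrightarrow> (\<forall>u\<in>Xsp \<sigma>. \<forall>f\<in>Ysp \<sigma>. (\<forall>x\<in>{0<..<1}. Lop N lam s u x = f x) \<longrightarrow> Xnorm \<sigma> u \<le> C * Ynorm \<sigma> f)"

lemma Lop_sums:
  assumes u: "\<And>k. smooth01 (u k)" and w: "smooth01 w" and x: "x \<in> {0..1}"
    and s: "\<And>n x. x \<in> {0..1} \<Longrightarrow> (\<lambda>k. nderiv (u k) n x) sums nderiv w n x"
  shows "(\<lambda>k. Lop N lam s (u k) x) sums Lop N lam s w x"
proof -
  have 0: "(\<lambda>k. u k x) sums w x" using s[OF x, of 0] unfolding nderiv_0[OF u x] nderiv_0[OF w x] .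
  have 1: "(1::real) \<in> {0..1}" by simp
  show ?thesis unfolding Lop_def
    by (intro sums_add sums_diff sums_mult sums_sum s[OF x] s[OF 1] 0)
qed

text \<open>Neumann series for \<open>L\<^sub>s = L\<^sub>s\<^sub>' + (s - s') d/dx\<close>.\<close>

lemma solvable_step:
  assumes S: "solvable N lam s'" and ap: "apriori N lam C s'" and C: "C \<ge> 0" "C * cmod (s' - s) \<le> 1 / 4"
  shows "solvable N lam s"
  unfolding solvable_def
proof
  fix f assume f: "f \<in> Ysp \<sigma>"
  define R where "R h = (SOME u. u \<in> Xsp \<sigma> \<and> (\<forall>x\<in>{0<..<1}. Lop N lam s' u x = h x))" for h
  have R: "R h \<in> Xsp \<sigma> \<and> (\<forall>x\<in>{0<..<1}. Lop N lam s' (R h) x = h x)" if "h \<in> Ysp \<sigma>" for h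
  proof -
    have "\<exists>u. u \<in> Xsp \<sigma> \<and> (\<forall>x\<in>{0<..<1}. Lop N lam s' u x = h x)" using S that unfolding solvable_def by blast
    from someI_ex[OF this] show ?thesis unfolding R_def .
  qed
  have RC: "Xnorm \<sigma> (R h) \<le> C * Ynorm \<sigma> h" if "h \<in> Ysp \<sigma>" for h
    using ap R[OF that] that unfolding apriori_def by blast
  \<comment> \<open>The terms of the Neumann series. \<open>R\<close> is obtained by choice, and no
    linearity of \<open>R\<close> is used: the series is summed in X and the linear operator is
    applied to the sum.\<close>
  define u where "u = rec_nat (R f) (\<lambda>k v. R (\<lambda>x. (s' - s) * nderiv v 1 x))"
  have u0: "u 0 = R f" and uS: "u (Suc k) = R (\<lambda>x. (s' - s) * nderiv (u k) 1 x)" for k unfolding u_def by simp_all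
  have uX: "u k \<in> Xsp \<sigma>" for k
  proof (induction k)
    case (Suc k)
    then show ?case unfolding uS using R Ynorm_scale_le(1) derivative_Ysp(1)[OF sg] by blast
  qed (use R f u0 in simp)
  have hY: "(\<lambda>x. (s' - s) * nderiv (u k) 1 x) \<in> Ysp \<sigma>" for k
    by (rule Ynorm_scale_le(1)[OF derivative_Ysp(1)[OF sg uX]])
  have half: "Xnorm \<sigma> (u (Suc k)) \<le> 1 / 2 * Xnorm \<sigma> (u k)" for k
  proof -
    have "Xnorm \<sigma> (u (Suc k)) \<le> C * Ynorm \<sigma> (\<lambda>x. (s' - s) * nderiv (u k) 1 x)" unfolding uS by (rule RC[OF hY])
    also have "\<dots> \<le> C * (2 * cmod (s' - s) * Ynorm \<sigma> (nderiv (u k) 1))"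
      by (intro mult_left_mono C Ynorm_scale_le(2) derivative_Ysp(1)[OF sg uX])
    also have "\<dots> \<le> C * (2 * cmod (s' - s) * Xnorm \<sigma> (u k))"
      by (intro mult_left_mono C derivative_Ysp(2)[OF sg uX]) auto
    also have "\<dots> = 2 * (C * cmod (s' - s)) * Xnorm \<sigma> (u k)" by simp
    also have "\<dots> \<le> 1 / 2 * Xnorm \<sigma> (u k)"
      using C(2) by (intro mult_right_mono Xnorm_nonneg[OF sg uX]) auto
    finally show ?thesis .
  qed
  have "Xnorm \<sigma> (u k) \<le> Xnorm \<sigma> (u 0) * (1 / 2) ^ k" for k
  proof (induction k)
    case (Suc k)
    then show ?case using half[of k] by simp
  qed simp
  then obtain w where w: "w \<in> Xsp \<sigma>" "\<And>n x. x \<in> {0..1} \<Longrightarrow> (\<lambda>k. nderiv (u k) n x) sums nderiv w n x"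
    using Xsp_series[of u, OF uX] by blast
  have us: "smooth01 (u k)" for k using uX by (simp add: Xsp_iff[OF sg])
  have ws: "smooth01 w" using w by (simp add: Xsp_iff[OF sg])
  have "Lop N lam s w x = f x" if x: "x \<in> {0<..<1}" for x
  proof -
    have x': "x \<in> {0..1}" using x by simp
    have L: "(\<lambda>k. Lop N lam s' (u k) x) sums Lop N lam s' w x" by (rule Lop_sums[OF us ws x' w(2)])
    have L0: "Lop N lam s' (u 0) x = f x" unfolding u0 using R[OF f] x by blast
    have LS: "Lop N lam s' (u (Suc k)) x = (s' - s) * nderiv (u k) 1 x" for k unfolding uS using R[OF hY] x by blast
    have "(\<lambda>k. (s' - s) * nderiv (u k) 1 x) sums ((s' - s) * nderiv w 1 x)" by (intro sums_mult w(2) x')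
    \<comment> \<open>The image of each term is \<open>(s' - s)\<close> times the derivative of its
      predecessor, so the operator at \<open>s'\<close> maps \<open>w\<close> to \<open>f\<close>
      plus \<open>(s' - s)\<close> times the derivative of \<open>w\<close>.\<close>
    then have "(\<lambda>k. Lop N lam s' (u k) x) sums ((s' - s) * nderiv w 1 x + Lop N lam s' (u 0) x)"
      unfolding LS[symmetric] by (rule sums_Suc)
    then have "Lop N lam s' w x = (s' - s) * nderiv w 1 x + f x" using L L0 sums_unique2 by metis
    then show ?thesis using Lop_change_s[of N lam s w x s'] by (simp add: algebra_simps)
  qed
  then show "\<exists>u\<in>Xsp \<sigma>. \<forall>x\<in>{0<..<1}. Lop N lam s u x = f x" using w(1) by blast
qed

text \<open>The admissible step length depends only on \<open>C\<close>, so finitely many steps to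
  the left lead from \<open>s + T\<close> back to \<open>s\<close>.\<close>

lemma solvable_continuation:
  assumes S: "solvable N lam (s + of_real T)" and T: "T \<ge> 0" and C: "C \<ge> 0"
    and ap: "\<And>t. 0 \<le> t \<Longrightarrow> t \<le> T \<Longrightarrow> apriori N lam C (s + of_real t)"
  shows "solvable N lam s"
proof -
  obtain n where n: "4 * C * T \<le> real n" using real_arch_simple by blast
  define h where "h = T / real (Suc n)"
  have h0: "h \<ge> 0" unfolding h_def using T by simp
  have hC: "C * h \<le> 1 / 4" unfolding h_def using n by (simp add: field_simps)
  have "solvable N lam (s + of_real (T - real j * h))" if "j \<le> Suc n" for j
    using that
  proof (induction j)
    case (Suc j)
    have "real j * h \<le> real (Suc n) * h" using Suc.prems h0 by (intro mult_right_mono) auto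
    then have "real j * h \<le> T" unfolding h_def by simp
    then have ap': "apriori N lam C (s + of_real (T - real j * h))" using h0 by (intro ap) auto
    have le: "C * cmod ((s + of_real (T - real j * h)) - (s + of_real (T - real (Suc j) * h))) \<le> 1 / 4"
    proof -
      have "(s + of_real (T - real j * h)) - (s + of_real (T - real (Suc j) * h)) = of_real h"
        by (simp add: algebra_simps)
      then show ?thesis using hC h0 by (simp only: norm_of_real abs_of_nonneg)
    qed
    have "solvable N lam (s + of_real (T - real j * h))" using Suc by simp
    then show ?case by (rule solvable_step[OF _ ap' C le])
  qed (use S in simp)
  from this[of "Suc n"] show ?thesis unfolding h_def by simp
qed

end

section \<open>The holomorphic family\<close>

text \<open>Compactness yields \<open>M\<close>, \<open>\<delta>\<close>, \<open>\<eta>\<close> and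
  \<open>A\<close>; these determine \<open>N\<close>, and then \<open>N\<close> and \<open>A\<close>
  determine \<open>lam\<close>. Hence one operator and one constant serve every \<open>s\<close> in
  \<open>K\<close>, on both sides of the imaginary axis.\<close>

lemma uniform_resolvent_bounds:
  assumes sg: "\<sigma> > 0" and K: "compact K" "K \<subseteq> good \<sigma>"
  shows "\<exists>N lam C. C \<ge> 0 \<and> (\<forall>s\<in>K. apriori \<sigma> N lam C s \<and> (Re s \<ge> 1 \<longrightarrow> solvable \<sigma> N lam s))"
proof -
  obtain M \<delta> where M: "M \<ge> 0" "\<delta> > 0" "\<And>s. s \<in> K \<Longrightarrow> coercive_at \<sigma> M \<delta> s"
    using coercive_on_compact[OF sg K] by blast
  obtain \<eta> where eta: "\<eta> > 0" "\<And>s. s \<in> K \<Longrightarrow> \<sigma> + \<eta> \<le> cmod s" using cmod_gap_on_compact[OF K] by blast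
  obtain A where A: "A > 0" "\<And>s. s \<in> K \<Longrightarrow> cmod s \<le> A"
    using compact_imp_bounded[OF K(1)] unfolding bounded_pos by blast
  define L where "L = 2 * (3 + A) + 2 * \<sigma>\<^sup>2 + \<sigma>\<^sup>2 * A"
  \<comment> \<open>All summands are nonnegative, so a single inequality yields the four separate
    requirements on \<open>N\<close>.\<close>
  obtain N where N: "1 + A + 4 * L + 4 / \<delta> * (2 * M * L + 1 / \<sigma>) \<le> real N" using real_arch_simple by blast
  have L0: "L \<ge> 0" unfolding L_def using A sg by (intro add_nonneg_nonneg mult_nonneg_nonneg) auto
  have W0: "4 / \<delta> * (2 * M * L + 1 / \<sigma>) \<ge> 0" using M sg L0 by (intro mult_nonneg_nonneg add_nonneg_nonneg) auto
  have N1: "N \<ge> 1" "A \<le> 2 * real N" "4 * L \<le> real N" "4 / \<delta> * (2 * M * L + 1 / \<sigma>) \<le> real N"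
    using N L0 W0 A(1) by linarith+
  have NK: "2 * M * L + 1 / \<sigma> \<le> \<delta> / 4 * real N" using N1(4) M(2) by (simp add: field_simps)
  have ReA: "\<bar>Re s\<bar> \<le> A" if "s \<in> K" for s using abs_Re_le_cmod[of s] A(2)[OF that] by linarith
  \<comment> \<open>Chosen so that \<open>Re (lam + s) \<ge> N (N + 1) + 2\<close> for all
    \<open>|s| \<le> A\<close>: \<open>N (N + 1)\<close> for the entry below the diagonal, 1 for the
    entry above, and 1 to spare.\<close>
  define lam where "lam = real (N * (N + 1)) + 2 + A"
  have lam: "real (N * (N + 1)) + 2 \<le> cmod (of_real lam + s + of_nat (2 * (n + 1)))" if "s \<in> K" for s n
  proof -
    have "real (N * (N + 1)) + 2 \<le> lam + Re s" unfolding lam_def using ReA[OF that] by linarith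
    also have "\<dots> \<le> lam + Re s + real (2 * (n + 1))" by simp
    also have "\<dots> = Re (of_real lam + s + of_nat (2 * (n + 1)))" by (simp only: plus_complex.sel Re_complex_of_real complex_Re_of_nat)
    also have "\<dots> \<le> cmod (of_real lam + s + of_nat (2 * (n + 1)))" by (rule complex_Re_le_cmod)
    finally show ?thesis .
  qed
  have cs: "1 + 1 / \<sigma> + 1 / \<sigma>\<^sup>2 + \<sigma> \<ge> 0" using sg by (intro add_nonneg_nonneg) auto
  define Ch1 where "Ch1 = (1 + 1 / \<sigma> + 1 / \<sigma>\<^sup>2 + \<sigma>) * (2 / \<delta> * (M + 1 / \<delta> + \<delta> / (\<sigma> * \<eta>\<^sup>2)) + 1 / (\<sigma> * \<eta>\<^sup>2))"
  define Ch2 where "Ch2 = (1 + 1 / \<sigma> + 1 / \<sigma>\<^sup>2 + \<sigma>) * ((2 + 1 / (\<sigma> * \<eta>\<^sup>2)) + 1 / (\<sigma> * \<eta>\<^sup>2))"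
  have Ch: "Ch1 \<ge> 0" "Ch2 \<ge> 0" unfolding Ch1_def Ch2_def using cs sg M eta(1)
    by (intro mult_nonneg_nonneg add_nonneg_nonneg; simp)+
  define Ch where "Ch = max Ch1 Ch2"
  have "Ch \<ge> 0" unfolding Ch_def using Ch by simp
  then obtain C where C: "C \<ge> 0" "\<And>lam s u f. smooth01 u \<Longrightarrow> u 1 = 0 \<Longrightarrow> f \<in> Ysp \<sigma> \<Longrightarrow> \<forall>x\<in>{0<..<1}. Lop N lam s u x = f x \<Longrightarrow>
     \<forall>n<N. real (N * (N + 1)) + 2 \<le> cmod (of_real lam + s + of_nat (2 * (n + 1))) \<Longrightarrow>
     \<forall>j. (\<Sum>n=N..N+j. Xterm \<sigma> u n) \<le> Ch * (Ynorm \<sigma> f)\<^sup>2 \<Longrightarrow> u \<in> Xsp \<sigma> \<and> Xnorm \<sigma> u \<le> C * Ynorm \<sigma> f"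
    using low_estimate[OF sg, of Ch N] by blast
  have Ch1: "Ch1 * (Ynorm \<sigma> f)\<^sup>2 \<le> Ch * (Ynorm \<sigma> f)\<^sup>2" and Ch2: "Ch2 * (Ynorm \<sigma> f)\<^sup>2 \<le> Ch * (Ynorm \<sigma> f)\<^sup>2" for f
    unfolding Ch_def by (intro mult_right_mono; simp)+
  have "apriori \<sigma> N lam C s" if s: "s \<in> K" for s
    unfolding apriori_def[OF sg]
  proof (intro ballI impI)
    fix u f assume u: "u \<in> Xsp \<sigma>" and f: "f \<in> Ysp \<sigma>" and LE: "\<forall>x\<in>{0<..<1}. Lop N lam s u x = f x"
    have "\<forall>j. (\<Sum>n=N..N+j. Xterm \<sigma> u n) \<le> Ch * (Ynorm \<sigma> f)\<^sup>2"
      using order_trans[OF high_estimate[OF sg N1(1) u f LE eta(1) eta(2)[OF s] ReA[OF s] N1(2) M(2) M(1) M(3)[OF s]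
        NK[unfolded L_def], folded Ch1_def] Ch1] by blast
    then show "Xnorm \<sigma> u \<le> C * Ynorm \<sigma> f"
      using C(2)[of u f lam s] u f LE lam[OF s] by (auto simp: Xsp_iff[OF sg])
  qed
  moreover have "solvable \<sigma> N lam s" if s: "s \<in> K" and Re: "Re s \<ge> 1" for s
    unfolding solvable_def[OF sg]
  proof
    fix f assume f: "f \<in> Ysp \<sigma>"
    then have fs: "smooth01 f" by (simp add: Ysp_iff[OF sg])
    have Re0: "Re s > 0" using Re by simp
    obtain u where u: "smooth01 u" "u 1 = 0" "\<forall>x\<in>{0..1}. Lop N lam s u x = f x"
      using existence_right_half_plane[OF N1(1) Re0 fs lam[OF s]] by blast
    have LE: "\<forall>x\<in>{0<..<1}. Lop N lam s u x = f x" using u(3) by simp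
    have "\<forall>j. (\<Sum>n=N..N+j. Xterm \<sigma> u n) \<le> Ch * (Ynorm \<sigma> f)\<^sup>2"
      using order_trans[OF high_estimate_right[OF sg N1(1) u(1) f LE eta(1) eta(2)[OF s] ReA[OF s] N1(2) Re
        N1(3)[unfolded L_def], folded Ch2_def] Ch2] by blast
    then show "\<exists>u\<in>Xsp \<sigma>. \<forall>x\<in>{0<..<1}. Lop N lam s u x = f x"
      using C(2)[of u f lam s] u f LE lam[OF s] by blast
  qed
  ultimately show ?thesis using C(1) by blast
qed

lemma aprioriD:
  assumes "\<sigma> > 0" "apriori \<sigma> N lam C s" "u \<in> Xsp \<sigma>" "f \<in> Ysp \<sigma>" "\<forall>x\<in>{0<..<1}. Lop N lam s u x = f x"
  shows "Xnorm \<sigma> u \<le> C * Ynorm \<sigma> f"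
  using assms(2-5) unfolding apriori_def[OF assms(1)] by blast

lemma apriori_unique:
  assumes sg: "\<sigma> > 0" and ap: "apriori \<sigma> N lam C s" and u: "u \<in> Xsp \<sigma>" and v: "v \<in> Xsp \<sigma>"
    and eq: "\<And>x. x \<in> {0<..<1} \<Longrightarrow> Lop N lam s u x = Lop N lam s v x" and x: "x \<in> {0..1}"
  shows "u x = v x"
proof -
  let ?d = "\<lambda>y. (- 1) * v y + u y"
  have d: "?d \<in> Xsp \<sigma>" by (rule Xsp_linear[OF sg v u])
  have us: "smooth01 u" "smooth01 v" using u v by (auto simp: Xsp_iff[OF sg])
  have "\<forall>x\<in>{0<..<1}. Lop N lam s ?d x = 0"
  proof
    fix x :: real assume x: "x \<in> {0<..<1}"
    then have "x \<in> {0..1}" by simp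
    then show "Lop N lam s ?d x = 0" unfolding Lop_linear[OF us(2,1) \<open>x \<in> {0..1}\<close>] using eq[OF x] by simp
  qed
  then have "Xnorm \<sigma> ?d \<le> C * Ynorm \<sigma> (\<lambda>x. 0)" by (rule aprioriD[OF sg ap d zero_Ysp[OF sg]])
  then have "?d x = 0" using Xnorm_zero_imp[OF sg d _ x] Ynorm_zero[OF sg] by simp
  then show ?thesis by simp
qed

lemma Lop_zero: "x \<in> {0..1} \<Longrightarrow> Lop N lam s (\<lambda>x. 0) x = 0"
  unfolding Lop_def by (simp add: nderiv_zero)

locale resolvent_family =
  fixes \<sigma> :: real and N :: nat and lam C :: real and U :: "complex set"
    and R :: "complex \<Rightarrow> (real \<Rightarrow> complex) \<Rightarrow> real \<Rightarrow> complex"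
  assumes sg: "\<sigma> > 0" and C: "C \<ge> 0"
    and ap: "\<And>s. s \<in> U \<Longrightarrow> apriori \<sigma> N lam C s"
    and RX: "\<And>s f. s \<in> U \<Longrightarrow> f \<in> Ysp \<sigma> \<Longrightarrow> R s f \<in> Xsp \<sigma>"
    and RL: "\<And>s f x. s \<in> U \<Longrightarrow> f \<in> Ysp \<sigma> \<Longrightarrow> x \<in> {0<..<1} \<Longrightarrow> Lop N lam s (R s f) x = f x"
begin

lemma Rs: "s \<in> U \<Longrightarrow> f \<in> Ysp \<sigma> \<Longrightarrow> smooth01 (R s f)"
  using RX by (simp add: Xsp_iff[OF sg])

lemma RC: "s \<in> U \<Longrightarrow> f \<in> Ysp \<sigma> \<Longrightarrow> Xnorm \<sigma> (R s f) \<le> C * Ynorm \<sigma> f"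
  using RL by (intro aprioriD[OF sg ap RX]) auto

text \<open>\<open>R s\<close> may select any solution, so linearity is not built in; it follows
  from uniqueness, and therefore only on \<open>[0,1]\<close>.\<close>

lemma R_linear:
  assumes s: "s \<in> U" and f: "f \<in> Ysp \<sigma>" and g: "g \<in> Ysp \<sigma>" and x: "x \<in> {0..1}"
  shows "R s (\<lambda>y. a * f y + g y) x = a * R s f x + R s g x"
proof (rule apriori_unique[OF sg ap[OF s] _ _ _ x, where u = "R s (\<lambda>y. a * f y + g y)" and v = "\<lambda>y. a * R s f y + R s g y"])
  have fg: "(\<lambda>y. a * f y + g y) \<in> Ysp \<sigma>" by (rule Ysp_linear[OF sg f g])
  show "R s (\<lambda>y. a * f y + g y) \<in> Xsp \<sigma>" by (rule RX[OF s fg])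
  show "(\<lambda>y. a * R s f y + R s g y) \<in> Xsp \<sigma>" by (intro Xsp_linear[OF sg] RX s f g)
  fix t :: real assume t: "t \<in> {0<..<1}"
  then have t': "t \<in> {0..1}" by simp
  show "Lop N lam s (R s (\<lambda>y. a * f y + g y)) t = Lop N lam s (\<lambda>y. a * R s f y + R s g y) t"
    unfolding RL[OF s fg t] Lop_linear[OF Rs[OF s f] Rs[OF s g] t'] RL[OF s f t] RL[OF s g t] ..
qed

lemma R_bounded: "s \<in> U \<Longrightarrow> bounded_op \<sigma> (R s)"
  unfolding bounded_op_def using RX R_linear RC by blast

lemma negative_derivative_Ysp:
  assumes s: "s \<in> U" and f: "f \<in> Ysp \<sigma>"
  shows "(\<lambda>x. (- 1) * nderiv (R s f) 1 x) \<in> Ysp \<sigma>" "Ynorm \<sigma> (\<lambda>x. (- 1) * nderiv (R s f) 1 x) \<le> 2 * C * Ynorm \<sigma> f"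
proof -
  have Y: "nderiv (R s f) 1 \<in> Ysp \<sigma>" by (rule derivative_Ysp(1)[OF sg RX[OF s f]])
  show "(\<lambda>x. (- 1) * nderiv (R s f) 1 x) \<in> Ysp \<sigma>" by (rule Ynorm_scale_le(1)[OF sg Y])
  have "Ynorm \<sigma> (\<lambda>x. (- 1) * nderiv (R s f) 1 x) \<le> 2 * cmod (- 1) * Ynorm \<sigma> (nderiv (R s f) 1)"
    by (rule Ynorm_scale_le(2)[OF sg Y])
  also have "\<dots> \<le> 2 * cmod (- 1) * (C * Ynorm \<sigma> f)"
    by (intro mult_left_mono order_trans[OF derivative_Ysp(2)[OF sg RX[OF s f]] RC[OF s f]]) auto
  finally show "Ynorm \<sigma> (\<lambda>x. (- 1) * nderiv (R s f) 1 x) \<le> 2 * C * Ynorm \<sigma> f" by simp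
qed

text \<open>Formally differentiating \<open>L(s) R(s) = 1\<close> in \<open>s\<close>, with
  \<open>L'(s) = d/dx\<close>, gives the derivative \<open>- R(s) (d/dx) R(s)\<close>.\<close>

definition R' :: "complex \<Rightarrow> (real \<Rightarrow> complex) \<Rightarrow> real \<Rightarrow> complex" where
  "R' s f = R s (\<lambda>x. (- 1) * nderiv (R s f) 1 x)"

lemma R'_bound: "s \<in> U \<Longrightarrow> f \<in> Ysp \<sigma> \<Longrightarrow> Xnorm \<sigma> (R' s f) \<le> 2 * C\<^sup>2 * Ynorm \<sigma> f"
proof -
  assume s: "s \<in> U" and f: "f \<in> Ysp \<sigma>"
  have "Xnorm \<sigma> (R' s f) \<le> C * Ynorm \<sigma> (\<lambda>x. (- 1) * nderiv (R s f) 1 x)"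
    unfolding R'_def by (rule RC[OF s negative_derivative_Ysp(1)[OF s f]])
  also have "\<dots> \<le> C * (2 * C * Ynorm \<sigma> f)" by (intro mult_left_mono negative_derivative_Ysp(2) s f C)
  finally show ?thesis by (simp add: power2_eq_square mult_ac)
qed

text \<open>The two inner right-hand sides agree on \<open>[0,1]\<close> but possibly not elsewhere,
  so linearity of \<open>R s\<close> cannot simply be composed with itself; uniqueness is applied
  once more to the outer solution.\<close>

lemma R'_linear:
  assumes s: "s \<in> U" and f: "f \<in> Ysp \<sigma>" and g: "g \<in> Ysp \<sigma>" and x: "x \<in> {0..1}"
  shows "R' s (\<lambda>y. a * f y + g y) x = a * R' s f x + R' s g x"
  unfolding R'_def
proof (rule apriori_unique[OF sg ap[OF s] _ _ _ x,
    where u = "R s (\<lambda>x. (- 1) * nderiv (R s (\<lambda>y. a * f y + g y)) 1 x)"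
      and v = "\<lambda>y. a * R s (\<lambda>x. (- 1) * nderiv (R s f) 1 x) y + R s (\<lambda>x. (- 1) * nderiv (R s g) 1 x) y"])
  have fg: "(\<lambda>y. a * f y + g y) \<in> Ysp \<sigma>" by (rule Ysp_linear[OF sg f g])
  note Y = negative_derivative_Ysp(1)[OF s]
  show "R s (\<lambda>x. (- 1) * nderiv (R s (\<lambda>y. a * f y + g y)) 1 x) \<in> Xsp \<sigma>" by (rule RX[OF s Y[OF fg]])
  show "(\<lambda>y. a * R s (\<lambda>x. (- 1) * nderiv (R s f) 1 x) y + R s (\<lambda>x. (- 1) * nderiv (R s g) 1 x) y) \<in> Xsp \<sigma>"
    by (intro Xsp_linear[OF sg] RX s Y f g)
  fix t :: real assume t: "t \<in> {0<..<1}"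
  then have t': "t \<in> {0..1}" by simp
  have "nderiv (R s (\<lambda>y. a * f y + g y)) 1 t = a * nderiv (R s f) 1 t + nderiv (R s g) 1 t"
    by (rule smooth_derivs_unique[OF smooth_derivs_nderiv[OF Rs[OF s fg]] smooth_derivs_linear[OF Rs[OF s f] Rs[OF s g]] R_linear[OF s f g] t'])
  then show "Lop N lam s (R s (\<lambda>x. (- 1) * nderiv (R s (\<lambda>y. a * f y + g y)) 1 x)) t
     = Lop N lam s (\<lambda>y. a * R s (\<lambda>x. (- 1) * nderiv (R s f) 1 x) y + R s (\<lambda>x. (- 1) * nderiv (R s g) 1 x) y) t"
    unfolding RL[OF s Y[OF fg] t] Lop_linear[OF Rs[OF s Y[OF f]] Rs[OF s Y[OF g]] t'] RL[OF s Y[OF f] t] RL[OF s Y[OF g] t]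
    by (simp add: algebra_simps)
qed

lemma R'_bounded: "s \<in> U \<Longrightarrow> bounded_op \<sigma> (R' s)"
proof -
  assume s: "s \<in> U"
  have "R' s f \<in> Xsp \<sigma>" if "f \<in> Ysp \<sigma>" for f
    unfolding R'_def by (rule RX[OF s negative_derivative_Ysp(1)[OF s that]])
  then show ?thesis unfolding bounded_op_def using R'_linear[OF s] R'_bound[OF s] by blast
qed

text \<open>The resolvent identity: the remainder of the difference quotient solves the equation
  at \<open>s\<close> with right-hand side \<open>- (s - s0) (R' s0 f)'\<close>.\<close>

lemma difference_quotient_bound:
  assumes s: "s \<in> U" and s0: "s0 \<in> U" and ne: "s \<noteq> s0" and f: "f \<in> Ysp \<sigma>"
  shows "Xnorm \<sigma> (\<lambda>x. (R s f x - R s0 f x) / (s - s0) - R' s0 f x) \<le> 4 * C ^ 3 * cmod (s - s0) * Ynorm \<sigma> f"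
proof -
  define c where "c = 1 / (s - s0)"
  define r where "r = R' s0 f"
  let ?p = "\<lambda>x. (- 1) * R s0 f x + R s f x"
  let ?P = "\<lambda>x. (- (s - s0)) * r x + ?p x"
  let ?D = "\<lambda>x. c * ?P x + 0"
  have D: "(\<lambda>x. (R s f x - R s0 f x) / (s - s0) - R' s0 f x) = ?D"
    using ne by (intro ext) (simp add: c_def r_def field_simps)
  have rX: "r \<in> Xsp \<sigma>" unfolding r_def R'_def by (rule RX[OF s0 negative_derivative_Ysp(1)[OF s0 f]])
  have pX: "?p \<in> Xsp \<sigma>" by (intro Xsp_linear[OF sg] RX s s0 f)
  have PX: "?P \<in> Xsp \<sigma>" by (intro Xsp_linear[OF sg] rX pX)
  have DX: "?D \<in> Xsp \<sigma>" by (intro Xsp_linear[OF sg] PX zero_Xsp[OF sg])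
  have sm: "smooth01 r" "smooth01 ?p" "smooth01 ?P" "smooth01 (\<lambda>x. 0)"
    using rX pX PX zero_Xsp[OF sg] by (auto simp: Xsp_iff[OF sg])
  have rY: "nderiv r 1 \<in> Ysp \<sigma>" by (rule derivative_Ysp(1)[OF sg rX])
  have hY: "(\<lambda>x. (- (s - s0)) * nderiv r 1 x) \<in> Ysp \<sigma>" by (rule Ynorm_scale_le(1)[OF sg rY])
  have "\<forall>x\<in>{0<..<1}. Lop N lam s ?D x = (- (s - s0)) * nderiv r 1 x"
  proof
    fix x :: real assume x: "x \<in> {0<..<1}"
    then have x': "x \<in> {0..1}" by simp
    have u0: "Lop N lam s (R s0 f) x = f x + (s - s0) * nderiv (R s0 f) 1 x"
      using Lop_change_s[of N lam s "R s0 f" x s0] RL[OF s0 f x] by simp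
    have r: "Lop N lam s r x = (- 1) * nderiv (R s0 f) 1 x + (s - s0) * nderiv r 1 x"
      using Lop_change_s[of N lam s r x s0] RL[OF s0 negative_derivative_Ysp(1)[OF s0 f] x] unfolding r_def R'_def by simp
    have "Lop N lam s ?D x = c * (- (s - s0) * Lop N lam s r x + ((- 1) * Lop N lam s (R s0 f) x + Lop N lam s (R s f) x)) + 0"
      unfolding Lop_linear[OF sm(3,4) x'] Lop_linear[OF sm(1,2) x'] Lop_linear[OF Rs[OF s0 f] Rs[OF s f] x'] Lop_zero[OF x'] ..
    also have "\<dots> = (- (s - s0)) * nderiv r 1 x"
      unfolding u0 r RL[OF s f x] c_def using ne by (simp add: field_simps)
    finally show "Lop N lam s ?D x = (- (s - s0)) * nderiv r 1 x" .
  qed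
  then have "Xnorm \<sigma> ?D \<le> C * Ynorm \<sigma> (\<lambda>x. (- (s - s0)) * nderiv r 1 x)"
    by (rule aprioriD[OF sg ap[OF s] DX hY])
  \<comment> \<open>The constant \<open>4 * C ^ 3\<close> arises from \<open>C\<close> for solving
    at \<open>s\<close>, 2 for the scaling, and \<open>2 * C^2\<close> for the candidate derivative
    at \<open>s0\<close>.\<close>
  also have "\<dots> \<le> C * (2 * cmod (- (s - s0)) * Ynorm \<sigma> (nderiv r 1))"
    by (intro mult_left_mono C Ynorm_scale_le(2)[OF sg rY])
  also have "\<dots> \<le> C * (2 * cmod (- (s - s0)) * (2 * C\<^sup>2 * Ynorm \<sigma> f))"
    using order_trans[OF derivative_Ysp(2)[OF sg rX] R'_bound[OF s0 f, folded r_def]] by (intro mult_left_mono C) auto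
  also have "\<dots> = 4 * C ^ 3 * cmod (s - s0) * Ynorm \<sigma> f"
    by (simp add: power2_eq_square power3_eq_cube norm_minus_commute)
  finally show ?thesis unfolding D .
qed

lemma holomorphic: "holomorphic_op_family \<sigma> U R"
  unfolding holomorphic_op_family_def
proof (intro conjI ballI)
  show "bounded_op \<sigma> (R s)" if "s \<in> U" for s by (rule R_bounded[OF that])
  fix s0 assume s0: "s0 \<in> U"
  show "\<exists>R'. bounded_op \<sigma> R' \<and> (\<forall>\<epsilon>>0. \<exists>\<delta>>0. \<forall>s\<in>U. 0 < cmod (s - s0) \<and> cmod (s - s0) < \<delta> \<longrightarrow>
           (\<forall>f\<in>Ysp \<sigma>. Xnorm \<sigma> (\<lambda>x. (R s f x - R s0 f x) / (s - s0) - R' f x) \<le> \<epsilon> * Ynorm \<sigma> f))"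
  proof (intro exI[of _ "R' s0"] conjI allI impI R'_bounded[OF s0])
    fix \<epsilon> :: real assume e: "\<epsilon> > 0"
    have C3: "4 * C ^ 3 + 1 > 0" using C by (intro add_nonneg_pos) auto
    show "\<exists>\<delta>>0. \<forall>s\<in>U. 0 < cmod (s - s0) \<and> cmod (s - s0) < \<delta> \<longrightarrow>
           (\<forall>f\<in>Ysp \<sigma>. Xnorm \<sigma> (\<lambda>x. (R s f x - R s0 f x) / (s - s0) - R' s0 f x) \<le> \<epsilon> * Ynorm \<sigma> f)"
    proof (intro exI[of _ "\<epsilon> / (4 * C ^ 3 + 1)"] conjI ballI impI)
      show "\<epsilon> / (4 * C ^ 3 + 1) > 0" using e C3 by simp
      fix s f assume s: "s \<in> U" and sd: "0 < cmod (s - s0) \<and> cmod (s - s0) < \<epsilon> / (4 * C ^ 3 + 1)" and f: "f \<in> Ysp \<sigma>"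
      have "(4 * C ^ 3 + 1) * cmod (s - s0) \<le> \<epsilon>" using sd C3 by (simp add: field_simps)
      then have "4 * C ^ 3 * cmod (s - s0) \<le> \<epsilon>" using norm_ge_zero[of "s - s0"] unfolding distrib_right mult_1 by linarith
      then have "4 * C ^ 3 * cmod (s - s0) * Ynorm \<sigma> f \<le> \<epsilon> * Ynorm \<sigma> f"
        by (intro mult_right_mono Ynorm_nonneg sg f)
      moreover have "s \<noteq> s0" using sd by auto
      ultimately show "Xnorm \<sigma> (\<lambda>x. (R s f x - R s0 f x) / (s - s0) - R' s0 f x) \<le> \<epsilon> * Ynorm \<sigma> f"
        using difference_quotient_bound[OF s s0 _ f] by force
    qed
  qed
qed

end

theorem mainTheorem12:
  fixes \<sigma> :: real and \<Upsilon> :: "complex set"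
  assumes "\<sigma> > 0" and "open \<Upsilon>" and "compact (closure \<Upsilon>)" and "closure \<Upsilon> \<subseteq> Omega \<sigma>"
  shows "\<exists>(N::nat) (lam::real) R.
     (\<forall>s\<in>\<Upsilon>. \<forall>f\<in>Ysp \<sigma>.
        R s f \<in> Xsp \<sigma> \<and> (\<forall>x\<in>{0<..<1}. Lop N lam s (R s f) x = f x) \<and>
        (\<forall>v\<in>Xsp \<sigma>. (\<forall>x\<in>{0<..<1}. Lop N lam s v x = f x) \<longrightarrow> (\<forall>x\<in>{0..1}. v x = R s f x))) \<and>
     holomorphic_op_family \<sigma> \<Upsilon> R"
proof -
  note sg = assms(1)
  obtain b where b: "b > 0" "\<And>s. s \<in> closure \<Upsilon> \<Longrightarrow> cmod s \<le> b"
    using compact_imp_bounded[OF assms(3)] unfolding bounded_pos by blast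
  \<comment> \<open>Shifting by \<open>T\<close> moves every point of the closure to
    \<open>Re s \<ge> 1\<close>, where solvability is known.\<close>
  define T where "T = b + 1"
  have T0: "T \<ge> 0" using b by (simp add: T_def)
  \<comment> \<open>The closure together with the horizontal segments of length \<open>T\<close> to
    its right: \<open>N\<close>, \<open>lam\<close> and \<open>C\<close> must stay the same along
    each path of continuation.\<close>
  define K where "K = (\<lambda>p. fst p + complex_of_real (snd p)) ` (closure \<Upsilon> \<times> {0..T})"
  have "compact K" unfolding K_def
    by (intro compact_continuous_image compact_Times assms(3) continuous_intros) auto
  moreover have "K \<subseteq> good \<sigma>"
    unfolding K_def using assms(4) Omega_subset_good[OF sg] by (auto intro!: good_add_nonneg)
  ultimately obtain N lam C where C: "C \<ge> 0" "\<And>s. s \<in> K \<Longrightarrow> apriori \<sigma> N lam C s"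
    "\<And>s. s \<in> K \<Longrightarrow> Re s \<ge> 1 \<Longrightarrow> solvable \<sigma> N lam s"
    using uniform_resolvent_bounds[OF sg] by metis
  have inK: "s + of_real t \<in> K" if "s \<in> \<Upsilon>" "0 \<le> t" "t \<le> T" for s t
    unfolding K_def using that closure_subset by (intro image_eqI[of _ _ "(s, t)"]) auto
  have ap: "apriori \<sigma> N lam C s" if "s \<in> \<Upsilon>" for s using C(2)[OF inK[OF that, of 0]] T0 by simp
  have sol: "solvable \<sigma> N lam s" if s: "s \<in> \<Upsilon>" for s
  proof (rule solvable_continuation[OF sg _ T0 C(1)])
    have "- b \<le> Re s" using abs_Re_le_cmod[of s] b(2)[of s] s closure_subset by fastforce
    then show "solvable \<sigma> N lam (s + of_real T)" using T0 by (intro C(3) inK s) (auto simp: T_def)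
    show "apriori \<sigma> N lam C (s + of_real t)" if "0 \<le> t" "t \<le> T" for t by (intro C(2) inK s that)
  qed
  define R where "R s f = (SOME u. u \<in> Xsp \<sigma> \<and> (\<forall>x\<in>{0<..<1}. Lop N lam s u x = f x))" for s f
  have R: "R s f \<in> Xsp \<sigma> \<and> (\<forall>x\<in>{0<..<1}. Lop N lam s (R s f) x = f x)" if "s \<in> \<Upsilon>" "f \<in> Ysp \<sigma>" for s f
  proof -
    have "\<exists>u. u \<in> Xsp \<sigma> \<and> (\<forall>x\<in>{0<..<1}. Lop N lam s u x = f x)"
      using sol[OF that(1)] that(2) unfolding solvable_def[OF sg] by blast
    from someI_ex[OF this] show ?thesis unfolding R_def .
  qed
  interpret resolvent_family \<sigma> N lam C \<Upsilon> R
    using sg C(1) ap R by unfold_locales auto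
  show ?thesis
  proof (intro exI[of _ N] exI[of _ lam] exI[of _ R] conjI ballI impI holomorphic)
    fix s f assume s: "s \<in> \<Upsilon>" and f: "f \<in> Ysp \<sigma>"
    show "R s f \<in> Xsp \<sigma>" by (rule RX[OF s f])
    show "Lop N lam s (R s f) x = f x" if "x \<in> {0<..<1}" for x by (rule RL[OF s f that])
    fix v x assume v: "v \<in> Xsp \<sigma>" "\<forall>x\<in>{0<..<1}. Lop N lam s v x = f x" and x: "x \<in> {0..1::real}"
    show "v x = R s f x"
      by (rule apriori_unique[OF sg ap[OF s] v(1) RX[OF s f] _ x]) (use v(2) RL[OF s f] in simp)
  qed
qed

end
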